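(* Given two functional vset-automata $A_1$ and $A_2$, each with $O(n)$ states and $O(v)$ variables, one can construct in time $O(vn^4)$ a functional vset-automaton $A$ with $[\![A_1\bowtie A_2]\!]=[\![A]\!]$.
   Context: Strings and spans. $\Sigma$ is a fixed finite alphabet with $|\Sigma|\ge 2$. A span of $\mathbf{s}=\sigma_1\cdots\sigma_\ell\in\Sigma^*$ is an expression $[i,j\rangle$ with $1\le i\le j\le \ell+1$. $\mathsf{Vars}$ is an infinite set of variables, disjoint from $\Sigma$. For finite $V\subset\mathsf{Vars}$, a $(V,\mathbf{s})$-tuple is a function from $V$ to the spans of $\mathbf{s}$; a spanner $P$ with finite variable set $\mathsf{Vars}(P)=V$ maps each $\mathbf{s}\in\Sigma^*$ to a set $P(\mathbf{s})$ of $(V,\mathbf{s})$-tuples. Ref-words. For finite $V\subset\mathsf{Vars}$ let $\Gamma_V=\{x{\vdash},\ {\dashv}x \mid x\in V\}$, disjoint from $\Sigma$. A word $\mathbf{r}\in(\Sigma\cup\Gamma_V)^*$ is valid for $V$ if for each $x\in V$ it contains exactly one $x{\vdash}$ and exactly one ${\dashv}x$, the former to the left of the latter. $\mathsf{clr}$ is the morphism erasing $\Gamma_V$ and fixing $\Sigma$. A valid $\mathbf{r}$ with $\mathsf{clr}(\mathbf{r})=\mathbf{s}$ defines the $(V,\mathbf{s})$-tuple $\mu^{\mathbf{r}}$: writing $\mathbf{r}=\mathbf{r}'_x\, x{\vdash}\,\mathbf{r}_x\,{\dashv}x\,\mathbf{r}''_x$, $\mu^{\mathbf{r}}(x)=[i,j\rangle$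 with $i=|\mathsf{clr}(\mathbf{r}'_x)|+1$, $j=i+|\mathsf{clr}(\mathbf{r}_x)|$. Vset-automata. A vset-automaton is a tuple $A=(V,Q,q_0,q_f,\delta)$ with $\mathsf{Vars}(A)=V\subset\mathsf{Vars}$ finite, $Q$ a finite set of states, $q_0,q_f\in Q$ initial and final states, and $\delta\colon Q\times(\Sigma\cup\{\epsilon\}\cup\Gamma_V)\to 2^Q$. $\mathcal{R}(A)$ is the set of words over $\Sigma\cup\Gamma_V$ accepted by $A$ viewed as an $\epsilon$-NFA. $[\![A]\!]$ is the spanner with variables $V$ and $[\![A]\!](\mathbf{s})=\{\mu^{\mathbf{r}}\mid\mathbf{r}\in\mathcal{R}(A)\text{ valid for }V,\ \mathsf{clr}(\mathbf{r})=\mathbf{s}\}$. $A$ is functional if every word in $\mathcal{R}(A)$ is valid for $V$. Natural join: $[\![A_1\bowtie A_2]\!]$ has variables $\mathsf{Vars}(A_1)\cup\mathsf{Vars}(A_2)$, and $[\![A_1\bowtie A_2]\!](\mathbf{s})$ is the set of all $(\mathsf{Vars}(A_1)\cup\mathsf{Vars}(A_2),\mathbf{s})$-tuples $\mu$ with $\mu|_{\mathsf{Vars}(A_i)}\in[\![A_i]\!](\mathbf{s})$ for $i=1,2$. Running times are in the unit-cost RAM model with machine words of size logarithmic in the input size. *)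

theory Defs
  imports Complex_Main "HOL-Library.Log_Nat"
begin

section \<open>Spans, tuples and spanners\<close>

text \<open>
  The alphabet is the type \<open>'a\<close>, the set of variables is the type \<open>'x\<close>.
  The pair \<open>(i, j)\<close> stands for the span \<open>[i, j\<rangle>\<close>; positions start at 1.
  A tuple over \<open>V\<close> is a partial map with domain \<open>V\<close>.
\<close>

type_synonym span = "nat \<times> nat"

type_synonym 'x span_tuple = "'x \<rightharpoonup> span"

definition spans :: "'a list \<Rightarrow> span set" where
  "spans s = {(i, j). 1 \<le> i \<and> i \<le> j \<and> j \<le> length s + 1}"

definition tuples :: "'x set \<Rightarrow> 'a list \<Rightarrow> 'x span_tuple set" where
  "tuples V s = {\<mu>. dom \<mu> = V \<and> ran \<mu> \<subseteq> spans s}"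

text \<open>
  A spanner carries its variable set, so that equality of spanners includes equality
  of their variables.
\<close>

type_synonym ('a, 'x) spanner = "'x set \<times> ('a list \<Rightarrow> 'x span_tuple set)"

definition join :: "('a, 'x) spanner \<Rightarrow> ('a, 'x) spanner \<Rightarrow> ('a, 'x) spanner" where
  "join P1 P2 =
    (fst P1 \<union> fst P2,
     \<lambda>s. {\<mu> \<in> tuples (fst P1 \<union> fst P2) s. \<mu> |` fst P1 \<in> snd P1 s \<and> \<mu> |` fst P2 \<in> snd P2 s})"

section \<open>Ref-words\<close>

text \<open>\<open>Open x\<close> and \<open>Close x\<close> are the two variable operations of \<open>x\<close>.\<close>

datatype ('a, 'x) symbol = Letter 'a | Open 'x | Close 'x

definition symbols :: "'x set \<Rightarrow> ('a, 'x) symbol set" where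
  "symbols V = range Letter \<union> Open ` V \<union> Close ` V"

fun clr :: "('a, 'x) symbol list \<Rightarrow> 'a list" where
  "clr [] = []"
| "clr (Letter a # r) = a # clr r"
| "clr (Open x # r) = clr r"
| "clr (Close x # r) = clr r"

definition valid :: "'x set \<Rightarrow> ('a, 'x) symbol list \<Rightarrow> bool" where
  "valid V r \<longleftrightarrow> set r \<subseteq> symbols V \<and>
    (\<forall>x\<in>V. count_list r (Open x) = 1 \<and> count_list r (Close x) = 1 \<and>
      (\<exists>r1 r2 r3. r = r1 @ Open x # r2 @ Close x # r3))"

text \<open>
  If \<open>r = r1 @ Open x # r2 @ Close x # r3\<close> is valid, then the two words
  \<open>takeWhile \<dots>\<close> below are \<open>r1\<close> and \<open>r2\<close>.
\<close>

definition span_of :: "('a, 'x) symbol list \<Rightarrow> 'x \<Rightarrow> span" where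
  "span_of r x =
    (let r1 = takeWhile (\<lambda>y. y \<noteq> Open x) r;
         r2 = takeWhile (\<lambda>y. y \<noteq> Close x) (tl (dropWhile (\<lambda>y. y \<noteq> Open x) r));
         i = length (clr r1) + 1
     in (i, i + length (clr r2)))"

definition tuple_of :: "'x set \<Rightarrow> ('a, 'x) symbol list \<Rightarrow> 'x span_tuple" where
  "tuple_of V r = (\<lambda>x. if x \<in> V then Some (span_of r x) else None)"

section \<open>Vset-automata\<close>

text \<open>In transition labels, \<open>None\<close> is the empty word.\<close>

record ('a, 'x, 'q) vset_automaton =
  vars :: "'x set"
  states :: "'q set"
  initial :: 'q
  final :: 'q
  delta :: "'q \<Rightarrow> ('a, 'x) symbol option \<Rightarrow> 'q set"

text \<open>The transition function is extended by the empty set outside its proper domain.\<close>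

definition vset_automaton :: "('a, 'x, 'q) vset_automaton \<Rightarrow> bool" where
  "vset_automaton A \<longleftrightarrow>
    finite (vars A) \<and> finite (states A) \<and> initial A \<in> states A \<and> final A \<in> states A \<and>
    (\<forall>p l q. q \<in> delta A p l \<longrightarrow>
      p \<in> states A \<and> q \<in> states A \<and> l \<in> insert None (Some ` symbols (vars A)))"

inductive path :: "('a, 'x, 'q) vset_automaton \<Rightarrow> 'q \<Rightarrow> ('a, 'x) symbol list \<Rightarrow> 'q \<Rightarrow> bool"
  for A where
  path_Nil: "path A p [] p"
| path_eps: "q \<in> delta A p None \<Longrightarrow> path A q r q' \<Longrightarrow> path A p r q'"
| path_symbol: "q \<in> delta A p (Some y) \<Longrightarrow> path A q r q' \<Longrightarrow> path A p (y # r) q'"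

definition ref_words :: "('a, 'x, 'q) vset_automaton \<Rightarrow> ('a, 'x) symbol list set" where
  "ref_words A = {r. path A (initial A) r (final A)}"

definition spanner_of :: "('a, 'x, 'q) vset_automaton \<Rightarrow> ('a, 'x) spanner" where
  "spanner_of A =
    (vars A, \<lambda>s. {tuple_of (vars A) r |r. r \<in> ref_words A \<and> valid (vars A) r \<and> clr r = s})"

definition functional :: "('a, 'x, 'q) vset_automaton \<Rightarrow> bool" where
  "functional A \<longleftrightarrow> (\<forall>r \<in> ref_words A. valid (vars A) r)"

section \<open>Unit-cost RAM with \<open>w\<close>-bit words\<close>

text \<open>
  Registers and memory cells hold numbers below \<open>2 ^ w\<close>. Arithmetic is modulo \<open>2 ^ w\<close>,
  except that subtraction is cut off at 0. Operands are register numbers, apart from the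
  constant in \<open>Const\<close> and the jump targets; memory is accessed only indirectly, at the
  address contained in a register.
\<close>

datatype instr =
  Const nat nat
| Move nat nat
| Add nat nat nat
| Sub nat nat nat
| Mult nat nat nat
| Load nat nat
| Store nat nat
| Jump nat
| JumpZero nat nat

record config =
  pc :: nat
  reg :: "nat \<Rightarrow> nat"
  mem :: "nat \<Rightarrow> nat"

definition set_reg :: "nat \<Rightarrow> nat \<Rightarrow> config \<Rightarrow> config" where
  "set_reg i x c = c\<lparr>pc := Suc (pc c), reg := (reg c)(i := x)\<rparr>"

fun exec :: "nat \<Rightarrow> instr \<Rightarrow> config \<Rightarrow> config" where
  "exec w (Const i x) c = set_reg i (x mod 2 ^ w) c"
| "exec w (Move i j) c = set_reg i (reg c j) c"
| "exec w (Add i j l) c = set_reg i ((reg c j + reg c l) mod 2 ^ w) c"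
| "exec w (Sub i j l) c = set_reg i (reg c j - reg c l) c"
| "exec w (Mult i j l) c = set_reg i ((reg c j * reg c l) mod 2 ^ w) c"
| "exec w (Load i j) c = set_reg i (mem c (reg c j)) c"
| "exec w (Store i j) c = c\<lparr>pc := Suc (pc c), mem := (mem c)(reg c i := reg c j)\<rparr>"
| "exec w (Jump t) c = c\<lparr>pc := t\<rparr>"
| "exec w (JumpZero i t) c = c\<lparr>pc := (if reg c i = 0 then t else Suc (pc c))\<rparr>"

definition halted :: "instr list \<Rightarrow> config \<Rightarrow> bool" where
  "halted P c \<longleftrightarrow> length P \<le> pc c"

definition step :: "nat \<Rightarrow> instr list \<Rightarrow> config \<Rightarrow> config" where
  "step w P c = (if halted P c then c else exec w (P ! pc c) c)"

text \<open>
  The input occupies the memory from address 0 on; all other cells and all registers are 0.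
  On termination, register 0 holds the address and register 1 the length of the output.
\<close>

definition init :: "nat list \<Rightarrow> config" where
  "init xs = \<lparr>pc = 0, reg = (\<lambda>_. 0), mem = (\<lambda>i. if i < length xs then xs ! i else 0)\<rparr>"

definition result :: "config \<Rightarrow> nat list" where
  "result c = map (mem c) [reg c 0 ..< reg c 0 + reg c 1]"

text \<open>
  \<open>computes_within w P xs T ys\<close>: input \<open>xs\<close> fits into a memory of \<open>w\<close>-bit words with
  \<open>w\<close>-bit addresses, and program \<open>P\<close> halts on it after at most \<open>T\<close> steps with output \<open>ys\<close>.
\<close>

definition computes_within :: "nat \<Rightarrow> instr list \<Rightarrow> nat list \<Rightarrow> nat \<Rightarrow> nat list \<Rightarrow> bool" where
  "computes_within w P xs T ys \<longleftrightarrow>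
    length xs \<le> 2 ^ w \<and> (\<forall>x \<in> set xs. x < 2 ^ w) \<and>
    (\<exists>t \<le> T. let c = (step w P ^^ t) (init xs) in
      halted P c \<and> reg c 0 + reg c 1 \<le> 2 ^ w \<and> result c = ys)"

section \<open>Automata as sequences of words\<close>

text \<open>
  For the machine, variables and states are natural numbers, and letters are represented
  through an injection \<open>code\<close>. An automaton is given by lists, in any order and without
  repetitions, of its states, its variables and its transitions.
\<close>

fun encode_label :: "('a \<Rightarrow> nat) \<Rightarrow> ('a, nat) symbol option \<Rightarrow> nat list" where
  "encode_label code None = [0, 0]"
| "encode_label code (Some (Letter a)) = [1, code a]"
| "encode_label code (Some (Open x)) = [2, x]"
| "encode_label code (Some (Close x)) = [3, x]"

definition encodes ::
    "('a \<Rightarrow> nat) \<Rightarrow> ('a, nat, nat) vset_automaton \<Rightarrow> nat list \<Rightarrow> bool" where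
  "encodes code A xs \<longleftrightarrow>
    (\<exists>qs vs ts.
      distinct qs \<and> set qs = states A \<and>
      distinct vs \<and> set vs = vars A \<and>
      distinct ts \<and> set ts = {(p, l, q). q \<in> delta A p l} \<and>
      xs = [length qs, length vs, length ts, initial A, final A] @ qs @ vs @
           concat (map (\<lambda>(p, l, q). p # encode_label code l @ [q]) ts))"

end

theory Submission
  imports Defs
begin

text \<open>
  In a functional automaton, all letterless paths between two fixed states that lie on an
  accepting path perform the same variable operations, each of them once. Hence the states
  may be paired as in the product construction for NFAs: the pairs move in lockstep on
  letters, and between two letters the join automaton may pass from \<open>(p1, p2)\<close> to \<open>(q1, q2)\<close>
  whenever there are letterless paths from \<open>p1\<close> to \<open>q1\<close> and from \<open>p2\<close> to \<open>q2\<close> that agree on the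
  common variables. It then performs the operations of both paths in a fixed order, all
  \<open>Open\<close> before all \<open>Close\<close>, which does not change the tuple. There are \<open>O(n\<^sup>4)\<close> such
  quadruples, each with a chain of \<open>O(v)\<close> transitions, and \<open>O(v n\<^sup>4)\<close> transitions on letters,
  because an automaton has \<open>O(n\<^sup>2)\<close> transitions on letters and \<open>O(v n\<^sup>2)\<close> altogether. Letterless
  reachability is found by Warshall's algorithm in time \<open>O(n\<^sup>3)\<close>.

  Functions of up to five words are tabulated in memory at addresses computed from their
  arguments in a base exceeding all input words; since the memory is initially zero, no
  time is spent on initializing the tables. The program is written in a language of bounded
  loops, whose compilation to the machine preserves the step counts.
\<close>

section \<open>A loop language and its compilation to the RAM\<close>

text \<open>Functionality fixes the operations of a letterless path because such a path, lying on an
  accepting one, may be exchanged for any other between the same states, and the new word must again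
  contain every operation exactly once. Otherwise sets of pending operations would have to be stored
  in the states. The bound rests on two choices. An operation occurs on a letterless path from
  \<open>p\<close> to \<open>q\<close> exactly if one of its transitions starts at a state reachable
  from \<open>p\<close> and ends at a state from which \<open>q\<close> is reachable; running over
  transitions and pairs of states gives this table in \<open>O(v n^4)\<close>. On letters, only the
  \<open>O(n^2)\<close> letter transitions of the first automaton are combined with all
  \<open>O(v n^2)\<close> transitions of the second; combining all with all would cost another
  factor \<open>v\<close>. The tables span \<open>W^6\<close> addresses, more than the time bound
  allows to visit, but each address still fits into \<open>O(log N)\<close> bits, since
  \<open>W\<close> is polynomial in the input length \<open>N\<close>. The same positional code
  names the output states, so no table of names is kept.\<close>

datatype exp = Num nat | Var nat | Plus exp exp | Minus exp exp | Times exp exp | Deref exp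

text \<open>
  \<open>For r h e1 e2 c\<close> runs \<open>c\<close> with register \<open>r\<close> ranging from \<open>e1\<close> to \<open>e2 - 1\<close>; the bound
  is evaluated once and kept in register \<open>h\<close>.
\<close>

datatype com =
  Skip
| Assign nat exp
| Write exp exp
| Seq com com (infixr ";;" 60)
| Cond exp com com
| For nat nat exp exp com

type_synonym store = "(nat \<Rightarrow> nat) \<times> (nat \<Rightarrow> nat)"

fun ev :: "exp \<Rightarrow> store \<Rightarrow> nat" where
  "ev (Num x) s = x"
| "ev (Var r) s = fst s r"
| "ev (Plus e e') s = ev e s + ev e' s"
| "ev (Minus e e') s = ev e s - ev e' s"
| "ev (Times e e') s = ev e s * ev e' s"
| "ev (Deref e) s = snd s (ev e s)"

text \<open>The last pass is split off, so facts about the first \<open>k\<close> passes follow by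
  induction on \<open>k\<close>. The counter is set anew before each pass; the machine merely
  increments it, with the same effect because \<open>wf_com\<close> forbids the body to write
  it.\<close>

fun loop :: "(store \<Rightarrow> store) \<Rightarrow> nat \<Rightarrow> nat \<Rightarrow> nat \<Rightarrow> store \<Rightarrow> store" where
  "loop f r l 0 s = s"
| "loop f r l (Suc k) s = (let s' = loop f r l k s in f ((fst s')(r := l + k), snd s'))"

text \<open>A loop leaves its counter at \<open>max l u\<close>: the compiled code tests
  \<open>u - l = 0\<close> before the first pass, so for \<open>l \<ge> u\<close> the counter keeps
  the value \<open>l\<close>.\<close>

fun run :: "com \<Rightarrow> store \<Rightarrow> store" where
  "run Skip s = s"
| "run (Assign r e) s = ((fst s)(r := ev e s), snd s)"
| "run (Write e e') s = (fst s, (snd s)(ev e s := ev e' s))"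
| "run (c1 ;; c2) s = run c2 (run c1 s)"
| "run (Cond e c1 c2) s = (if ev e s \<noteq> 0 then run c1 s else run c2 s)"
| "run (For r h e1 e2 c) s =
    (let l = ev e1 s; u = ev e2 s;
         s' = loop (run c) r l (u - l) ((fst s)(h := u), snd s)
     in ((fst s')(r := max l u), snd s'))"

text \<open>The numbers of machine steps of the compiled code.\<close>

fun ecost :: "exp \<Rightarrow> nat" where
  "ecost (Num x) = 1"
| "ecost (Var r) = 1"
| "ecost (Plus e e') = ecost e + ecost e' + 1"
| "ecost (Minus e e') = ecost e + ecost e' + 1"
| "ecost (Times e e') = ecost e + ecost e' + 1"
| "ecost (Deref e) = ecost e + 1"

fun cost :: "com \<Rightarrow> store \<Rightarrow> nat" where
  "cost Skip s = 0"
| "cost (Assign r e) s = ecost e + 1"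
| "cost (Write e e') s = ecost e + ecost e' + 1"
| "cost (c1 ;; c2) s = cost c1 s + cost c2 (run c1 s)"
| "cost (Cond e c1 c2) s = ecost e + 2 + (if ev e s \<noteq> 0 then cost c1 s else cost c2 s)"
| "cost (For r h e1 e2 c) s =
    (let l = ev e1 s; u = ev e2 s; s0 = ((fst s)(h := u), snd s)
     in ecost e1 + ecost e2 + 4 +
        (\<Sum>k<u - l. cost c ((fst (loop (run c) r l k s0))(r := l + k), snd (loop (run c) r l k s0)) + 5))"

text \<open>\<open>esafe B\<close> and \<open>safe B\<close>: all computed numbers are below \<open>B\<close>.\<close>

fun esafe :: "nat \<Rightarrow> exp \<Rightarrow> store \<Rightarrow> bool" where
  "esafe B (Num x) s \<longleftrightarrow> x < B"
| "esafe B (Var r) s \<longleftrightarrow> True"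
| "esafe B (Plus e e') s \<longleftrightarrow> esafe B e s \<and> esafe B e' s \<and> ev e s + ev e' s < B"
| "esafe B (Minus e e') s \<longleftrightarrow> esafe B e s \<and> esafe B e' s"
| "esafe B (Times e e') s \<longleftrightarrow> esafe B e s \<and> esafe B e' s \<and> ev e s * ev e' s < B"
| "esafe B (Deref e) s \<longleftrightarrow> esafe B e s"

fun safe :: "nat \<Rightarrow> com \<Rightarrow> store \<Rightarrow> bool" where
  "safe B Skip s \<longleftrightarrow> True"
| "safe B (Assign r e) s \<longleftrightarrow> esafe B e s"
| "safe B (Write e e') s \<longleftrightarrow> esafe B e s \<and> esafe B e' s"
| "safe B (c1 ;; c2) s \<longleftrightarrow> safe B c1 s \<and> safe B c2 (run c1 s)"
| "safe B (Cond e c1 c2) s \<longleftrightarrow> esafe B e s \<and> (if ev e s \<noteq> 0 then safe B c1 s else safe B c2 s)"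
| "safe B (For r h e1 e2 c) s \<longleftrightarrow>
    (let l = ev e1 s; u = ev e2 s; s0 = ((fst s)(h := u), snd s)
     in 1 < B \<and> esafe B e1 s \<and> esafe B e2 s \<and> u < B \<and>
        (\<forall>k<u - l. safe B c ((fst (loop (run c) r l k s0))(r := l + k), snd (loop (run c) r l k s0))))"

fun ereads :: "exp \<Rightarrow> nat set" where
  "ereads (Num x) = {}"
| "ereads (Var r) = {r}"
| "ereads (Plus e e') = ereads e \<union> ereads e'"
| "ereads (Minus e e') = ereads e \<union> ereads e'"
| "ereads (Times e e') = ereads e \<union> ereads e'"
| "ereads (Deref e) = ereads e"

fun writes :: "com \<Rightarrow> nat set" where
  "writes Skip = {}"
| "writes (Assign r e) = {r}"
| "writes (Write e e') = {}"
| "writes (c1 ;; c2) = writes c1 \<union> writes c2"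
| "writes (Cond e c1 c2) = writes c1 \<union> writes c2"
| "writes (For r h e1 e2 c) = {r, h} \<union> writes c"

text \<open>Registers from \<open>z\<close> on serve as evaluation stack of the compiled code.\<close>

fun wf_com :: "nat \<Rightarrow> com \<Rightarrow> bool" where
  "wf_com z Skip \<longleftrightarrow> True"
| "wf_com z (Assign r e) \<longleftrightarrow> r < z \<and> ereads e \<subseteq> {..<z}"
| "wf_com z (Write e e') \<longleftrightarrow> ereads e \<subseteq> {..<z} \<and> ereads e' \<subseteq> {..<z}"
| "wf_com z (c1 ;; c2) \<longleftrightarrow> wf_com z c1 \<and> wf_com z c2"
| "wf_com z (Cond e c1 c2) \<longleftrightarrow> ereads e \<subseteq> {..<z} \<and> wf_com z c1 \<and> wf_com z c2"
| "wf_com z (For r h e1 e2 c) \<longleftrightarrow> r < z \<and> h < z \<and> r \<noteq> h \<and> r \<notin> writes c \<and> h \<notin> writes c \<and>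
    ereads e1 \<subseteq> {..<z} \<and> ereads e2 \<subseteq> {..<z} \<and> wf_com z c"

fun comp_exp :: "nat \<Rightarrow> exp \<Rightarrow> instr list" where
  "comp_exp t (Num x) = [Const t x]"
| "comp_exp t (Var r) = [Move t r]"
| "comp_exp t (Plus e e') = comp_exp t e @ comp_exp (Suc t) e' @ [Add t t (Suc t)]"
| "comp_exp t (Minus e e') = comp_exp t e @ comp_exp (Suc t) e' @ [Sub t t (Suc t)]"
| "comp_exp t (Times e e') = comp_exp t e @ comp_exp (Suc t) e' @ [Mult t t (Suc t)]"
| "comp_exp t (Deref e) = comp_exp t e @ [Load t t]"

fun csize :: "com \<Rightarrow> nat" where
  "csize Skip = 0"
| "csize (Assign r e) = ecost e + 1"
| "csize (Write e e') = ecost e + ecost e' + 1"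
| "csize (c1 ;; c2) = csize c1 + csize c2"
| "csize (Cond e c1 c2) = ecost e + csize c1 + csize c2 + 2"
| "csize (For r h e1 e2 c) = ecost e1 + ecost e2 + csize c + 7"

text \<open>Jump targets are absolute, hence the load address \<open>p\<close> as an argument. In a
  loop, \<open>q\<close> is the address of the test. Test, increment and jump back are the 5 steps
  per pass charged by \<open>cost\<close>; the two moves before \<open>q\<close> and the last test
  are its constant 4.\<close>

fun compile :: "nat \<Rightarrow> nat \<Rightarrow> com \<Rightarrow> instr list" where
  "compile z p Skip = []"
| "compile z p (Assign r e) = comp_exp z e @ [Move r z]"
| "compile z p (Write e e') = comp_exp z e @ comp_exp (Suc z) e' @ [Store z (Suc z)]"
| "compile z p (c1 ;; c2) = compile z p c1 @ compile z (p + csize c1) c2"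
| "compile z p (Cond e c1 c2) =
    (let p1 = p + ecost e + 1; p2 = p1 + csize c1 + 1
     in comp_exp z e @ [JumpZero z p2] @ compile z p1 c1 @ [Jump (p2 + csize c2)] @ compile z p2 c2)"
| "compile z p (For r h e1 e2 c) =
    (let q = p + ecost e1 + ecost e2 + 2; u = q + csize c + 5
     in comp_exp z e1 @ comp_exp (Suc z) e2 @ [Move r z, Move h (Suc z), Sub z h r, JumpZero z u] @
        compile z (q + 2) c @ [Const z 1, Add r r z, Jump q])"

section \<open>Correctness and step counts of the compiled code\<close>

lemma length_comp_exp [simp]: "length (comp_exp t e) = ecost e"
  by (induction e arbitrary: t) auto

lemma length_comp [simp]: "length (compile z p c) = csize c"
  by (induction c arbitrary: p) (auto simp: Let_def)

lemma ev_cong: "(\<And>r. r \<in> ereads e \<Longrightarrow> f r = g r) \<Longrightarrow> ev e (f, m) = ev e (g, m)"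
  by (induction e) auto

lemma esafe_cong: "(\<And>r. r \<in> ereads e \<Longrightarrow> f r = g r) \<Longrightarrow> esafe B e (f, m) = esafe B e (g, m)"
  by (induction e) (auto simp: ev_cong[of _ f g])

lemma loop_unchanged:
  assumes "\<And>s. fst (f s) x = fst s x" "x \<noteq> r"
  shows "fst (loop f r l k s) x = fst s x"
  using assms by (induction k) (auto simp: Let_def)

lemma run_unchanged: "x \<notin> writes c \<Longrightarrow> fst (run c s) x = fst s x"
  by (induction c arbitrary: s) (auto simp: Let_def loop_unchanged)

definition code_at :: "instr list \<Rightarrow> nat \<Rightarrow> instr list \<Rightarrow> bool" where
  "code_at P p is \<longleftrightarrow> p + length is \<le> length P \<and> (\<forall>i<length is. P ! (p + i) = is ! i)"

lemma code_at_append [simp]: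
  "code_at P p (xs @ ys) \<longleftrightarrow> code_at P p xs \<and> code_at P (p + length xs) ys"
proof
  assume a: "code_at P p (xs @ ys)"
  show "code_at P p xs \<and> code_at P (p + length xs) ys"
    unfolding code_at_def
  proof (intro conjI allI impI)
    fix i assume i: "i < length xs"
    then have "P ! (p + i) = (xs @ ys) ! i" using a unfolding code_at_def by auto
    then show "P ! (p + i) = xs ! i" using i by (simp add: nth_append)
  next
    fix i assume i: "i < length ys"
    then have "P ! (p + (length xs + i)) = (xs @ ys) ! (length xs + i)"
      using a unfolding code_at_def by auto
    then show "P ! (p + length xs + i) = ys ! i" by (simp add: nth_append add.assoc)
  qed (use a in \<open>auto simp: code_at_def\<close>)
next
  assume a: "code_at P p xs \<and> code_at P (p + length xs) ys"
  have "P ! (p + i) = (xs @ ys) ! i" if "i < length xs + length ys" for i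
  proof (cases "i < length xs")
    case False
    then obtain j where "i = length xs + j" using le_Suc_ex linorder_not_less by metis
    then show ?thesis using a that by (auto simp: code_at_def nth_append add.assoc)
  qed (use a in \<open>auto simp: code_at_def nth_append\<close>)
  then show "code_at P p (xs @ ys)" using a by (auto simp: code_at_def)
qed

lemma code_at_Cons [simp]:
  "code_at P p (i # is) \<longleftrightarrow> p < length P \<and> P ! p = i \<and> code_at P (Suc p) is"
  using code_at_append[of P p "[i]" "is"] by (auto simp: code_at_def)

lemma code_at_Nil [simp]: "code_at P p [] \<longleftrightarrow> p \<le> length P"
  by (simp add: code_at_def)

definition steps :: "nat \<Rightarrow> instr list \<Rightarrow> nat \<Rightarrow> config \<Rightarrow> config \<Rightarrow> bool" where
  "steps w P t c c' \<longleftrightarrow> (step w P ^^ t) c = c'"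

lemma steps_refl: "steps w P 0 c c"
  by (simp add: steps_def)

lemma steps_trans: "steps w P t c c' \<Longrightarrow> steps w P t' c' c'' \<Longrightarrow> steps w P (t + t') c c''"
  by (auto simp: steps_def funpow_add add.commute[of t t'])

lemma steps_one: "pc c < length P \<Longrightarrow> exec w (P ! pc c) c = c' \<Longrightarrow> steps w P (Suc 0) c c'"
  by (simp add: steps_def step_def halted_def)

lemma steps_snoc:
  "steps w P t c c' \<Longrightarrow> pc c' < length P \<Longrightarrow> exec w (P ! pc c') c' = c'' \<Longrightarrow> steps w P (Suc t) c c''"
  using steps_trans[OF _ steps_one] by fastforce

abbreviation conf :: "nat \<Rightarrow> (nat \<Rightarrow> nat) \<Rightarrow> (nat \<Rightarrow> nat) \<Rightarrow> config" where
  "conf p f m \<equiv> \<lparr>pc = p, reg = f, mem = m\<rparr>"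

text \<open>Stack discipline: evaluation at height \<open>t\<close> leaves all registers below
  \<open>t\<close> alone, so the first operand in register \<open>t\<close> survives the evaluation
  of the second at height \<open>Suc t\<close>. Safety makes the reduction modulo
  \<open>2 ^ w\<close> the identity.\<close>

lemma comp_exp_correct:
  assumes "code_at P p (comp_exp t e)" "ereads e \<subseteq> {..<t}" "esafe (2 ^ w) e (f, m)"
  shows "\<exists>g. steps w P (ecost e) (conf p f m) (conf (p + ecost e) g m) \<and>
    g t = ev e (f, m) \<and> (\<forall>r<t. g r = f r)"
  using assms
proof (induction e arbitrary: p t f)
  case (Num x)
  then show ?case
    by (intro exI[of _ "f(t := x)"]) (auto intro!: steps_one simp: set_reg_def fun_upd_def)
next
  case (Var r)
  then show ?case
    by (intro exI[of _ "f(t := f r)"]) (auto intro!: steps_one simp: set_reg_def fun_upd_def)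
next
  case (Deref e)
  then obtain g where g: "steps w P (ecost e) (conf p f m) (conf (p + ecost e) g m)"
      "g t = ev e (f, m)" "\<forall>r<t. g r = f r"
    by (auto simp: Let_def) blast
  show ?case
    by (rule exI[of _ "g(t := m (g t))"])
      (use g Deref.prems in \<open>auto intro!: steps_snoc[OF g(1)] simp: set_reg_def fun_upd_def\<close>)
next
  case (Plus e e')
  obtain g where g: "steps w P (ecost e) (conf p f m) (conf (p + ecost e) g m)"
      "g t = ev e (f, m)" "\<forall>r<t. g r = f r"
    using Plus.IH(1)[of p t f] Plus.prems by auto
  have e': "ereads e' \<subseteq> {..<Suc t}" using Plus.prems by auto
  have c: "ev e' (g, m) = ev e' (f, m)" "esafe (2 ^ w) e' (g, m) = esafe (2 ^ w) e' (f, m)"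
    by (rule ev_cong esafe_cong, use Plus.prems g(3) in \<open>force\<close>)+
  obtain g' where g': "steps w P (ecost e') (conf (p + ecost e) g m) (conf (p + ecost e + ecost e') g' m)"
      "g' (Suc t) = ev e' (f, m)" "\<forall>r<Suc t. g' r = g r"
    using Plus.IH(2)[of "p + ecost e" "Suc t" g] Plus.prems e' c by auto
  show ?case
    by (rule exI[of _ "g'(t := g' t + g' (Suc t))"])
      (use g g' Plus.prems in \<open>auto intro!: steps_snoc[OF steps_trans[OF g(1) g'(1)]] simp: set_reg_def fun_upd_def\<close>)
next
  case (Minus e e')
  obtain g where g: "steps w P (ecost e) (conf p f m) (conf (p + ecost e) g m)"
      "g t = ev e (f, m)" "\<forall>r<t. g r = f r"
    using Minus.IH(1)[of p t f] Minus.prems by auto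
  have e': "ereads e' \<subseteq> {..<Suc t}" using Minus.prems by auto
  have c: "ev e' (g, m) = ev e' (f, m)" "esafe (2 ^ w) e' (g, m) = esafe (2 ^ w) e' (f, m)"
    by (rule ev_cong esafe_cong, use Minus.prems g(3) in \<open>force\<close>)+
  obtain g' where g': "steps w P (ecost e') (conf (p + ecost e) g m) (conf (p + ecost e + ecost e') g' m)"
      "g' (Suc t) = ev e' (f, m)" "\<forall>r<Suc t. g' r = g r"
    using Minus.IH(2)[of "p + ecost e" "Suc t" g] Minus.prems e' c by auto
  show ?case
    by (rule exI[of _ "g'(t := g' t - g' (Suc t))"])
      (use g g' Minus.prems in \<open>auto intro!: steps_snoc[OF steps_trans[OF g(1) g'(1)]] simp: set_reg_def fun_upd_def\<close>)
next
  case (Times e e')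
  obtain g where g: "steps w P (ecost e) (conf p f m) (conf (p + ecost e) g m)"
      "g t = ev e (f, m)" "\<forall>r<t. g r = f r"
    using Times.IH(1)[of p t f] Times.prems by auto
  have e': "ereads e' \<subseteq> {..<Suc t}" using Times.prems by auto
  have c: "ev e' (g, m) = ev e' (f, m)" "esafe (2 ^ w) e' (g, m) = esafe (2 ^ w) e' (f, m)"
    by (rule ev_cong esafe_cong, use Times.prems g(3) in \<open>force\<close>)+
  obtain g' where g': "steps w P (ecost e') (conf (p + ecost e) g m) (conf (p + ecost e + ecost e') g' m)"
      "g' (Suc t) = ev e' (f, m)" "\<forall>r<Suc t. g' r = g r"
    using Times.IH(2)[of "p + ecost e" "Suc t" g] Times.prems e' c by auto
  show ?case
    by (rule exI[of _ "g'(t := g' t * g' (Suc t))"])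
      (use g g' Times.prems in \<open>auto intro!: steps_snoc[OF steps_trans[OF g(1) g'(1)]] simp: set_reg_def fun_upd_def\<close>)
qed

definition eqr :: "nat \<Rightarrow> (nat \<Rightarrow> nat) \<Rightarrow> (nat \<Rightarrow> nat) \<Rightarrow> bool" where
  "eqr z f g \<longleftrightarrow> (\<forall>r<z. f r = g r)"

text \<open>Registers are compared below \<open>z\<close> only, as evaluation overwrites the others.
  The step count is bounded rather than determined, because \<open>cost\<close> charges every
  conditional for the jump over the second branch, which is executed after the first branch
  only.\<close>

lemma comp_correct:
  assumes "code_at P p (compile z p c)" "wf_com z c" "eqr z f (fst s)" "safe (2 ^ w) c s"
  shows "\<exists>t g. t \<le> cost c s \<and>
    steps w P t (conf p f (snd s)) (conf (p + csize c) g (snd (run c s))) \<and> eqr z g (fst (run c s))"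
  using assms
proof (induction c arbitrary: p f s)
  case Skip
  then show ?case using steps_refl by fastforce
next
  case (Assign r e)
  obtain g where g: "steps w P (ecost e) (conf p f (snd s)) (conf (p + ecost e) g (snd s))"
      "g z = ev e (f, snd s)" "\<forall>r<z. g r = f r"
    using comp_exp_correct[of P p z e w f "snd s"] Assign.prems esafe_cong[of e f "fst s" "2 ^ w" "snd s"]
    by (force simp: eqr_def subset_eq)
  have "ev e (f, snd s) = ev e s"
    using Assign.prems ev_cong[of e f "fst s" "snd s"] by (auto simp: eqr_def subset_eq)
  then show ?case
    by (intro exI[of _ "Suc (ecost e)"] exI[of _ "g(r := g z)"])
      (use g Assign.prems in \<open>auto intro!: steps_snoc[OF g(1)] simp: set_reg_def fun_upd_def eqr_def\<close>)
next
  case (Write e e')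
  obtain g where g: "steps w P (ecost e) (conf p f (snd s)) (conf (p + ecost e) g (snd s))"
      "g z = ev e (f, snd s)" "\<forall>r<z. g r = f r"
    using comp_exp_correct[of P p z e w f "snd s"] Write.prems esafe_cong[of e f "fst s" "2 ^ w" "snd s"]
    by (force simp: eqr_def subset_eq)
  obtain g' where g': "steps w P (ecost e') (conf (p + ecost e) g (snd s)) (conf (p + ecost e + ecost e') g' (snd s))"
      "g' (Suc z) = ev e' (g, snd s)" "\<forall>r<Suc z. g' r = g r"
    using comp_exp_correct[of P "p + ecost e" "Suc z" e' w g "snd s"] Write.prems g(3)
      esafe_cong[of e' g "fst s" "2 ^ w" "snd s"]
    by (force simp: eqr_def subset_eq)
  have "ev e (f, snd s) = ev e s" "ev e' (g, snd s) = ev e' s"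
    using Write.prems ev_cong[of e f "fst s" "snd s"] ev_cong[of e' g "fst s" "snd s"] g(3)
    by (auto simp: eqr_def subset_eq)
  then show ?case
    by (intro exI[of _ "Suc (ecost e + ecost e')"] exI[of _ g'])
      (use g g' Write.prems in \<open>auto intro!: steps_snoc[OF steps_trans[OF g(1) g'(1)]] simp: set_reg_def fun_upd_def eqr_def\<close>)
next
  case (Seq c1 c2)
  obtain t g where 1: "t \<le> cost c1 s"
      "steps w P t (conf p f (snd s)) (conf (p + csize c1) g (snd (run c1 s)))" "eqr z g (fst (run c1 s))"
    using Seq.IH(1)[of p f s] Seq.prems by auto
  obtain t' g' where 2: "t' \<le> cost c2 (run c1 s)"
      "steps w P t' (conf (p + csize c1) g (snd (run c1 s)))
        (conf (p + csize c1 + csize c2) g' (snd (run c2 (run c1 s))))" "eqr z g' (fst (run c2 (run c1 s)))"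
    using Seq.IH(2)[of "p + csize c1" g "run c1 s"] Seq.prems 1(3) by auto
  show ?case
    using 1 2 steps_trans[OF 1(2) 2(2)]
    by (intro exI[of _ "t + t'"] exI[of _ g']) (simp add: add.assoc)
next
  case (Cond e c1 c2)
  obtain g where g: "steps w P (ecost e) (conf p f (snd s)) (conf (p + ecost e) g (snd s))"
      "g z = ev e (f, snd s)" "\<forall>r<z. g r = f r"
    using comp_exp_correct[of P p z e w f "snd s"] Cond.prems esafe_cong[of e f "fst s" "2 ^ w" "snd s"]
    by (force simp: eqr_def subset_eq Let_def)
  have e: "ev e (f, snd s) = ev e s" "eqr z g (fst s)"
    using Cond.prems ev_cong[of e f "fst s" "snd s"] g by (auto simp: eqr_def subset_eq)
  show ?case
  proof (cases "ev e s = 0")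
    case True
    then have s: "steps w P (Suc (ecost e)) (conf p f (snd s)) (conf (p + ecost e + 1 + csize c1 + 1) g (snd s))"
      using g e Cond.prems by (auto intro!: steps_snoc[OF g(1)] simp: Let_def)
    obtain t g' where "t \<le> cost c2 s"
        "steps w P t (conf (p + ecost e + 1 + csize c1 + 1) g (snd s))
          (conf (p + ecost e + 1 + csize c1 + 1 + csize c2) g' (snd (run c2 s)))" "eqr z g' (fst (run c2 s))"
      using Cond.IH(2)[of "p + ecost e + 1 + csize c1 + 1" g s] Cond.prems True e
      by (auto simp: Let_def add.assoc add.left_commute)
    then show ?thesis using True steps_trans[OF s]
      by (intro exI[of _ "Suc (ecost e) + t"] exI[of _ g']) (auto simp: ac_simps)
  next
    case False
    then have s: "steps w P (Suc (ecost e)) (conf p f (snd s)) (conf (p + ecost e + 1) g (snd s))"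
      using g e Cond.prems by (auto intro!: steps_snoc[OF g(1)] simp: Let_def)
    obtain t g' where t: "t \<le> cost c1 s"
        "steps w P t (conf (p + ecost e + 1) g (snd s))
          (conf (p + ecost e + 1 + csize c1) g' (snd (run c1 s)))" "eqr z g' (fst (run c1 s))"
      using Cond.IH(1)[of "p + ecost e + 1" g s] Cond.prems False e
      by (auto simp: Let_def)
    have "steps w P (Suc (Suc (ecost e) + t)) (conf p f (snd s))
        (conf (p + csize (Cond e c1 c2)) g' (snd (run c1 s)))"
      by (rule steps_snoc[OF steps_trans[OF s t(2)]]) (use Cond.prems in \<open>simp_all add: Let_def ac_simps\<close>)
    then show ?thesis using False t
      by (intro exI[of _ "Suc (Suc (ecost e) + t)"] exI[of _ g']) auto
  qed
next
  case (For r h e1 e2 c)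
  let ?m = "snd s"
  obtain g where g: "steps w P (ecost e1) (conf p f ?m) (conf (p + ecost e1) g ?m)"
      "g z = ev e1 (f, ?m)" "\<forall>r<z. g r = f r"
    using comp_exp_correct[of P p z e1 w f ?m] For.prems esafe_cong[of e1 f "fst s" "2 ^ w" ?m]
    by (force simp: eqr_def subset_eq Let_def)
  obtain g' where g': "steps w P (ecost e2) (conf (p + ecost e1) g ?m) (conf (p + ecost e1 + ecost e2) g' ?m)"
      "g' (Suc z) = ev e2 (g, ?m)" "\<forall>r<Suc z. g' r = g r"
    using comp_exp_correct[of P "p + ecost e1" "Suc z" e2 w g ?m] For.prems g(3)
      esafe_cong[of e2 g "fst s" "2 ^ w" ?m]
    by (force simp: eqr_def subset_eq Let_def)
  define l where "l = ev e1 s"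
  define u where "u = ev e2 s"
  define q where "q = p + ecost e1 + ecost e2 + 2"
  define s0 where "s0 = ((fst s)(h := u), ?m)"
  define S where "S k = loop (run c) r l k s0" for k
  have lu: "ev e1 (f, ?m) = l" "ev e2 (g, ?m) = u"
    using For.prems ev_cong[of e1 f "fst s" ?m] ev_cong[of e2 g "fst s" ?m] g(3)
    by (auto simp: eqr_def subset_eq l_def u_def)
  have wfs: "r \<noteq> h" "r \<notin> writes c" "h \<notin> writes c" "r < z" "h < z" "wf_com z c"
    using For.prems by auto
  have code: "P ! q = Sub z h r" "P ! Suc q = JumpZero z (q + csize c + 5)" "code_at P (q + 2) (compile z (q + 2) c)"
      "P ! (q + 2 + csize c) = Const z 1" "P ! (q + 3 + csize c) = Add r r z" "P ! (q + 4 + csize c) = Jump q"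
      "q + 4 + csize c < length P"
    using For.prems(1) by (simp_all add: Let_def q_def ac_simps numeral_eq_Suc)
  have safe: "safe (2 ^ w) c ((fst (S k))(r := l + k), snd (S k))" if "k < u - l" for k
    using For.prems(4) that by (simp add: Let_def S_def s0_def l_def u_def)
  have B: "1 < (2::nat) ^ w" "u < 2 ^ w" using For.prems(4) by (auto simp: Let_def u_def)
  have S0: "fst (S k) h = u" for k
    unfolding S_def using wfs by (subst loop_unchanged) (auto simp: run_unchanged s0_def)
  have init: "steps w P (ecost e1 + ecost e2 + 2) (conf p f ?m) (conf q (g'(r := l, h := u)) ?m)"
  proof -
    have "steps w P (Suc (ecost e1 + ecost e2)) (conf p f ?m) (conf (p + ecost e1 + ecost e2 + 1) (g'(r := l)) ?m)"
      using For.prems g g' lu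
      by (auto intro!: steps_snoc[OF steps_trans[OF g(1) g'(1)]] simp: Let_def set_reg_def fun_upd_def)
    from steps_snoc[OF this, of "conf q (g'(r := l, h := u)) ?m"] show ?thesis
      using For.prems g g' lu wfs by (auto simp: Let_def set_reg_def fun_upd_def q_def)
  qed
  \<comment> \<open>Loop invariant at the test address \<open>q\<close>: after \<open>k\<close>
    passes the machine register \<open>r\<close> already contains \<open>l + k\<close>, the value to
    which the source semantics resets it for the next pass.\<close>
  have iter: "\<exists>t G. t \<le> (\<Sum>j<k. cost c ((fst (S j))(r := l + j), snd (S j)) + 5) \<and>
      steps w P t (conf q (g'(r := l, h := u)) ?m) (conf q G (snd (S k))) \<and>
      eqr z G ((fst (S k))(r := l + k))" if "k \<le> u - l" for k
    using that
  proof (induction k)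
    case 0
    then show ?case using g g' For.prems(3) wfs
      by (intro exI[of _ 0] exI[of _ "g'(r := l, h := u)"])
        (auto simp: S_def s0_def eqr_def steps_refl fun_upd_def)
  next
    case (Suc k)
    have "k \<le> u - l" using Suc.prems by simp
    from Suc.IH[OF this] obtain t G where t: "t \<le> (\<Sum>j<k. cost c ((fst (S j))(r := l + j), snd (S j)) + 5)"
        "steps w P t (conf q (g'(r := l, h := u)) ?m) (conf q G (snd (S k)))"
        "eqr z G ((fst (S k))(r := l + k))"
      by blast
    let ?s = "((fst (S k))(r := l + k), snd (S k))"
    have G: "G r = l + k" "G h = u" using t(3) wfs S0[of k] by (auto simp: eqr_def)
    have "steps w P (Suc (Suc t)) (conf q (g'(r := l, h := u)) ?m) (conf (q + 2) (G(z := u - (l + k))) (snd (S k)))"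
      by (rule steps_snoc[OF steps_snoc[OF t(2) _ refl]])
        (use code G Suc.prems wfs in \<open>auto simp: set_reg_def fun_upd_def\<close>)
    moreover have "eqr z (G(z := u - (l + k))) (fst ?s)" "k < u - l"
      using t(3) Suc.prems by (auto simp: eqr_def)
    with For.IH[OF code(3) wfs(6)] safe
    obtain t' G' where t': "t' \<le> cost c ?s"
        "steps w P t' (conf (q + 2) (G(z := u - (l + k))) (snd (S k)))
          (conf (q + 2 + csize c) G' (snd (run c ?s)))" "eqr z G' (fst (run c ?s))"
      by (metis snd_conv)
    ultimately have a: "steps w P (Suc (Suc t) + t') (conf q (g'(r := l, h := u)) ?m)
        (conf (q + 2 + csize c) G' (snd (run c ?s)))"
      using steps_trans by blast
    have r: "G' r = l + k" using t'(3) wfs run_unchanged[OF wfs(2), of ?s] by (auto simp: eqr_def)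
    have "steps w P (Suc (Suc (Suc (Suc (Suc t) + t')))) (conf q (g'(r := l, h := u)) ?m)
        (conf q (G'(z := 1, r := Suc (l + k))) (snd (run c ?s)))"
      by (rule steps_snoc[OF steps_snoc[OF steps_snoc[OF a _ refl] _ refl]])
        (use code wfs r B Suc.prems in \<open>auto simp: set_reg_def fun_upd_def numeral_eq_Suc\<close>)
    moreover have "Suc (Suc (Suc (Suc (Suc t) + t'))) \<le>
        (\<Sum>j<Suc k. cost c ((fst (S j))(r := l + j), snd (S j)) + 5)"
      using t(1) t'(1) unfolding sum.lessThan_Suc by linarith
    moreover have "eqr z (G'(z := 1, r := Suc (l + k))) ((fst (run c ?s))(r := l + Suc k))"
      using t'(3) by (auto simp: eqr_def)
    moreover have S: "S (Suc k) = run c ?s" by (simp add: S_def Let_def)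
    ultimately show ?case unfolding S by blast
  qed
  from iter[OF order_refl] obtain t G where t: "t \<le> (\<Sum>j<u - l. cost c ((fst (S j))(r := l + j), snd (S j)) + 5)"
      "steps w P t (conf q (g'(r := l, h := u)) ?m) (conf q G (snd (S (u - l))))"
      "eqr z G ((fst (S (u - l)))(r := l + (u - l)))"
    by blast
  have G: "G r = max l u" "G h = u" using t(3) wfs S0[of "u - l"] by (auto simp: eqr_def)
  note st = steps_trans[OF init t(2)]
  have "steps w P (Suc (Suc (ecost e1 + ecost e2 + 2 + t))) (conf p f ?m)
      (conf (q + csize c + 5) (G(z := 0)) (snd (S (u - l))))"
    by (rule steps_snoc[OF steps_snoc[OF st _ refl]])
      (use code G wfs in \<open>auto simp: set_reg_def fun_upd_def\<close>)
  moreover have run: "run (For r h e1 e2 c) s = ((fst (S (u - l)))(r := max l u), snd (S (u - l)))"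
    by (simp add: Let_def S_def s0_def l_def u_def)
  moreover have cost: "cost (For r h e1 e2 c) s = ecost e1 + ecost e2 + 4 +
      (\<Sum>j<u - l. cost c ((fst (S j))(r := l + j), snd (S j)) + 5)"
    by (simp add: Let_def S_def s0_def l_def u_def)
  moreover have "Suc (Suc (ecost e1 + ecost e2 + 2 + t)) \<le> cost (For r h e1 e2 c) s"
    using t(1) cost by linarith
  moreover have "eqr z (G(z := 0)) ((fst (S (u - l)))(r := max l u))"
    using t(3) by (auto simp: eqr_def)
  moreover have "q + csize c + 5 = p + csize (For r h e1 e2 c)" by (simp add: q_def)
  ultimately show ?case unfolding run fst_conv snd_conv by metis
qed

lemma eqr_refl: "eqr z f f"
  by (simp add: eqr_def)

text \<open>The result is read from registers 0 and 1, so these must lie below the evaluation stack;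
  this is the role of \<open>2 \<le> z\<close>.\<close>

lemma computes_within_compile:
  fixes xs c
  defines "s \<equiv> (\<lambda>_. 0, \<lambda>i. if i < length xs then xs ! i else 0)"
  assumes "length xs \<le> 2 ^ w" "\<forall>x\<in>set xs. x < 2 ^ w" "wf_com z c" "2 \<le> z" "safe (2 ^ w) c s"
    and "cost c s \<le> T" "run c s = (f, m)" "f 0 + f 1 \<le> 2 ^ w" "map m [f 0..<f 0 + f 1] = ys"
  shows "computes_within w (compile z 0 c) xs T ys"
proof -
  have "code_at (compile z 0 c) 0 (compile z 0 c)" by (simp add: code_at_def)
  from comp_correct[OF this assms(4) eqr_refl assms(6)] obtain t g where t: "t \<le> cost c s"
    "steps w (compile z 0 c) t (conf 0 (fst s) (snd s)) (conf (csize c) g m)" "eqr z g f"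
    by (auto simp: assms(8))
  have "conf 0 (fst s) (snd s) = init xs" by (simp add: init_def s_def)
  then have "(step w (compile z 0 c) ^^ t) (init xs) = conf (csize c) g m"
    using t(2) by (simp add: steps_def)
  moreover have "g 0 = f 0" "g 1 = f 1" using t(3) assms(5) by (auto simp: eqr_def)
  ultimately show ?thesis
    using assms(2,3,7,9,10) t(1)
    by (auto simp: computes_within_def halted_def result_def Let_def intro!: exI[of _ t])
qed

section \<open>Hoare triples with time bounds\<close>

text \<open>
  \<open>G\<close> lists registers with fixed values. Apart from these, all data are kept in the memory,
  so that assertions speak about the memory only.
\<close>

definition agree :: "(nat \<times> nat) list \<Rightarrow> (nat \<Rightarrow> nat) \<Rightarrow> bool" where
  "agree G f \<longleftrightarrow> (\<forall>(r, x)\<in>set G. f r = x)"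

lemma agree_Nil [simp]: "agree [] f"
  by (simp add: agree_def)

lemma agree_Cons [simp]: "agree ((r, x) # G) f \<longleftrightarrow> f r = x \<and> agree G f"
  by (auto simp: agree_def)

lemma agree_cong: "agree G f \<Longrightarrow> (\<And>r. r \<in> fst ` set G \<Longrightarrow> f r = g r) \<Longrightarrow> agree G g"
  by (force simp: agree_def)

definition triple ::
    "nat \<Rightarrow> (nat \<times> nat) list \<Rightarrow> ((nat \<Rightarrow> nat) \<Rightarrow> bool) \<Rightarrow> com \<Rightarrow> ((nat \<Rightarrow> nat) \<Rightarrow> bool) \<Rightarrow> nat \<Rightarrow> bool" where
  "triple B G P c Q T \<longleftrightarrow>
    (\<forall>f m. agree G f \<longrightarrow> P m \<longrightarrow> safe B c (f, m) \<and> cost c (f, m) \<le> T \<and> Q (snd (run c (f, m))))"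

lemma triple_conseq:
  assumes "triple B G P c Q T" "\<And>m. P' m \<Longrightarrow> P m" "\<And>m. Q m \<Longrightarrow> Q' m" "T \<le> T'"
  shows "triple B G P' c Q' T'"
  using assms unfolding triple_def by (meson order_trans)

lemma triple_weaken:
  "triple B G P c Q T \<Longrightarrow> set G \<subseteq> set G' \<Longrightarrow> triple B G' P c Q T"
  unfolding triple_def agree_def by (meson subset_iff)

lemma triple_Skip: "(\<And>m. P m \<Longrightarrow> Q m) \<Longrightarrow> triple B G P Skip Q T"
  by (simp add: triple_def)

lemma triple_Write:
  assumes "\<And>f m. agree G f \<Longrightarrow> P m \<Longrightarrow>
    esafe B e (f, m) \<and> esafe B e' (f, m) \<and> Q (m(ev e (f, m) := ev e' (f, m)))"
    and "ecost e + ecost e' + 1 \<le> T"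
  shows "triple B G P (Write e e') Q T"
  using assms by (simp add: triple_def)

lemma triple_Seq:
  assumes "triple B G P c1 Q T1" "triple B G Q c2 R T2" "fst ` set G \<inter> writes c1 = {}" "T1 + T2 \<le> T"
  shows "triple B G P (c1 ;; c2) R T"
  unfolding triple_def
proof (intro allI impI)
  fix f m assume *: "agree G f" "P m"
  obtain f' m' where r: "run c1 (f, m) = (f', m')" by fastforce
  have "agree G f'"
    using *(1) run_unchanged[of _ c1 "(f, m)"] assms(3) r by (intro agree_cong[OF *(1)]) fastforce
  then show "safe B (c1 ;; c2) (f, m) \<and> cost (c1 ;; c2) (f, m) \<le> T \<and> R (snd (run (c1 ;; c2) (f, m)))"
    using assms(1,2,4) * r unfolding triple_def by fastforce
qed

text \<open>Since assertions do not mention registers, the assigned value must be determined by the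
  precondition; it is then recorded among the fixed registers for the rest of the program.\<close>

lemma triple_Assign:
  assumes "\<And>f m. agree G f \<Longrightarrow> P m \<Longrightarrow> esafe B e (f, m) \<and> ev e (f, m) = x"
    and "triple B ((r, x) # G) P c Q T'" "r \<notin> fst ` set G" "ecost e + 1 + T' \<le> T"
  shows "triple B G P (Assign r e ;; c) Q T"
  unfolding triple_def
proof (intro allI impI)
  fix f m assume *: "agree G f" "P m"
  have "agree G (f(r := x))"
    by (rule agree_cong[OF *(1)]) (use assms(3) in auto)
  then have "agree ((r, x) # G) (f(r := x))" by simp
  then have "safe B c (f(r := x), m) \<and> cost c (f(r := x), m) \<le> T' \<and> Q (snd (run c (f(r := x), m)))"
    using assms(2) *(2) unfolding triple_def by blast
  then show "safe B (Assign r e ;; c) (f, m) \<and> cost (Assign r e ;; c) (f, m) \<le> T \<and>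
      Q (snd (run (Assign r e ;; c) (f, m)))"
    using assms(1)[OF *] assms(4) by simp
qed

lemma triple_Cond:
  assumes "\<And>f m. agree G f \<Longrightarrow> P m \<Longrightarrow>
      esafe B e (f, m) \<and> (if ev e (f, m) \<noteq> 0 then P1 m else P2 m)"
    and "triple B G P1 c1 Q T'" "triple B G P2 c2 Q T'" "ecost e + 2 + T' \<le> T"
  shows "triple B G P (Cond e c1 c2) Q T"
  unfolding triple_def
proof (intro allI impI)
  fix f m assume *: "agree G f" "P m"
  show "safe B (Cond e c1 c2) (f, m) \<and> cost (Cond e c1 c2) (f, m) \<le> T \<and>
      Q (snd (run (Cond e c1 c2) (f, m)))"
  proof (cases "ev e (f, m) = 0")
    case True
    then have "P2 m" using assms(1)[OF *] by simp
    then have "safe B c2 (f, m) \<and> cost c2 (f, m) \<le> T' \<and> Q (snd (run c2 (f, m)))"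
      using assms(3) * by (simp add: triple_def)
    then show ?thesis using assms(1)[OF *] assms(4) True by simp
  next
    case False
    then have "P1 m" using assms(1)[OF *] by simp
    then have "safe B c1 (f, m) \<and> cost c1 (f, m) \<le> T' \<and> Q (snd (run c1 (f, m)))"
      using assms(2) * by (simp add: triple_def)
    then show ?thesis using assms(1)[OF *] assms(4) False by simp
  qed
qed

lemma triple_For_sum:
  assumes "\<And>f m. agree G f \<Longrightarrow> P m \<Longrightarrow>
      esafe B e1 (f, m) \<and> esafe B e2 (f, m) \<and> ev e1 (f, m) = l \<and> ev e2 (f, m) = u \<and> I l m"
    and body: "\<And>i. l \<le> i \<Longrightarrow> i < u \<Longrightarrow> triple B ((r, i) # G) (I i) c (I (Suc i)) (T i)"
    and "1 < B" "u < B" "l \<le> u" "fst ` set G \<inter> ({r, h} \<union> writes c) = {}"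
    and T: "ecost e1 + ecost e2 + 4 + (\<Sum>i\<in>{l..<u}. T i + 5) \<le> T'"
  shows "triple B G P (For r h e1 e2 c) (I u) T'"
  unfolding triple_def
proof (intro allI impI)
  fix f m assume *: "agree G f" "P m"
  note e = assms(1)[OF *]
  define s0 where "s0 = (f(h := u), m)"
  define S where "S k = loop (run c) r l k s0" for k
  define S' where "S' k = ((fst (S k))(r := l + k), snd (S k))" for k
  \<comment> \<open>The registers in \<open>G\<close> are disjoint from the loop registers and from
    those written by the body, so they keep their values through all passes.\<close>
  have agr: "agree ((r, l + k) # G) (fst (S' k))" for k
  proof -
    have "fst (S k) x = f x" if "x \<in> fst ` set G" for x
    proof -
      have x: "x \<noteq> r" "x \<noteq> h" "x \<notin> writes c" using assms(6) that by auto
      then show ?thesis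
        unfolding S_def by (subst loop_unchanged) (auto simp: run_unchanged s0_def)
    qed
    then have "agree G (fst (S' k))"
      by (intro agree_cong[OF *(1)]) (use assms(6) in \<open>auto simp: S'_def\<close>)
    then show ?thesis by (simp add: S'_def)
  qed
  have SS: "S (Suc k) = run c (S' k)" for k
    by (simp add: S_def S'_def Let_def)
  have step: "safe B c (S' k) \<and> cost c (S' k) \<le> T (l + k) \<and> I (Suc (l + k)) (snd (S (Suc k)))"
    if "k < u - l" "I (l + k) (snd (S k))" for k
    using body[of "l + k"] that agr[of k] SS[of k]
    unfolding triple_def by (metis S'_def less_diff_conv add.commute le_add1 prod.collapse snd_conv)
  have inv: "I (l + k) (snd (S k))" if "k \<le> u - l" for k
    using that
  proof (induction k)
    case 0
    then show ?case using e by (simp add: S_def s0_def)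
  qed (use step in auto)
  have "(\<Sum>k<u - l. cost c (S' k) + 5) \<le> (\<Sum>k<u - l. T (l + k) + 5)"
    using step inv by (intro sum_mono add_right_mono) simp
  also have "\<dots> = (\<Sum>i\<in>{l..<u}. T i + 5)"
    by (simp add: sum.atLeastLessThan_shift_0[of _ l u] lessThan_atLeast0 add.commute)
  finally have "cost (For r h e1 e2 c) (f, m) \<le> T'"
    using e T by (simp add: Let_def S'_def S_def s0_def)
  moreover have "safe B (For r h e1 e2 c) (f, m)"
    using e assms(3,4) step inv by (auto simp: Let_def S'_def S_def s0_def)
  moreover have "snd (run (For r h e1 e2 c) (f, m)) = snd (S (u - l))"
    using e by (simp add: Let_def S_def s0_def)
  ultimately show "safe B (For r h e1 e2 c) (f, m) \<and> cost (For r h e1 e2 c) (f, m) \<le> T' \<and>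
      I u (snd (run (For r h e1 e2 c) (f, m)))"
    using inv[of "u - l"] assms(5) by simp
qed

text \<open>The form "constant times product" is stable under nesting: each loop level contributes
  one factor \<open>n + 1\<close> and raises the constant by its own overhead. The
  \<open>+ 1\<close> pays for a loop without passes, and innermost bodies start with the product
  \<open>X = 1\<close>.\<close>

lemma triple_For:
  assumes "\<And>f m. agree G f \<Longrightarrow> P m \<Longrightarrow>
      esafe B e1 (f, m) \<and> esafe B e2 (f, m) \<and> ev e1 (f, m) = l \<and> ev e2 (f, m) = u \<and> I l m"
    and body: "\<And>i. l \<le> i \<Longrightarrow> i < u \<Longrightarrow> triple B ((r, i) # G) (I i) c (I (Suc i)) (K * X)"
    and B: "1 < B" "u < B" "l \<le> u" and G: "fst ` set G \<inter> ({r, h} \<union> writes c) = {}"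
    and T: "ecost e1 + ecost e2 + 9 + K \<le> K'" "1 \<le> X" "u - l \<le> n"
  shows "triple B G P (For r h e1 e2 c) (I u) (K' * ((n + 1) * X))"
proof (rule triple_For_sum[OF assms(1) body B G])
  have "ecost e1 + ecost e2 + 4 + (u - l) * (K * X + 5) \<le> (ecost e1 + ecost e2 + 9 + K) * ((n + 1) * X)"
  proof -
    have "ecost e1 + ecost e2 + 4 \<le> (ecost e1 + ecost e2 + 9 + K) * X" using T(2) by (cases X) auto
    moreover have "(u - l) * (K * X + 5) \<le> n * ((ecost e1 + ecost e2 + 9 + K) * X)"
      using T(2,3) by (intro mult_le_mono) (auto simp: algebra_simps)
    ultimately show ?thesis by (simp add: algebra_simps)
  qed
  also have "\<dots> \<le> K' * ((n + 1) * X)" using T by (intro mult_le_mono) auto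
  finally show "ecost e1 + ecost e2 + 4 + (\<Sum>i\<in>{l..<u}. K * X + 5) \<le> K' * ((n + 1) * X)" by simp
qed auto

section \<open>Positions of variable operations\<close>

definition ops :: "'x set \<Rightarrow> ('a, 'x) symbol set" where
  "ops V = Open ` V \<union> Close ` V"

text \<open>For a variable operation this lists how many letters precede each occurrence. It is
  insensitive to the order of operations between two letters, and it determines the spans; so two
  words can be compared without matching them symbol by symbol.\<close>

fun occ :: "('a, 'x) symbol \<Rightarrow> ('a, 'x) symbol list \<Rightarrow> nat list" where
  "occ y [] = []"
| "occ y (Letter a # r) = map Suc (occ y r)"
| "occ y (Open x # r) = (if Open x = y then 0 # occ y r else occ y r)"
| "occ y (Close x # r) = (if Close x = y then 0 # occ y r else occ y r)"

lemma clr_append [simp]: "clr (r @ r') = clr r @ clr r'"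
  by (induction r rule: clr.induct) auto

lemma occ_append: "occ y (r @ r') = occ y r @ map ((+) (length (clr r))) (occ y r')"
  by (induction r rule: clr.induct) (auto simp: o_def)

lemma length_occ: "y \<in> ops V \<Longrightarrow> length (occ y r) = count_list r y"
  by (induction r rule: clr.induct) (auto simp: ops_def)

lemma occ_clr_Nil: "y \<in> ops V \<Longrightarrow> clr r = [] \<Longrightarrow> occ y r = replicate (count_list r y) 0"
  by (induction r rule: clr.induct) (auto simp: ops_def)

lemma occ_notin: "y \<notin> set r \<Longrightarrow> occ y r = []"
  by (induction r rule: clr.induct) auto

lemma distinct_count_list: "distinct r \<Longrightarrow> count_list r y = (if y \<in> set r then 1 else 0)"
  by (induction r) auto

lemma occ_eq_mem:
  assumes "y \<in> ops V" "occ y r = occ y r'" shows "y \<in> set r \<longleftrightarrow> y \<in> set r'"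
  using assms length_occ[of y V] count_list_0_iff by metis

text \<open>The wrong order of the two operations of a variable, in a form that distributes over
  append (\<open>bad_append\<close>). The existential decomposition in \<open>valid\<close> does
  not.\<close>

fun bad :: "'x \<Rightarrow> ('a, 'x) symbol list \<Rightarrow> bool" where
  "bad x [] \<longleftrightarrow> False"
| "bad x (y # r) \<longleftrightarrow> y = Close x \<and> Open x \<in> set r \<or> bad x r"

lemma bad_append: "bad x (r @ r') \<longleftrightarrow> bad x r \<or> bad x r' \<or> Close x \<in> set r \<and> Open x \<in> set r'"
  by (induction r) auto

lemma bad_mem: "bad x r \<Longrightarrow> Open x \<in> set r"
  by (induction r) auto

lemma not_bad_split:
  assumes "count_list r (Open x) = 1" "count_list r (Close x) = 1"
  shows "(\<exists>r1 r2 r3. r = r1 @ Open x # r2 @ Close x # r3) \<longleftrightarrow> \<not> bad x r"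
proof
  assume "\<exists>r1 r2 r3. r = r1 @ Open x # r2 @ Close x # r3"
  then obtain r1 r2 r3 where r: "r = r1 @ Open x # r2 @ Close x # r3" by blast
  have "count_list r1 (Open x) = 0" "count_list r2 (Open x) = 0" "count_list r3 (Open x) = 0"
    "count_list r1 (Close x) = 0" "count_list r2 (Close x) = 0" "count_list r3 (Close x) = 0"
    using assms unfolding r by auto
  then show "\<not> bad x r" unfolding r
    using bad_mem[of x r1] bad_mem[of x r2] bad_mem[of x r3] by (auto simp: bad_append count_list_0_iff)
next
  assume b: "\<not> bad x r"
  have "Open x \<in> set r" "Close x \<in> set r"
    using assms count_list_0_iff[of r "Open x"] count_list_0_iff[of r "Close x"] by auto
  from split_list[OF this(1)] obtain r1 r' where r: "r = r1 @ Open x # r'" by blast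
  then have "Close x \<notin> set r1" using b by (auto simp: bad_append)
  then have "Close x \<in> set r'" using \<open>Close x \<in> set r\<close> unfolding r by auto
  from split_list[OF this] obtain r2 r3 where "r' = r2 @ Close x # r3" by blast
  then show "\<exists>r1 r2 r3. r = r1 @ Open x # r2 @ Close x # r3" using r by blast
qed

lemma valid_iff:
  "valid V r \<longleftrightarrow> set r \<subseteq> symbols V \<and> (\<forall>y\<in>ops V. count_list r y = 1) \<and> (\<forall>x\<in>V. \<not> bad x r)"
proof -
  have "count_list r (Open x) = 1 \<and> count_list r (Close x) = 1 \<and>
      (\<exists>r1 r2 r3. r = r1 @ Open x # r2 @ Close x # r3) \<longleftrightarrow>
    count_list r (Open x) = 1 \<and> count_list r (Close x) = 1 \<and> \<not> bad x r" for x
    using not_bad_split[of r x] by argo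
  then show ?thesis unfolding valid_def ops_def by (simp only:) fast
qed

lemma valid_count: "valid V r \<Longrightarrow> y \<in> ops V \<Longrightarrow> count_list r y = 1"
  by (simp add: valid_iff)

text \<open>Reduces statements on spans to \<open>occ\<close>. The shift by one is due to positions
  starting at 1 while \<open>occ\<close> counts the letters before an operation.\<close>

lemma valid_span:
  assumes "valid V r" "x \<in> V"
  shows "\<exists>i j. occ (Open x) r = [i] \<and> occ (Close x) r = [j] \<and> i \<le> j \<and> j \<le> length (clr r) \<and>
    span_of r x = (i + 1, j + 1)"
proof -
  obtain r1 r2 r3 where r: "r = r1 @ Open x # r2 @ Close x # r3"
    using assms by (auto simp: valid_def)
  have c: "count_list r (Open x) = 1" "count_list r (Close x) = 1"
    using assms by (auto simp: valid_def)
  have n: "Open x \<notin> set r1" "Open x \<notin> set r2" "Open x \<notin> set r3"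
    "Close x \<notin> set r1" "Close x \<notin> set r2" "Close x \<notin> set r3"
    using c unfolding r by (auto simp: count_list_0_iff)
  have t: "takeWhile (\<lambda>y. y \<noteq> Open x) r = r1" "dropWhile (\<lambda>y. y \<noteq> Open x) r = Open x # r2 @ Close x # r3"
    "takeWhile (\<lambda>y. y \<noteq> Close x) (r2 @ Close x # r3) = r2"
    unfolding r using n by (auto simp: takeWhile_append dropWhile_append) 
  have "span_of r x = (length (clr r1) + 1, length (clr r1) + length (clr r2) + 1)"
    unfolding span_of_def t by (simp add: t Let_def)
  moreover have "occ (Open x) r = [length (clr r1)]" "occ (Close x) r = [length (clr r1) + length (clr r2)]"
    unfolding r using n by (auto simp: occ_append occ_notin)
  moreover have "length (clr r1) + length (clr r2) \<le> length (clr r)" unfolding r by simp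
  ultimately show ?thesis by auto
qed

lemma tuple_of_in_tuples: "valid V r \<Longrightarrow> tuple_of V r \<in> tuples V (clr r)"
  by (fastforce simp: tuples_def tuple_of_def spans_def ran_def dom_def dest: valid_span)

lemma tuple_of_restrict:
  assumes "valid V r" "valid V1 r1" "V1 \<subseteq> V" "\<forall>y\<in>ops V1. occ y r = occ y r1"
  shows "tuple_of V r |` V1 = tuple_of V1 r1"
proof
  fix x show "(tuple_of V r |` V1) x = tuple_of V1 r1 x"
  proof (cases "x \<in> V1")
    case True
    then have "x \<in> V" "occ (Open x) r = occ (Open x) r1" "occ (Close x) r = occ (Close x) r1"
      using assms by (auto simp: ops_def)
    moreover obtain i j where "occ (Open x) r = [i]" "occ (Close x) r = [j]" "span_of r x = (i + 1, j + 1)"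
      using valid_span[OF assms(1) \<open>x \<in> V\<close>] by blast
    moreover obtain i' j' where "occ (Open x) r1 = [i']" "occ (Close x) r1 = [j']"
      "span_of r1 x = (i' + 1, j' + 1)"
      using valid_span[OF assms(2) True] by blast
    ultimately show ?thesis using True by (simp add: tuple_of_def)
  qed (simp add: tuple_of_def)
qed

text \<open>Counterpart of \<open>tuple_of_restrict\<close>: agreement of two tuples on a common
  variable becomes agreement of \<open>occ\<close>, which is what \<open>jrun_lift\<close> asks
  for.\<close>

lemma tuple_of_eq_occ:
  assumes "valid V1 r1" "valid V2 r2" "x \<in> V1" "x \<in> V2" "tuple_of V1 r1 x = tuple_of V2 r2 x"
  shows "occ (Open x) r1 = occ (Open x) r2" "occ (Close x) r1 = occ (Close x) r2"
proof -
  obtain i j where "occ (Open x) r1 = [i]" "occ (Close x) r1 = [j]" "span_of r1 x = (i + 1, j + 1)"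
    using valid_span[OF assms(1,3)] by blast
  moreover obtain i' j' where "occ (Open x) r2 = [i']" "occ (Close x) r2 = [j']"
    "span_of r2 x = (i' + 1, j' + 1)"
    using valid_span[OF assms(2,4)] by blast
  ultimately show "occ (Open x) r1 = occ (Open x) r2" "occ (Close x) r1 = occ (Close x) r2"
    using assms(3-5) by (simp_all add: tuple_of_def)
qed

section \<open>Paths\<close>

lemma path_append: "path A p r q \<Longrightarrow> path A q r' q' \<Longrightarrow> path A p (r @ r') q'"
  by (induction rule: path.induct) (auto intro: path.intros)

lemma path_eps1: "q \<in> delta A p None \<Longrightarrow> path A p [] q"
  by (auto intro: path.intros)

lemma path_symbol1: "q \<in> delta A p (Some y) \<Longrightarrow> path A p [y] q"
  by (auto intro: path.intros)

lemma path_Cons_split: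
  assumes "path A p (y # r) q"
  obtains m m' where "path A p [] m" "m' \<in> delta A m (Some y)" "path A m' r q"
proof -
  have "path A p r' q \<Longrightarrow> r' = y # r \<Longrightarrow>
      \<exists>m m'. path A p [] m \<and> m' \<in> delta A m (Some y) \<and> path A m' r q" for r'
    by (induction rule: path.induct) (auto intro: path.intros)
  then show ?thesis using that assms by blast
qed

lemma path_append_split:
  assumes "path A p (r @ r') q"
  obtains m where "path A p r m" "path A m r' q"
  using assms
proof (induction r arbitrary: p thesis)
  case (Cons y r)
  obtain m m' where "path A p [] m" "m' \<in> delta A m (Some y)" "path A m' (r @ r') q"
    using Cons.prems(2) path_Cons_split[of A p y "r @ r'" q] by auto
  moreover from Cons.IH[OF _ this(3)] obtain m'' where "path A m' r m''" "path A m'' r' q" by blast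
  moreover from this have "path A p ([] @ y # r) m''"
    using calculation(1,2) by (intro path_append path_symbol)
  ultimately show ?case using Cons.prems(1) by simp
qed (auto intro: path.intros)

lemma path_letter_split:
  assumes "path A p (w @ y # r) q"
  obtains m m' where "path A p w m" "m' \<in> delta A m (Some y)" "path A m' r q"
proof -
  obtain m0 where m0: "path A p w m0" "path A m0 (y # r) q" using assms by (rule path_append_split)
  from m0(2) obtain m m' where "path A m0 [] m" "m' \<in> delta A m (Some y)" "path A m' r q"
    by (rule path_Cons_split)
  then show ?thesis using that path_append[OF m0(1)] by fastforce
qed

lemma path_states:
  "path A p r q \<Longrightarrow> vset_automaton A \<Longrightarrow> p \<in> states A \<Longrightarrow> q \<in> states A \<and> set r \<subseteq> symbols (vars A)"
  by (induction rule: path.induct) (auto simp: vset_automaton_def)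

lemma path_symbols: "path A p r q \<Longrightarrow> vset_automaton A \<Longrightarrow> set r \<subseteq> symbols (vars A)"
  by (induction rule: path.induct) (auto simp: vset_automaton_def)

section \<open>Letterless paths and their operations\<close>

definition eps_reach :: "('a, 'x, 'q) vset_automaton \<Rightarrow> 'q \<Rightarrow> 'q \<Rightarrow> bool" where
  "eps_reach A p q \<longleftrightarrow> (\<exists>r. path A p r q \<and> clr r = [])"

definition eps_op :: "('a, 'x, 'q) vset_automaton \<Rightarrow> ('a, 'x) symbol \<Rightarrow> 'q \<Rightarrow> 'q \<Rightarrow> bool" where
  "eps_op A y p q \<longleftrightarrow> (\<exists>r. path A p r q \<and> clr r = [] \<and> y \<in> set r)"

lemma eps_op_in_ops:
  assumes "vset_automaton A" "eps_op A y p q" shows "y \<in> ops (vars A)"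
proof -
  obtain r where r: "path A p r q" "clr r = []" "y \<in> set r" using assms by (auto simp: eps_op_def)
  have "Letter a \<notin> set r" for a using r(2) by (induction r rule: clr.induct) auto
  then show ?thesis using r path_symbols[OF r(1) assms(1)] by (auto simp: symbols_def ops_def)
qed

text \<open>Exchange argument. Any path \<open>r'\<close> from \<open>p\<close> to \<open>q\<close>
  can replace \<open>r\<close> between \<open>u\<close> and \<open>w\<close>, and the counts of
  \<open>y\<close> in the three pieces must sum to 1. If some letterless \<open>r'\<close> contains
  \<open>y\<close>, then neither \<open>u\<close> nor \<open>w\<close> does, and therefore
  \<open>r\<close> contains it exactly once.\<close>

lemma eps_op_count:
  assumes "functional A" "path A (initial A) u p" "path A p r q" "path A q w (final A)" "clr r = []"
    and "y \<in> ops (vars A)"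
  shows "count_list r y = (if eps_op A y p q then 1 else 0)"
proof -
  have one: "count_list u y + count_list r' y + count_list w y = 1" if "path A p r' q" for r'
  proof -
    have "u @ r' @ w \<in> ref_words A"
      using assms(2,4) that by (auto simp: ref_words_def intro: path_append)
    then have "valid (vars A) (u @ r' @ w)" using assms(1) by (auto simp: functional_def)
    from valid_count[OF this assms(6)] show ?thesis by simp
  qed
  show ?thesis
  proof (cases "eps_op A y p q")
    case True
    then obtain r' where "path A p r' q" "y \<in> set r'" by (auto simp: eps_op_def)
    then have "count_list r' y \<noteq> 0" by (simp add: count_list_0_iff)
    then show ?thesis using one[OF \<open>path A p r' q\<close>] one[OF assms(3)] True by auto
  next
    case False
    then have "y \<notin> set r" using assms(3,5) by (auto simp: eps_op_def)
    then show ?thesis using False by (simp add: count_list_0_iff)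
  qed
qed

lemma eps_op_occ:
  assumes "functional A" "path A (initial A) u p" "path A p r q" "path A q w (final A)" "clr r = []"
    and "y \<in> ops (vars A)"
  shows "occ y r = (if eps_op A y p q then [0] else [])"
  using eps_op_count[OF assms] occ_clr_Nil[OF assms(6,5)] by auto

section \<open>The join automaton\<close>

text \<open>
  \<open>Base p1 p2\<close> simulates the two automata in lockstep on letters. For each choice of letterless
  paths from \<open>p1\<close> to \<open>q1\<close> and from \<open>p2\<close> to \<open>q2\<close>, the states \<open>Link p1 p2 q1 q2 i\<close> form a chain
  that performs the operations of both paths in a fixed order; the chain is broken where the
  paths disagree on a common variable.
\<close>

datatype ('p, 'q) jstate = Base 'p 'q | Link 'p 'q 'p 'q nat

definition connected ::
    "('a, 'x, 'p) vset_automaton \<Rightarrow> ('a, 'x, 'q) vset_automaton \<Rightarrow> 'p \<Rightarrow> 'q \<Rightarrow> 'p \<Rightarrow> 'q \<Rightarrow> bool" where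
  "connected A1 A2 p1 p2 q1 q2 \<longleftrightarrow>
    p1 \<in> states A1 \<and> p2 \<in> states A2 \<and> q1 \<in> states A1 \<and> q2 \<in> states A2 \<and>
    eps_reach A1 p1 q1 \<and> eps_reach A2 p2 q2"

definition either ::
    "('a, 'x, 'p) vset_automaton \<Rightarrow> ('a, 'x, 'q) vset_automaton \<Rightarrow> 'p \<Rightarrow> 'q \<Rightarrow> 'p \<Rightarrow> 'q \<Rightarrow>
      ('a, 'x) symbol \<Rightarrow> bool" where
  "either A1 A2 p1 p2 q1 q2 y \<longleftrightarrow> eps_op A1 y p1 q1 \<or> eps_op A2 y p2 q2"

definition consistent ::
    "('a, 'x, 'p) vset_automaton \<Rightarrow> ('a, 'x, 'q) vset_automaton \<Rightarrow> 'p \<Rightarrow> 'q \<Rightarrow> 'p \<Rightarrow> 'q \<Rightarrow>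
      ('a, 'x) symbol \<Rightarrow> bool" where
  "consistent A1 A2 p1 p2 q1 q2 y \<longleftrightarrow>
    (y \<in> ops (vars A1) \<inter> ops (vars A2) \<longrightarrow> (eps_op A1 y p1 q1 \<longleftrightarrow> eps_op A2 y p2 q2))"

inductive jtrans ::
    "('a, 'x, 'p) vset_automaton \<Rightarrow> ('a, 'x, 'q) vset_automaton \<Rightarrow> ('a, 'x) symbol list \<Rightarrow>
      ('p, 'q) jstate \<Rightarrow> ('a, 'x) symbol option \<Rightarrow> ('p, 'q) jstate \<Rightarrow> bool"
  for A1 A2 ys where
  letter: "q1 \<in> delta A1 p1 (Some (Letter a)) \<Longrightarrow> q2 \<in> delta A2 p2 (Some (Letter a)) \<Longrightarrow>
    jtrans A1 A2 ys (Base p1 p2) (Some (Letter a)) (Base q1 q2)"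
| enter: "connected A1 A2 p1 p2 q1 q2 \<Longrightarrow>
    jtrans A1 A2 ys (Base p1 p2) None (Link p1 p2 q1 q2 0)"
| link: "connected A1 A2 p1 p2 q1 q2 \<Longrightarrow> i < length ys \<Longrightarrow> consistent A1 A2 p1 p2 q1 q2 (ys ! i) \<Longrightarrow>
    jtrans A1 A2 ys (Link p1 p2 q1 q2 i)
      (if either A1 A2 p1 p2 q1 q2 (ys ! i) then Some (ys ! i) else None) (Link p1 p2 q1 q2 (Suc i))"
| leave: "connected A1 A2 p1 p2 q1 q2 \<Longrightarrow>
    jtrans A1 A2 ys (Link p1 p2 q1 q2 (length ys)) None (Base q1 q2)"

definition jstates ::
    "('a, 'x, 'p) vset_automaton \<Rightarrow> ('a, 'x, 'q) vset_automaton \<Rightarrow> nat \<Rightarrow> ('p, 'q) jstate set" where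
  "jstates A1 A2 n = {Base p1 p2 |p1 p2. p1 \<in> states A1 \<and> p2 \<in> states A2} \<union>
    {Link p1 p2 q1 q2 i |p1 p2 q1 q2 i.
      p1 \<in> states A1 \<and> p2 \<in> states A2 \<and> q1 \<in> states A1 \<and> q2 \<in> states A2 \<and> i \<le> n}"

definition join_automaton ::
    "('a, 'x, 'p) vset_automaton \<Rightarrow> ('a, 'x, 'q) vset_automaton \<Rightarrow> ('a, 'x) symbol list \<Rightarrow>
      ('a, 'x, ('p, 'q) jstate) vset_automaton" where
  "join_automaton A1 A2 ys =
    \<lparr>vars = vars A1 \<union> vars A2, states = jstates A1 A2 (length ys),
     initial = Base (initial A1) (initial A2), final = Base (final A1) (final A2),
     delta = \<lambda>u l. {w. jtrans A1 A2 ys u l w}\<rparr>"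

text \<open>Accepting runs of the join automaton with a whole chain counted as one step, so that the
  inductions below only meet \<open>Base\<close> states.\<close>

inductive jrun ::
    "('a, 'x, 'p) vset_automaton \<Rightarrow> ('a, 'x, 'q) vset_automaton \<Rightarrow> ('a, 'x) symbol list \<Rightarrow>
      'p \<Rightarrow> 'q \<Rightarrow> 'p \<Rightarrow> 'q \<Rightarrow> ('a, 'x) symbol list \<Rightarrow> bool"
  for A1 A2 ys f1 f2 where
  Nil: "jrun A1 A2 ys f1 f2 f1 f2 []"
| Letter: "q1 \<in> delta A1 p1 (Some (Letter a)) \<Longrightarrow> q2 \<in> delta A2 p2 (Some (Letter a)) \<Longrightarrow>
    jrun A1 A2 ys f1 f2 q1 q2 r \<Longrightarrow> jrun A1 A2 ys f1 f2 p1 p2 (Letter a # r)"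
| Block: "connected A1 A2 p1 p2 q1 q2 \<Longrightarrow> \<forall>y\<in>set ys. consistent A1 A2 p1 p2 q1 q2 y \<Longrightarrow>
    jrun A1 A2 ys f1 f2 q1 q2 r \<Longrightarrow>
    jrun A1 A2 ys f1 f2 p1 p2 (filter (either A1 A2 p1 p2 q1 q2) ys @ r)"

text \<open>An induction along a path also visits \<open>Link\<close> states, hence the case
  distinction: a run that starts inside a chain has to finish this chain, contributing the
  operations still to come, before it continues at a \<open>Base\<close> state.\<close>

lemma path_imp_jrun:
  assumes "path (join_automaton A1 A2 ys) u r v" "v = Base f1 f2"
  shows "case u of Base p1 p2 \<Rightarrow> jrun A1 A2 ys f1 f2 p1 p2 r
    | Link p1 p2 q1 q2 i \<Rightarrow> \<exists>r'. r = filter (either A1 A2 p1 p2 q1 q2) (drop i ys) @ r' \<and>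
        connected A1 A2 p1 p2 q1 q2 \<and> (\<forall>y\<in>set (drop i ys). consistent A1 A2 p1 p2 q1 q2 y) \<and>
        jrun A1 A2 ys f1 f2 q1 q2 r'"
  using assms
proof (induction rule: path.induct)
  case (path_Nil p)
  then show ?case by (auto intro: jrun.intros)
next
  case (path_eps q p r q')
  have "jtrans A1 A2 ys p None q" using path_eps.hyps by (simp add: join_automaton_def)
  then show ?case
  proof cases
    case (enter p1 p2 q1 q2)
    then show ?thesis using path_eps.IH path_eps.prems by (auto intro: jrun.Block)
  next
    case (link p1 p2 q1 q2 i)
    \<comment> \<open>A chain transition is labelled \<open>None\<close> exactly if neither side
      performs the operation, so \<open>filter\<close> drops \<open>ys ! i\<close>.\<close>
    have "\<not> either A1 A2 p1 p2 q1 q2 (ys ! i)" using link by (metis option.distinct(1))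
    then show ?thesis using path_eps.IH path_eps.prems link
      by (auto simp: Cons_nth_drop_Suc[symmetric])
  next
    case (leave p1 p2 q1 q2)
    then show ?thesis using path_eps.IH path_eps.prems by auto
  qed
next
  case (path_symbol q p y r q')
  have "jtrans A1 A2 ys p (Some y) q" using path_symbol.hyps by (simp add: join_automaton_def)
  then show ?case
  proof cases
    case (letter q1 p1 a q2 p2)
    then show ?thesis using path_symbol.IH path_symbol.prems by (auto intro: jrun.Letter)
  next
    case (link p1 p2 q1 q2 i)
    have "either A1 A2 p1 p2 q1 q2 (ys ! i)" "y = ys ! i"
      using link by (metis option.distinct(1), metis option.distinct(1) option.inject)
    then show ?thesis using path_symbol.IH path_symbol.prems link
      by (auto simp: Cons_nth_drop_Suc[symmetric])
  qed
qed

lemma Link_path: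
  assumes "connected A1 A2 p1 p2 q1 q2" "\<forall>y\<in>set ys. consistent A1 A2 p1 p2 q1 q2 y" "i \<le> length ys"
  shows "path (join_automaton A1 A2 ys) (Link p1 p2 q1 q2 i)
    (filter (either A1 A2 p1 p2 q1 q2) (drop i ys)) (Base q1 q2)"
  using assms(3)
proof (induction "length ys - i" arbitrary: i)
  case 0
  then show ?case using assms(1)
    by (auto simp: join_automaton_def intro!: path_eps1 jtrans.leave)
next
  case (Suc k)
  then have i: "i < length ys" by simp
  have t: "jtrans A1 A2 ys (Link p1 p2 q1 q2 i)
      (if either A1 A2 p1 p2 q1 q2 (ys ! i) then Some (ys ! i) else None) (Link p1 p2 q1 q2 (Suc i))"
    using assms i by (intro jtrans.link) auto
  have "path (join_automaton A1 A2 ys) (Link p1 p2 q1 q2 (Suc i))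
      (filter (either A1 A2 p1 p2 q1 q2) (drop (Suc i) ys)) (Base q1 q2)"
    using Suc by simp
  then show ?case
    using t unfolding Cons_nth_drop_Suc[OF i, symmetric]
    by (auto simp: join_automaton_def split: if_splits intro: path_eps path_symbol)
qed

lemma delta_join: "w \<in> delta (join_automaton A1 A2 ys) u l \<longleftrightarrow> jtrans A1 A2 ys u l w"
  by (simp add: join_automaton_def)

lemma jrun_imp_path:
  "jrun A1 A2 ys f1 f2 p1 p2 r \<Longrightarrow> path (join_automaton A1 A2 ys) (Base p1 p2) r (Base f1 f2)"
proof (induction rule: jrun.induct)
  case Nil
  then show ?case by (rule path_Nil)
next
  case (Letter q1 p1 a q2 p2 r)
  have "Base q1 q2 \<in> delta (join_automaton A1 A2 ys) (Base p1 p2) (Some (Letter a))"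
    unfolding delta_join using Letter.hyps(1,2) by (rule jtrans.letter)
  then show ?case using Letter.IH by (rule path_symbol)
next
  case (Block p1 p2 q1 q2 r)
  have "Link p1 p2 q1 q2 0 \<in> delta (join_automaton A1 A2 ys) (Base p1 p2) None"
    unfolding delta_join using Block.hyps(1) by (rule jtrans.enter)
  moreover have "path (join_automaton A1 A2 ys) (Link p1 p2 q1 q2 0)
      (filter (either A1 A2 p1 p2 q1 q2) ys) (Base q1 q2)"
    using Link_path[OF Block.hyps(1,2), of 0] by simp
  ultimately have "path (join_automaton A1 A2 ys) (Base p1 p2)
      (filter (either A1 A2 p1 p2 q1 q2) ys) (Base q1 q2)" by (rule path_eps)
  then show ?case using Block.IH by (rule path_append)
qed

lemma ref_words_join:
  "r \<in> ref_words (join_automaton A1 A2 ys) \<longleftrightarrow>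
    jrun A1 A2 ys (final A1) (final A2) (initial A1) (initial A2) r"
proof -
  have J: "initial (join_automaton A1 A2 ys) = Base (initial A1) (initial A2)"
    "final (join_automaton A1 A2 ys) = Base (final A1) (final A2)"
    by (simp_all add: join_automaton_def)
  show ?thesis unfolding ref_words_def J mem_Collect_eq
    using path_imp_jrun[OF _ refl, of A1 A2 ys "Base (initial A1) (initial A2)" r "final A1" "final A2"]
      jrun_imp_path[of A1 A2 ys "final A1" "final A2" "initial A1" "initial A2" r]
    unfolding jstate.case by blast
qed

section \<open>Language and spanner of the join automaton\<close>

locale two_automata =
  fixes A1 :: "('a, 'x, 'p) vset_automaton" and A2 :: "('a, 'x, 'q) vset_automaton"
    and vs :: "'x list"
  assumes A1: "vset_automaton A1" "functional A1" and A2: "vset_automaton A2" "functional A2"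
    and vs: "distinct vs" "set vs = vars A1 \<union> vars A2"
begin

definition ys :: "('a, 'x) symbol list" where
  "ys = map Open vs @ map Close vs"

abbreviation "V1 \<equiv> vars A1"
abbreviation "V2 \<equiv> vars A2"

lemma ys: "distinct ys" "set ys = ops (V1 \<union> V2)"
  using vs by (auto simp: ys_def ops_def distinct_map inj_on_def)

lemma clr_filter_ys: "clr (filter P ys) = []"
proof -
  have "clr (filter P (map Open us)) = []" "clr (filter P (map Close us)) = []" for us
    by (induction us) auto
  then show ?thesis by (simp add: ys_def)
qed

lemma occ_filter_ys:
  assumes "y \<in> ops (V1 \<union> V2)" shows "occ y (filter P ys) = (if P y then [0] else [])"
proof -
  have "count_list (filter P ys) y = (if P y then 1 else 0)"
    using distinct_count_list[OF distinct_filter[OF ys(1)]] ys(2) assms by auto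
  then show ?thesis using occ_clr_Nil[OF assms clr_filter_ys, of P] by auto
qed

text \<open>In \<open>ys\<close> every \<open>Open\<close> stands before every \<open>Close\<close>,
  and filtering preserves order.\<close>

lemma not_bad_filter_ys: "\<not> bad x (filter P ys)"
proof -
  have "\<not> bad x (map Open us :: ('a, 'x) symbol list)" "\<not> bad x (map Close us :: ('a, 'x) symbol list)" for us
    by (induction us) auto
  then show ?thesis by (auto simp: ys_def bad_append filter_map)
qed

text \<open>Relates a word \<open>r\<close> of the join automaton to a word \<open>r'\<close> of a
  component over \<open>V\<close>. Within a block the order of operations may differ, so
  \<open>r'\<close> need not be a subword of \<open>r\<close>. One direction suffices for
  \<open>bad\<close>: validity is transferred from \<open>r'\<close> to \<open>r\<close>.\<close>

definition proj_ok :: "'x set \<Rightarrow> ('a, 'x) symbol list \<Rightarrow> ('a, 'x) symbol list \<Rightarrow> bool" where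
  "proj_ok V r r' \<longleftrightarrow> clr r' = clr r \<and> (\<forall>y\<in>ops V. occ y r = occ y r') \<and> (\<forall>x\<in>V. bad x r \<longrightarrow> bad x r')"

lemma proj_ok_Letter: "proj_ok V r r' \<Longrightarrow> proj_ok V (Letter a # r) (Letter a # r')"
  by (auto simp: proj_ok_def)

text \<open>Here \<open>w\<close> is a normalized block and \<open>u\<close> the component path that
  it stands for. As \<open>w\<close> is not bad itself, badness of \<open>w @ r\<close> comes from
  \<open>r\<close> or from a \<open>Close x\<close> in \<open>w\<close> with an
  \<open>Open x\<close> in \<open>r\<close>; both memberships carry over because \<open>occ\<close>
  agrees.\<close>

lemma proj_ok_append:
  assumes "proj_ok V r r'" "clr u = []" "clr w = []" "\<forall>y\<in>ops V. occ y w = occ y u" "\<forall>x. \<not> bad x w"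
  shows "proj_ok V (w @ r) (u @ r')"
proof -
  have m: "y \<in> set w \<longleftrightarrow> y \<in> set u" "y \<in> set r \<longleftrightarrow> y \<in> set r'" if "y \<in> ops V" for y
    using that assms by (auto simp: proj_ok_def dest: occ_eq_mem)
  have "bad x (u @ r')" if "x \<in> V" "bad x (w @ r)" for x
    using that assms m[of "Open x"] m[of "Close x"] by (auto simp: bad_append proj_ok_def ops_def)
  then show ?thesis using assms by (auto simp: proj_ok_def occ_append)
qed

text \<open>An operation of \<open>V1\<close> performed by the second path also belongs to
  \<open>V2\<close>, hence is common, and consistency forces the first path to perform it too. So on
  \<open>V1\<close> the union \<open>either\<close> coincides with the operations of the first path
  alone; symmetrically for \<open>V2\<close>.\<close>

lemma block_occ:
  assumes "connected A1 A2 p1 p2 q1 q2" "\<forall>y\<in>set ys. consistent A1 A2 p1 p2 q1 q2 y"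
  shows "y \<in> ops V1 \<Longrightarrow> occ y (filter (either A1 A2 p1 p2 q1 q2) ys) = (if eps_op A1 y p1 q1 then [0] else [])"
    and "y \<in> ops V2 \<Longrightarrow> occ y (filter (either A1 A2 p1 p2 q1 q2) ys) = (if eps_op A2 y p2 q2 then [0] else [])"
proof -
  have V: "ops V1 \<subseteq> ops (V1 \<union> V2)" "ops V2 \<subseteq> ops (V1 \<union> V2)" by (auto simp: ops_def)
  have e: "eps_op A1 y p1 q1 \<Longrightarrow> y \<in> ops V1" "eps_op A2 y p2 q2 \<Longrightarrow> y \<in> ops V2" for y
    using eps_op_in_ops[OF A1(1)] eps_op_in_ops[OF A2(1)] by blast+
  have c: "consistent A1 A2 p1 p2 q1 q2 y" if "y \<in> ops (V1 \<union> V2)" for y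
    using assms(2) that unfolding ys(2) by blast
  show "occ y (filter (either A1 A2 p1 p2 q1 q2) ys) = (if eps_op A1 y p1 q1 then [0] else [])"
    if "y \<in> ops V1"
  proof -
    have y: "y \<in> ops (V1 \<union> V2)" using that V by blast
    have "either A1 A2 p1 p2 q1 q2 y \<longleftrightarrow> eps_op A1 y p1 q1"
      using that c[OF y] e(2)[of y] unfolding either_def consistent_def by blast
    then show ?thesis using occ_filter_ys[OF y] by simp
  qed
  show "occ y (filter (either A1 A2 p1 p2 q1 q2) ys) = (if eps_op A2 y p2 q2 then [0] else [])"
    if "y \<in> ops V2"
  proof -
    have y: "y \<in> ops (V1 \<union> V2)" using that V by blast
    have "either A1 A2 p1 p2 q1 q2 y \<longleftrightarrow> eps_op A2 y p2 q2"
      using that c[OF y] e(1)[of y] unfolding either_def consistent_def by blast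
    then show ?thesis using occ_filter_ys[OF y] by simp
  qed
qed

text \<open>Soundness. The paths from the initial states are hypotheses since
  \<open>eps_op_occ\<close> needs a full accepting path around each block; what follows the block is
  supplied by the induction hypothesis.\<close>

lemma jrun_project:
  assumes "jrun A1 A2 ys (final A1) (final A2) p1 p2 r"
    and "path A1 (initial A1) u1 p1" "path A2 (initial A2) u2 p2"
  shows "set r \<subseteq> symbols (V1 \<union> V2) \<and>
    (\<exists>r1. path A1 p1 r1 (final A1) \<and> proj_ok V1 r r1) \<and> (\<exists>r2. path A2 p2 r2 (final A2) \<and> proj_ok V2 r r2)"
  using assms
proof (induction arbitrary: u1 u2 rule: jrun.induct)
  case Nil
  then show ?case by (auto simp: proj_ok_def intro!: exI[of _ "[]"] path.path_Nil)
next
  case (Letter q1 p1 a q2 p2 r)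
  have "path A1 (initial A1) (u1 @ [Letter a]) q1" "path A2 (initial A2) (u2 @ [Letter a]) q2"
    using Letter by (auto intro: path_append path_symbol1)
  from Letter.IH[OF this] obtain r1 r2 where r: "path A1 q1 r1 (final A1)" "proj_ok V1 r r1"
    "path A2 q2 r2 (final A2)" "proj_ok V2 r r2" "set r \<subseteq> symbols (V1 \<union> V2)" by blast
  then have "set (Letter a # r) \<subseteq> symbols (V1 \<union> V2)" by (simp add: symbols_def)
  then show ?case
    using path_symbol[OF Letter.hyps(1) r(1)] path_symbol[OF Letter.hyps(2) r(3)]
      proj_ok_Letter[OF r(2), of a] proj_ok_Letter[OF r(4), of a] by blast
next
  case (Block p1 p2 q1 q2 r)
  let ?w = "filter (either A1 A2 p1 p2 q1 q2) ys"
  obtain w1 w2 where w: "path A1 p1 w1 q1" "clr w1 = []" "path A2 p2 w2 q2" "clr w2 = []"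
    using Block.hyps(1) by (auto simp: connected_def eps_reach_def)
  have "path A1 (initial A1) (u1 @ w1) q1" "path A2 (initial A2) (u2 @ w2) q2"
    using Block.prems w by (auto intro: path_append)
  from Block.IH[OF this] obtain r1 r2 where r: "path A1 q1 r1 (final A1)" "proj_ok V1 r r1"
    "path A2 q2 r2 (final A2)" "proj_ok V2 r r2" "set r \<subseteq> symbols (V1 \<union> V2)" by blast
  have "proj_ok V1 (?w @ r) (w1 @ r1)"
    using block_occ(1)[OF Block.hyps(1,2)] eps_op_occ[OF A1(2) Block.prems(1) w(1) r(1) w(2)] w
    by (intro proj_ok_append[OF r(2)]) (auto simp: clr_filter_ys not_bad_filter_ys)
  moreover have "proj_ok V2 (?w @ r) (w2 @ r2)"
    using block_occ(2)[OF Block.hyps(1,2)] eps_op_occ[OF A2(2) Block.prems(2) w(3) r(3) w(4)] w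
    by (intro proj_ok_append[OF r(4)]) (auto simp: clr_filter_ys not_bad_filter_ys)
  moreover have "set (?w @ r) \<subseteq> symbols (V1 \<union> V2)"
    using r(5) ys(2) by (auto simp: symbols_def ops_def)
  ultimately show ?case
    using path_append[OF w(1) r(1)] path_append[OF w(3) r(3)] by blast
qed

text \<open>Completeness, by induction on the document: both words are cut before and after their
  first letter, and the two letterless prefixes are replaced by one block.\<close>

lemma jrun_lift:
  assumes "path A1 p1 r1 (final A1)" "path A2 p2 r2 (final A2)" "clr r1 = s" "clr r2 = s"
    and "path A1 (initial A1) u1 p1" "path A2 (initial A2) u2 p2"
    and "\<forall>y\<in>ops V1 \<inter> ops V2. occ y r1 = occ y r2"
  shows "\<exists>r. jrun A1 A2 ys (final A1) (final A2) p1 p2 r \<and> clr r = s \<and>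
    (\<forall>y\<in>ops V1. occ y r = occ y r1) \<and> (\<forall>y\<in>ops V2. occ y r = occ y r2)"
proof -
  \<comment> \<open>For one letterless segment: by \<open>eps_op_occ\<close> the operations
    performed depend on the end states only, so agreement of the two given segments on common
    operations is consistency of the block.\<close>
  have block: "connected A1 A2 p1 p2 q1 q2 \<and> (\<forall>y\<in>set ys. consistent A1 A2 p1 p2 q1 q2 y) \<and>
      (\<forall>y\<in>ops V1. occ y (filter (either A1 A2 p1 p2 q1 q2) ys) = occ y w1) \<and>
      (\<forall>y\<in>ops V2. occ y (filter (either A1 A2 p1 p2 q1 q2) ys) = occ y w2)"
    if w: "path A1 p1 w1 q1" "path A2 p2 w2 q2" "clr w1 = []" "clr w2 = []"
      and u: "path A1 (initial A1) u1 p1" "path A2 (initial A2) u2 p2"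
      and v: "path A1 q1 v1 (final A1)" "path A2 q2 v2 (final A2)"
      and e: "\<forall>y\<in>ops V1 \<inter> ops V2. occ y w1 = occ y w2"
    for p1 p2 q1 q2 w1 w2 u1 u2 v1 v2
  proof -
    have "initial A1 \<in> states A1" "initial A2 \<in> states A2" using A1 A2 by (auto simp: vset_automaton_def)
    then have "p1 \<in> states A1" "p2 \<in> states A2" using u path_states A1 A2 by metis+
    moreover from this have "q1 \<in> states A1" "q2 \<in> states A2" using w path_states A1 A2 by metis+
    ultimately have c: "connected A1 A2 p1 p2 q1 q2"
      using w by (auto simp: connected_def eps_reach_def)
    have o: "y \<in> ops V1 \<Longrightarrow> occ y w1 = (if eps_op A1 y p1 q1 then [0] else [])"
       "y \<in> ops V2 \<Longrightarrow> occ y w2 = (if eps_op A2 y p2 q2 then [0] else [])" for y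
      using eps_op_occ[OF A1(2) u(1) w(1) v(1) w(3)] eps_op_occ[OF A2(2) u(2) w(2) v(2) w(4)] by auto
    have a: "\<forall>y\<in>set ys. consistent A1 A2 p1 p2 q1 q2 y"
    proof
      fix y show "consistent A1 A2 p1 p2 q1 q2 y"
        using o[of y] e by (auto simp: consistent_def split: if_splits)
    qed
    show ?thesis using c a o block_occ[OF c a] by auto
  qed
  show ?thesis using assms
  proof (induction s arbitrary: p1 p2 r1 r2 u1 u2)
    case Nil
    note b = block[OF Nil(1-6) path_Nil path_Nil Nil(7)]
    then have "jrun A1 A2 ys (final A1) (final A2) p1 p2
        (filter (either A1 A2 p1 p2 (final A1) (final A2)) ys @ [])"
      by (intro jrun.Block) (auto intro: jrun.Nil)
    then show ?case using b clr_filter_ys by auto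
  next
    case (Cons a s)
    have split: "\<exists>w r'. r = w @ Letter a # r' \<and> clr w = [] \<and> clr r' = s"
      if "clr r = a # s" for r :: "('a, 'x) symbol list"
      using that
    proof (induction r rule: clr.induct)
      case (2 b r)
      then show ?case by (intro exI[of _ "[]"] exI[of _ r]) auto
    next
      case (3 x r)
      then obtain w r' where "r = w @ Letter a # r' \<and> clr w = [] \<and> clr r' = s" by auto
      then show ?case by (intro exI[of _ "Open x # w"] exI[of _ r']) auto
    next
      case (4 x r)
      then obtain w r' where "r = w @ Letter a # r' \<and> clr w = [] \<and> clr r' = s" by auto
      then show ?case by (intro exI[of _ "Close x # w"] exI[of _ r']) auto
    qed auto
    obtain w1 r1' where r1: "r1 = w1 @ Letter a # r1'" "clr w1 = []" "clr r1' = s"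
      using split Cons.prems(3) by blast
    obtain w2 r2' where r2: "r2 = w2 @ Letter a # r2'" "clr w2 = []" "clr r2' = s"
      using split Cons.prems(4) by blast
    obtain m1 m1' where m1: "path A1 p1 w1 m1" "m1' \<in> delta A1 m1 (Some (Letter a))" "path A1 m1' r1' (final A1)"
      using path_letter_split Cons.prems(1) unfolding r1(1) by metis
    obtain m2 m2' where m2: "path A2 p2 w2 m2" "m2' \<in> delta A2 m2 (Some (Letter a))" "path A2 m2' r2' (final A2)"
      using path_letter_split Cons.prems(2) unfolding r2(1) by metis
    have e: "occ y w1 = occ y w2 \<and> occ y r1' = occ y r2'" if "y \<in> ops V1 \<inter> ops V2" for y
    proof -
      have y: "y \<in> ops V1" using that by simp
      have "(+) 0 \<circ> Suc = Suc" by (simp add: fun_eq_iff)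
      then have l: "occ y (w @ Letter a # r) = replicate (count_list w y) 0 @ map Suc (occ y r)"
        if "clr w = []" for w r :: "('a, 'x) symbol list"
        using that by (simp add: occ_append occ_clr_Nil[OF y])
      have eq: "replicate (count_list w1 y) 0 @ map Suc (occ y r1') =
          replicate (count_list w2 y) 0 @ map Suc (occ y r2')"
        using bspec[OF Cons.prems(7) that] unfolding r1(1) r2(1) l[OF r1(2)] l[OF r2(2)] .
      \<comment> \<open>Operations in the prefix have position 0 and those after the letter have
        positive positions, so filtering separates the two parts of the equation.\<close>
      have "filter ((=) 0) (replicate k 0 @ map Suc l) = replicate k 0"
        "filter ((\<noteq>) 0) (replicate k 0 @ map Suc l) = map Suc l" for k l
        by (auto simp: filter_map o_def)
      then have "replicate (count_list w1 y) 0 = replicate (count_list w2 y) (0 :: nat)"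
        "map Suc (occ y r1') = map Suc (occ y r2')" using eq by metis+
      then show ?thesis using occ_clr_Nil[OF y] r1 r2 by (auto simp: inj_map_eq_map)
    qed
    have v: "path A1 m1 (Letter a # r1') (final A1)" "path A2 m2 (Letter a # r2') (final A2)"
      using m1 m2 path_symbol by metis+
    note b = block[OF m1(1) m2(1) r1(2) r2(2) Cons.prems(5,6) v]
    have u: "path A1 (initial A1) (u1 @ w1 @ [Letter a]) m1'" "path A2 (initial A2) (u2 @ w2 @ [Letter a]) m2'"
      using Cons.prems(5,6) m1 m2 by (meson path_append path_symbol1)+
    from Cons.IH[OF m1(3) m2(3) r1(3) r2(3) u] e
    obtain r where r: "jrun A1 A2 ys (final A1) (final A2) m1' m2' r" "clr r = s"
      "\<forall>y\<in>ops V1. occ y r = occ y r1'" "\<forall>y\<in>ops V2. occ y r = occ y r2'" by auto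
    let ?w = "filter (either A1 A2 p1 p2 m1 m2) ys"
    have "jrun A1 A2 ys (final A1) (final A2) p1 p2 (?w @ Letter a # r)"
      using b e r m1 m2 by (intro jrun.Block jrun.Letter) auto
    moreover have "clr (?w @ Letter a # r) = a # s" using r(2) clr_filter_ys by simp
    moreover have "\<forall>y\<in>ops V1. occ y (?w @ Letter a # r) = occ y r1"
      "\<forall>y\<in>ops V2. occ y (?w @ Letter a # r) = occ y r2"
      using b e r r1 r2 clr_filter_ys by (auto simp: occ_append)
    ultimately show ?case by blast
  qed
qed

lemma proj_ok_valid:
  assumes "set r \<subseteq> symbols (V1 \<union> V2)" "proj_ok V1 r r1" "proj_ok V2 r r2" "valid V1 r1" "valid V2 r2"
  shows "valid (V1 \<union> V2) r"
proof -
  have "count_list r y = 1" if "proj_ok V r r'" "valid V r'" "y \<in> ops V" for V r' y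
    using that valid_count[OF that(2,3)] length_occ[OF that(3), of r] length_occ[OF that(3), of r']
    by (simp add: proj_ok_def)
  from this[OF assms(2,4)] this[OF assms(3,5)]
  have "count_list r y = 1" if "y \<in> ops V1 \<union> ops V2" for y using that by blast
  moreover have "ops (V1 \<union> V2) = ops V1 \<union> ops V2" by (auto simp: ops_def)
  moreover have "\<not> bad x r" if "x \<in> V1 \<union> V2" for x
    using that assms unfolding valid_iff proj_ok_def by blast
  ultimately show ?thesis using assms(1) unfolding valid_iff by blast
qed

lemma jrun_accept:
  assumes "jrun A1 A2 ys (final A1) (final A2) (initial A1) (initial A2) r"
  obtains r1 r2 where "r1 \<in> ref_words A1" "r2 \<in> ref_words A2" "proj_ok V1 r r1" "proj_ok V2 r r2"
    "valid V1 r1" "valid V2 r2" "valid (V1 \<union> V2) r"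
proof -
  from jrun_project[OF assms path_Nil path_Nil] obtain r1 r2 where r:
    "set r \<subseteq> symbols (V1 \<union> V2)" "r1 \<in> ref_words A1" "r2 \<in> ref_words A2" "proj_ok V1 r r1" "proj_ok V2 r r2"
    unfolding ref_words_def by blast
  then have v: "valid V1 r1" "valid V2 r2" using A1(2) A2(2) unfolding functional_def by blast+
  show ?thesis using that[OF r(2-5) v proj_ok_valid[OF r(1,4,5) v]] .
qed

lemma functional_join_automaton: "functional (join_automaton A1 A2 ys)"
proof -
  have "vars (join_automaton A1 A2 ys) = V1 \<union> V2" by (simp add: join_automaton_def)
  then show ?thesis unfolding functional_def ref_words_join Ball_def by (metis jrun_accept)
qed

lemma vset_automaton_join_automaton: "vset_automaton (join_automaton A1 A2 ys)"
proof -
  have "jstates A1 A2 (length ys) = (\<lambda>(p1, p2). Base p1 p2) ` (states A1 \<times> states A2) \<union>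
      (\<lambda>(p1, p2, q1, q2, i). Link p1 p2 q1 q2 i) `
        (states A1 \<times> states A2 \<times> states A1 \<times> states A2 \<times> {..length ys})"
    by (auto simp: jstates_def image_def)
  then have "finite (jstates A1 A2 (length ys))" using A1 A2 by (simp add: vset_automaton_def)
  moreover have "p \<in> jstates A1 A2 (length ys) \<and> q \<in> jstates A1 A2 (length ys) \<and>
      l \<in> insert None (Some ` symbols (V1 \<union> V2))" if "jtrans A1 A2 ys p l q" for p l q
    using that
  proof cases
    case (letter q1 p1 a q2 p2)
    then show ?thesis using A1 A2 by (auto simp: jstates_def vset_automaton_def symbols_def)
  next
    case (link p1 p2 q1 q2 i)
    then have "ys ! i \<in> ops (V1 \<union> V2)" using ys(2) nth_mem by blast
    then show ?thesis using link by (auto simp: jstates_def connected_def symbols_def ops_def)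
  qed (auto simp: jstates_def connected_def)
  ultimately show ?thesis
    using A1 A2 by (auto simp: vset_automaton_def join_automaton_def jstates_def)
qed

lemma spanner_of_join_automaton:
  "spanner_of (join_automaton A1 A2 ys) = join (spanner_of A1) (spanner_of A2)"
proof -
  let ?J = "join_automaton A1 A2 ys"
  have V: "vars ?J = V1 \<union> V2" by (simp add: join_automaton_def)
  have "{tuple_of (vars ?J) r |r. r \<in> ref_words ?J \<and> valid (vars ?J) r \<and> clr r = s} =
      {\<mu> \<in> tuples (V1 \<union> V2) s. \<mu> |` V1 \<in> snd (spanner_of A1) s \<and> \<mu> |` V2 \<in> snd (spanner_of A2) s}"
    (is "?L = ?R") for s
  proof (intro equalityI subsetI)
    fix \<mu> assume "\<mu> \<in> ?L"
    then obtain r where r: "\<mu> = tuple_of (V1 \<union> V2) r" "valid (V1 \<union> V2) r" "clr r = s"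
      "jrun A1 A2 ys (final A1) (final A2) (initial A1) (initial A2) r"
      by (auto simp: V ref_words_join)
    from r(4) obtain r1 r2 where p: "r1 \<in> ref_words A1" "r2 \<in> ref_words A2"
      "proj_ok V1 r r1" "proj_ok V2 r r2" "valid V1 r1" "valid V2 r2" by (auto elim: jrun_accept)
    have "\<mu> |` V1 = tuple_of V1 r1" "\<mu> |` V2 = tuple_of V2 r2"
      unfolding r(1) using p by (auto intro!: tuple_of_restrict[OF r(2)] simp: proj_ok_def)
    moreover have "clr r1 = s" "clr r2 = s" using p r by (auto simp: proj_ok_def)
    ultimately show "\<mu> \<in> ?R"
      using p tuple_of_in_tuples[OF r(2)] r(1,3) by (auto simp: spanner_of_def)
  next
    fix \<mu> assume m: "\<mu> \<in> ?R"
    then obtain r1 r2 where r: "\<mu> |` V1 = tuple_of V1 r1" "r1 \<in> ref_words A1" "valid V1 r1" "clr r1 = s"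
      "\<mu> |` V2 = tuple_of V2 r2" "r2 \<in> ref_words A2" "valid V2 r2" "clr r2 = s"
      by (auto simp: spanner_of_def)
    have "occ y r1 = occ y r2" if "y \<in> ops V1 \<inter> ops V2" for y
    proof -
      have "\<exists>x. x \<in> V1 \<and> x \<in> V2 \<and> (y = Open x \<or> y = Close x)"
        using that by (auto simp: ops_def)
      then obtain x where x: "x \<in> V1" "x \<in> V2" "y = Open x \<or> y = Close x" by blast
      have "tuple_of V1 r1 x = tuple_of V2 r2 x" using r x by (metis restrict_in)
      then show ?thesis using tuple_of_eq_occ[OF r(3,7) x(1,2)] x(3) by auto
    qed
    then obtain w where w: "jrun A1 A2 ys (final A1) (final A2) (initial A1) (initial A2) w" "clr w = s"
      "\<forall>y\<in>ops V1. occ y w = occ y r1" "\<forall>y\<in>ops V2. occ y w = occ y r2"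
      using jrun_lift[of _ r1 _ r2 s, OF _ _ r(4,8) path_Nil path_Nil] r by (auto simp: ref_words_def)
    have v: "valid (V1 \<union> V2) w" using w(1) by (auto elim: jrun_accept)
    have t: "tuple_of (V1 \<union> V2) w |` V1 = \<mu> |` V1" "tuple_of (V1 \<union> V2) w |` V2 = \<mu> |` V2"
      using tuple_of_restrict[OF v r(3)] tuple_of_restrict[OF v r(7)] w r by auto
    \<comment> \<open>A tuple on the union is determined by its two restrictions.\<close>
    have "tuple_of (V1 \<union> V2) w x = \<mu> x" if "x \<in> V1 \<union> V2" for x
      using that fun_cong[OF t(1), of x] fun_cong[OF t(2), of x] by (auto simp: restrict_map_def split: if_splits)
    moreover have "dom \<mu> = V1 \<union> V2" using m by (auto simp: tuples_def)
    ultimately have "tuple_of (V1 \<union> V2) w = \<mu>"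
      by (intro ext) (metis domIff tuple_of_def)
    then show "\<mu> \<in> ?L" using v w by (auto simp: V ref_words_join)
  qed
  then have "spanner_of ?J = (V1 \<union> V2, \<lambda>s. {\<mu> \<in> tuples (V1 \<union> V2) s.
      \<mu> |` V1 \<in> snd (spanner_of A1) s \<and> \<mu> |` V2 \<in> snd (spanner_of A2) s})"
    unfolding spanner_of_def[of ?J] V by simp
  moreover have "fst (spanner_of A1) = V1" "fst (spanner_of A2) = V2" by (simp_all add: spanner_of_def)
  ultimately show ?thesis by (simp add: join_def)
qed

end

text \<open>The states of the join automaton are terms, whereas the machine writes numbers.
  Injectivity on the states ensures that consecutive renamed transitions come from consecutive
  transitions, so no words are added.\<close>

definition rename :: "('p \<Rightarrow> 'q) \<Rightarrow> ('a, 'x, 'p) vset_automaton \<Rightarrow> ('a, 'x, 'q) vset_automaton" where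
  "rename f A = \<lparr>vars = vars A, states = f ` states A, initial = f (initial A), final = f (final A),
    delta = \<lambda>u l. {f q |p q. u = f p \<and> q \<in> delta A p l}\<rparr>"

lemma vset_automaton_rename: "vset_automaton A \<Longrightarrow> vset_automaton (rename f A)"
  by (fastforce simp: vset_automaton_def rename_def)

lemma path_rename: "path A p r q \<Longrightarrow> path (rename f A) (f p) r (f q)"
proof (induction rule: path.induct)
  case (path_eps q p r q')
  then have "f q \<in> delta (rename f A) (f p) None" by (auto simp: rename_def)
  then show ?case using path_eps.IH by (rule path.path_eps)
next
  case (path_symbol q p y r q')
  then have "f q \<in> delta (rename f A) (f p) (Some y)" by (auto simp: rename_def)
  then show ?case using path_symbol.IH by (rule path.path_symbol)
qed (rule path_Nil)

lemma path_rename_imp: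
  assumes "path (rename f A) u r w" "u = f p" "p \<in> states A" "vset_automaton A" "inj_on f (states A)"
  shows "\<exists>q\<in>states A. w = f q \<and> path A p r q"
  using assms
proof (induction arbitrary: p rule: path.induct)
  case (path_Nil u)
  then show ?case using path.path_Nil by fast
next
  case (path_eps v u r w)
  from path_eps.hyps(1) obtain p' q where q: "v = f q" "u = f p'" "q \<in> delta A p' None"
    by (auto simp: rename_def)
  then have s: "p' \<in> states A" "q \<in> states A" using path_eps.prems(3) by (auto simp: vset_automaton_def)
  then have "p' = p" using q path_eps.prems by (auto dest: inj_onD)
  then show ?case using path_eps.IH[OF q(1) s(2)] path_eps.prems q path.path_eps by metis
next
  case (path_symbol v u y r w)
  from path_symbol.hyps(1) obtain p' q where q: "v = f q" "u = f p'" "q \<in> delta A p' (Some y)"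
    by (auto simp: rename_def)
  then have s: "p' \<in> states A" "q \<in> states A" using path_symbol.prems(3) by (auto simp: vset_automaton_def)
  then have "p' = p" using q path_symbol.prems by (auto dest: inj_onD)
  then show ?case using path_symbol.IH[OF q(1) s(2)] path_symbol.prems q path.path_symbol by metis
qed

lemma ref_words_rename:
  assumes "vset_automaton A" "inj_on f (states A)"
  shows "ref_words (rename f A) = ref_words A"
proof -
  have i: "initial A \<in> states A" "final A \<in> states A" using assms(1) by (auto simp: vset_automaton_def)
  have r: "initial (rename f A) = f (initial A)" "final (rename f A) = f (final A)"
    by (simp_all add: rename_def)
  have "path (rename f A) (f (initial A)) r (f (final A)) \<longleftrightarrow> path A (initial A) r (final A)" for r
    using path_rename_imp[OF _ refl i(1) assms, of r "f (final A)"] path_rename[of A "initial A" r "final A" f]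
      inj_onD[OF assms(2) _ i(2)] by blast
  then show ?thesis by (simp add: ref_words_def r)
qed

lemma functional_rename:
  "vset_automaton A \<Longrightarrow> inj_on f (states A) \<Longrightarrow> functional (rename f A) \<longleftrightarrow> functional A"
  by (simp add: functional_def ref_words_rename) (simp add: rename_def)

lemma spanner_of_rename:
  "vset_automaton A \<Longrightarrow> inj_on f (states A) \<Longrightarrow> spanner_of (rename f A) = spanner_of A"
  by (simp add: spanner_of_def ref_words_rename) (simp add: rename_def)

section \<open>The memory layout\<close>

text \<open>Positional notation in base \<open>W\<close>, in Horner form. The leading entry
  \<open>t\<close> is a tag and need not be a digit. The code is used both for table addresses and
  for the names of output states.\<close>

definition enc :: "nat \<Rightarrow> nat \<Rightarrow> nat \<Rightarrow> nat \<Rightarrow> nat \<Rightarrow> nat \<Rightarrow> nat \<Rightarrow> nat" where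
  "enc W t a b c d e = ((((t * W + a) * W + b) * W + c) * W + d) * W + e"

lemma digit_eq:
  assumes "x * W + a = y * W + b" "a < W" "b < (W :: nat)"
  shows "x = y \<and> a = b"
proof -
  have "(x * W + a) div W = (y * W + b) div W" using assms(1) by simp
  then have "x = y" using assms(2,3) by simp
  then show ?thesis using assms(1) by simp
qed

lemma enc_eq_iff:
  assumes "a < W" "b < W" "c < W" "d < W" "e < W" "a' < W" "b' < W" "c' < W" "d' < W" "e' < W"
  shows "enc W t a b c d e = enc W t' a' b' c' d' e' \<longleftrightarrow>
    t = t' \<and> a = a' \<and> b = b' \<and> c = c' \<and> d = d' \<and> e = e'"
  unfolding enc_def using assms by (metis digit_eq)

lemma enc_less:
  assumes "t < 10" "a < W" "b < W" "c < W" "d < W" "e < W" "10 \<le> W"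
  shows "enc W t a b c d e < W ^ 6"
proof -
  have d: "x * W + y < W ^ Suc k" if "x < W ^ k" "y < W" for x y k
  proof -
    have "x * W + y < (x + 1) * W" using that by simp
    also have "\<dots> \<le> W ^ k * W" using that by (intro mult_le_mono1) simp
    finally show ?thesis by (simp add: mult.commute)
  qed
  have "t < W ^ 1" using assms by simp
  then have "enc W t a b c d e < W ^ Suc (Suc (Suc (Suc (Suc 1))))"
    unfolding enc_def using assms by (intro d)
  then show ?thesis by (simp add: numeral_eq_Suc)
qed

text \<open>A nonzero tag puts an address at \<open>W\<close> or above, whereas the input occupies
  fewer than \<open>W\<close> cells; so writing tables never damages the input.\<close>

lemma enc_ge:
  assumes "0 < t" "0 < W" shows "W \<le> enc W t a b c d e"
proof -
  have s: "W \<le> x * W + y" if "0 < x" for x y using that by (cases x) auto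
  have p: "0 < x * W + y" if "0 < x" for x y using s[OF that] assms(2) by (meson less_le_trans)
  show ?thesis unfolding enc_def by (intro s p assms(1))
qed

definition encE :: "exp \<Rightarrow> exp \<Rightarrow> exp \<Rightarrow> exp \<Rightarrow> exp \<Rightarrow> exp \<Rightarrow> exp" where
  "encE t a b c d e = (let p = (\<lambda>x y. Plus (Times x (Var 4)) y) in p (p (p (p (p t a) b) c) d) e)"

lemma ev_encE [simp]: "ev (encE t a b c d e) s =
    enc (fst s 4) (ev t s) (ev a s) (ev b s) (ev c s) (ev d s) (ev e s)"
  by (simp add: encE_def enc_def Let_def)

lemma ecost_encE [simp]:
  "ecost (encE t a b c d e) = ecost t + ecost a + ecost b + ecost c + ecost d + ecost e + 15"
  by (simp add: encE_def Let_def)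

lemma ereads_encE [simp]:
  "ereads (encE t a b c d e) = {4} \<union> ereads t \<union> ereads a \<union> ereads b \<union> ereads c \<union> ereads d \<union> ereads e"
  by (auto simp: encE_def Let_def)

text \<open>In a Horner evaluation with positive base, no intermediate value exceeds the final one,
  so a bound on the result is enough.\<close>

lemma esafe_encE:
  assumes "enc (fst s 4) (ev t s) (ev a s) (ev b s) (ev c s) (ev d s) (ev e s) < B" "0 < fst s 4"
    "esafe B t s" "esafe B a s" "esafe B b s" "esafe B c s" "esafe B d s" "esafe B e s"
  shows "esafe B (encE t a b c d e) s"
proof -
  define W where "W = fst s 4"
  have W: "0 < W" using assms(2) by (simp add: W_def)
  have less: "x * W < B \<and> x < B" if "x * W + y < B" for x y
    using that W le_trans[of x "x * W" "x * W + y"] by auto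
  define x1 where "x1 = ev t s * W + ev a s"
  define x2 where "x2 = x1 * W + ev b s"
  define x3 where "x3 = x2 * W + ev c s"
  define x4 where "x4 = x3 * W + ev d s"
  have 5: "x4 * W + ev e s < B"
    using assms(1) by (simp add: W_def x1_def x2_def x3_def x4_def enc_def)
  note l = less[OF 5]
  have 4: "x3 * W + ev d s < B" using l by (simp add: x4_def)
  note l4 = less[OF 4]
  have 3: "x2 * W + ev c s < B" using l4 by (simp add: x3_def)
  note l3 = less[OF 3]
  have 2: "x1 * W + ev b s < B" using l3 by (simp add: x2_def)
  note l2 = less[OF 2]
  have 1: "ev t s * W + ev a s < B" using l2 by (simp add: x1_def)
  note l1 = less[OF 1]
  show ?thesis
    using assms(3-) 1 2 3 4 5 l l4 l3 l2 l1
    by (simp add: encE_def Let_def W_def[symmetric] x1_def[symmetric] x2_def[symmetric]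
        x3_def[symmetric] x4_def[symmetric])
qed

text \<open>With cut-off subtraction, the sum of the two differences is the absolute difference;
  subtracting it from 1 leaves 1 exactly in case of equality.\<close>

definition eqE :: "exp \<Rightarrow> exp \<Rightarrow> exp" where
  "eqE e e' = Minus (Num 1) (Plus (Minus e e') (Minus e' e))"

lemma ev_eqE [simp]: "ev (eqE e e') s = of_bool (ev e s = ev e' s)"
  by (auto simp: eqE_def)

lemma ecost_eqE [simp]: "ecost (eqE e e') = 2 * ecost e + 2 * ecost e' + 5"
  by (simp add: eqE_def)

lemma ereads_eqE [simp]: "ereads (eqE e e') = ereads e \<union> ereads e'"
  by (auto simp: eqE_def)

lemma esafe_eqE: "esafe B e s \<Longrightarrow> esafe B e' s \<Longrightarrow> ev e s < B \<Longrightarrow> ev e' s < B \<Longrightarrow> 1 < B \<Longrightarrow> esafe B (eqE e e') s"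
  by (auto simp: eqE_def)

text \<open>Access to an encoded automaton stored from address \<open>b\<close> on.\<close>

definition headE :: "exp \<Rightarrow> nat \<Rightarrow> exp" where
  "headE b k = Deref (Plus b (Num k))"

definition stateE :: "exp \<Rightarrow> exp \<Rightarrow> exp" where
  "stateE b i = Deref (Plus (Plus b (Num 5)) i)"

definition varE :: "exp \<Rightarrow> exp \<Rightarrow> exp" where
  "varE b i = Deref (Plus (Plus (Plus b (Num 5)) (headE b 0)) i)"

definition transE :: "exp \<Rightarrow> exp \<Rightarrow> nat \<Rightarrow> exp" where
  "transE b i k = Deref (Plus (Plus (Plus (Plus (Plus b (Num 5)) (headE b 0)) (headE b 1))
    (Times (Num 4) i)) (Num k))"

lemmas accessE_defs = headE_def stateE_def varE_def transE_def

definition cellE :: "nat \<Rightarrow> exp \<Rightarrow> exp \<Rightarrow> exp \<Rightarrow> exp \<Rightarrow> exp" where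
  "cellE t a b c d = encE (Num t) a b c d (Num 0)"

definition readE :: "nat \<Rightarrow> exp \<Rightarrow> exp \<Rightarrow> exp \<Rightarrow> exp \<Rightarrow> exp" where
  "readE t a b c d = Deref (cellE t a b c d)"

lemma ecost_access [simp]:
  "ecost (headE b k) = ecost b + 3"
  "ecost (stateE b i) = ecost b + ecost i + 4"
  "ecost (varE b i) = 2 * ecost b + ecost i + 8"
  "ecost (transE b i k) = 3 * ecost b + ecost i + 16"
  "ecost (cellE t e1 e2 e3 e4) = ecost e1 + ecost e2 + ecost e3 + ecost e4 + 17"
  "ecost (readE t e1 e2 e3 e4) = ecost e1 + ecost e2 + ecost e3 + ecost e4 + 18"
  by (simp_all add: accessE_defs cellE_def readE_def)

lemma ev_cellE [simp]:
  "ev (cellE t a b c d) s = enc (fst s 4) t (ev a s) (ev b s) (ev c s) (ev d s) 0"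
  by (simp add: cellE_def)

abbreviation zero :: exp ("\<zero>") where "\<zero> \<equiv> Num 0"

section \<open>Computing the tables\<close>

text \<open>Here and below \<open>u\<close> is 0 for the first automaton and 1 for the second, and
  selects the tag; \<open>b\<close> is the expression for the address of its encoding.\<close>

definition flags :: "exp \<Rightarrow> nat \<Rightarrow> com" where
  "flags b u = For 10 11 \<zero> (headE b 1) (Write (cellE (1 + u) (varE b (Var 10)) \<zero> \<zero> \<zero>) (Num 1))"

text \<open>The relation to be closed: identity pairs, which account for the empty path, and all
  transitions whose label is not a letter, thus also those on variable operations.\<close>

definition eps_edges :: "exp \<Rightarrow> nat \<Rightarrow> com" where
  "eps_edges b u =
    For 10 11 \<zero> (headE b 0) (Write (cellE (3 + u) (stateE b (Var 10)) (stateE b (Var 10)) \<zero> \<zero>) (Num 1)) ;;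
    For 10 11 \<zero> (headE b 2) (Cond (eqE (transE b (Var 10) 1) (Num 1)) Skip
      (Write (cellE (3 + u) (transE b (Var 10) 0) (transE b (Var 10) 3) \<zero> \<zero>) (Num 1)))"

definition warshall :: "exp \<Rightarrow> nat \<Rightarrow> com" where
  "warshall b u =
    For 10 11 \<zero> (headE b 0) (For 12 13 \<zero> (headE b 0) (For 14 15 \<zero> (headE b 0)
      (Cond (readE (3 + u) (stateE b (Var 12)) (stateE b (Var 10)) \<zero> \<zero>)
        (Cond (readE (3 + u) (stateE b (Var 10)) (stateE b (Var 14)) \<zero> \<zero>)
          (Write (cellE (3 + u) (stateE b (Var 12)) (stateE b (Var 14)) \<zero> \<zero>) (Num 1))
          Skip)
        Skip)))"

text \<open>Runs over transitions \<open>a\<close> to \<open>b\<close> on an operation and marks all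
  pairs \<open>(p, q)\<close> with \<open>a\<close> reachable from \<open>p\<close> and
  \<open>q\<close> from \<open>b\<close>. With \<open>O(v n^2)\<close> transitions and
  \<open>n^2\<close> pairs this stays within \<open>O(v n^4)\<close>.\<close>

definition op_table :: "exp \<Rightarrow> nat \<Rightarrow> com" where
  "op_table b u =
    For 10 11 \<zero> (headE b 2) (Cond (Minus (transE b (Var 10) 1) (Num 1))
      (For 12 13 \<zero> (headE b 0) (For 14 15 \<zero> (headE b 0)
        (Cond (readE (3 + u) (stateE b (Var 12)) (transE b (Var 10) 0) \<zero> \<zero>)
          (Cond (readE (3 + u) (transE b (Var 10) 3) (stateE b (Var 14)) \<zero> \<zero>)
            (Write (cellE (5 + u) (transE b (Var 10) 1) (transE b (Var 10) 2)
              (stateE b (Var 12)) (stateE b (Var 14))) (Num 1))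
            Skip)
          Skip)))
      Skip)"

definition push :: "exp \<Rightarrow> com" where
  "push e = Write (cellE 7 (readE 8 \<zero> \<zero> \<zero> \<zero>) \<zero> \<zero> \<zero>) e ;;
    Write (cellE 8 \<zero> \<zero> \<zero> \<zero>) (Plus (readE 8 \<zero> \<zero> \<zero> \<zero>) (Num 1))"

definition merge_vars :: "exp \<Rightarrow> exp \<Rightarrow> com" where
  "merge_vars b b' =
    For 10 11 \<zero> (headE b 1) (push (varE b (Var 10))) ;;
    For 10 11 \<zero> (headE b' 1)
      (Cond (readE 1 (varE b' (Var 10)) \<zero> \<zero> \<zero>) Skip (push (varE b' (Var 10))))"

fun trans_word :: "('a \<Rightarrow> nat) \<Rightarrow> nat \<times> ('a, nat) symbol option \<times> nat \<Rightarrow> nat list" where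
  "trans_word code (p, l, q) = p # encode_label code l @ [q]"

definition auto_word ::
    "('a \<Rightarrow> nat) \<Rightarrow> nat list \<Rightarrow> nat list \<Rightarrow> (nat \<times> ('a, nat) symbol option \<times> nat) list \<Rightarrow> nat \<Rightarrow> nat \<Rightarrow> nat list" where
  "auto_word code qs vs ts i f =
    [length qs, length vs, length ts, i, f] @ qs @ vs @ concat (map (trans_word code) ts)"

lemma length_trans_word [simp]: "length (trans_word code t) = 4"
  by (cases t; cases "fst (snd t)"; cases "the (fst (snd t))") auto

lemma nth_concat_trans:
  assumes "i < length ts" "k < 4"
  shows "concat (map (trans_word code) ts) ! (4 * i + k) = trans_word code (ts ! i) ! k"
  using assms
proof (induction ts arbitrary: i)
  case (Cons t ts)
  then show ?case by (cases i) (auto simp: nth_append)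
qed simp

lemma length_concat_trans [simp]: "length (concat (map (trans_word code) ts)) = 4 * length ts"
  by (induction ts) auto

definition kind :: "('a, nat) symbol option \<Rightarrow> nat" where
  "kind l = (case l of None \<Rightarrow> 0 | Some (Letter a) \<Rightarrow> 1 | Some (Open x) \<Rightarrow> 2 | Some (Close x) \<Rightarrow> 3)"

definition arg :: "('a \<Rightarrow> nat) \<Rightarrow> ('a, nat) symbol option \<Rightarrow> nat" where
  "arg code l = (case l of None \<Rightarrow> 0 | Some (Letter a) \<Rightarrow> code a | Some (Open x) \<Rightarrow> x | Some (Close x) \<Rightarrow> x)"

lemma trans_word_eq: "trans_word code (p, l, q) = [p, kind l, arg code l, q]"
  by (auto simp: kind_def arg_def split: option.splits symbol.splits)

text \<open>\<open>W\<close> is the base of the address code, \<open>B\<close> stands for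
  \<open>2 ^ w\<close>, \<open>N\<close> is the length of the input and \<open>N1\<close> the
  address of the second automaton. The seventh power leaves a factor of at least 10 above six-digit
  addresses (\<open>W6_B\<close>).\<close>

locale machine =
  fixes W B N N1 :: nat and xs :: "nat list"
  assumes W: "N + 10 \<le> W" and B: "W ^ 7 \<le> B" and xs: "length xs = N" "\<forall>x\<in>set xs. x < W"
    and N1: "N1 \<le> N"
begin

abbreviation G0 :: "(nat \<times> nat) list" where
  "G0 \<equiv> [(4, W), (2, N1)]"

lemma W10: "10 \<le> W" "0 < W" "0 < W" using W by auto

lemma W6_B: "W ^ 6 * 10 \<le> B"
proof -
  have "W ^ 6 * 10 \<le> W ^ 6 * W" using W10 by (intro mult_le_mono) auto
  then show ?thesis using B by (simp add: numeral_eq_Suc mult.commute)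
qed

lemma W_W6: "W \<le> W ^ 6" using W10 by (simp add: self_le_power)

lemma W_B: "10 * W \<le> B" "100 \<le> B"
  using W_W6 W6_B W10 by linarith+

lemma less_B: "x < W \<Longrightarrow> x < B" using W_B W10 by linarith

lemma enc_less_B:
  assumes "t < 10" "a < W" "b < W" "c < W" "d < W" "e < W"
  shows "enc W t a b c d e < B"
  using enc_less[OF assms W10(1)] W6_B by linarith

text \<open>
  Cells are addressed by six digits in base \<open>W\<close>, the first of which is a tag. Cells with tags
  1 to 6 are flags, set for the tuples in \<open>X\<close>: for the first and the second automaton,
  membership of variables (1, 2), letterless reachability of states (3, 4), and letterless
  paths through a given operation (5, 6). Cells with tag 7 hold the list \<open>Y\<close> of the variables
  of the join, whose length is in the cell with tag 8. The output starts behind the cell with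
  tag 9.
\<close>

definition M :: "(nat \<times> nat \<times> nat \<times> nat \<times> nat) set \<Rightarrow> nat list \<Rightarrow> (nat \<Rightarrow> nat) \<Rightarrow> bool" where
  "M X Y m \<longleftrightarrow> (\<forall>i<N. m i = xs ! i) \<and>
    (\<forall>t\<in>{1..6}. \<forall>a<W. \<forall>b<W. \<forall>c<W. \<forall>d<W. m (enc W t a b c d 0) = of_bool ((t, a, b, c, d) \<in> X)) \<and>
    m (enc W 8 0 0 0 0 0) = length Y \<and> (\<forall>j<length Y. m (enc W 7 j 0 0 0 0) = Y ! j) \<and> length Y < W"

lemma M_flag:
  assumes "M X Y m" "t \<in> {1..6}" "a < W" "b < W" "c < W" "d < W"
  shows "m (enc W t a b c d 0) = of_bool ((t, a, b, c, d) \<in> X)"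
  using assms by (auto simp: M_def)

lemma M_set:
  assumes "M X Y m" "t \<in> {1..6}" "a < W" "b < W" "c < W" "d < W"
  shows "M (insert (t, a, b, c, d) X) Y (m(enc W t a b c d 0 := 1))"
proof -
  have "N < enc W t a b c d 0" using enc_ge[of t W a b c d 0] assms(2) W by auto
  then show ?thesis
    unfolding M_def using assms W10
    apply (intro conjI ballI allI impI)
    subgoal by (auto simp: M_def)
    subgoal by (simp add: M_def enc_eq_iff)
    subgoal by (auto simp add: M_def enc_eq_iff)
    subgoal by (auto simp add: M_def enc_eq_iff)
    subgoal by (simp add: M_def)
    done
qed

lemma M_push:
  assumes "M X Y m" "Suc (length Y) < W" "x < W"
  shows "M X (Y @ [x]) (m(enc W 7 (length Y) 0 0 0 0 := x, enc W 8 0 0 0 0 0 := Suc (length Y)))"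
proof -
  have "N < enc W 7 (length Y) 0 0 0 0" "N < enc W 8 0 0 0 0 0"
    using enc_ge[of 7 W "length Y" 0 0 0 0] enc_ge[of 8 W 0 0 0 0 0] W by auto
  then show ?thesis
    unfolding M_def using assms W10
    apply (intro conjI ballI allI impI)
    subgoal by (auto simp: M_def)
    subgoal by (auto simp add: M_def enc_eq_iff)
    subgoal by (auto simp add: M_def enc_eq_iff)
    subgoal by (auto simp add: M_def enc_eq_iff nth_append less_Suc_eq)
    subgoal by (simp add: M_def)
    done
qed

lemma esafe_cellE:
  assumes "fst s 4 = W" "t < 10" "ev a s < W" "ev b s < W" "ev c s < W" "ev d s < W"
    "esafe B a s" "esafe B b s" "esafe B c s" "esafe B d s"
  shows "esafe B (cellE t a b c d) s"
proof -
  have "enc W t (ev a s) (ev b s) (ev c s) (ev d s) 0 < B"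
    using assms W10 by (intro enc_less_B) auto
  then show ?thesis unfolding cellE_def using assms W10 W_B by (intro esafe_encE) auto
qed

lemma ev_readE:
  assumes "M X Y (snd s)" "fst s 4 = W" "t \<in> {1..6}" "ev a s < W" "ev b s < W" "ev c s < W" "ev d s < W"
  shows "ev (readE t a b c d) s = of_bool ((t, ev a s, ev b s, ev c s, ev d s) \<in> X)"
  unfolding readE_def using assms M_flag[OF assms(1,3-)] by simp

lemma esafe_readE:
  assumes "fst s 4 = W" "t < 10" "ev a s < W" "ev b s < W" "ev c s < W" "ev d s < W"
    "esafe B a s" "esafe B b s" "esafe B c s" "esafe B d s"
  shows "esafe B (readE t a b c d) s"
  unfolding readE_def using esafe_cellE[OF assms] by simp

text \<open>Turns a memory write into the insertion of one tuple into the abstract flag set, so that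
  the loop proofs below become statements about sets.\<close>

lemma triple_mark:
  assumes "\<And>f m. agree G f \<Longrightarrow> M X Y m \<Longrightarrow> f 4 = W \<and>
      ev a (f, m) = va \<and> ev b (f, m) = vb \<and> ev c (f, m) = vc \<and> ev d (f, m) = vd \<and>
      esafe B a (f, m) \<and> esafe B b (f, m) \<and> esafe B c (f, m) \<and> esafe B d (f, m)"
    and "t \<in> {1..6}" "va < W" "vb < W" "vc < W" "vd < W"
    and "ecost a + ecost b + ecost c + ecost d + 19 \<le> T"
    and "insert (t, va, vb, vc, vd) X = X'"
  shows "triple B G (M X Y) (Write (cellE t a b c d) (Num 1)) (M X' Y) T"
proof (rule triple_Write)
  fix f m assume *: "agree G f" "M X Y m"
  note a = assms(1)[OF *]
  have "esafe B (cellE t a b c d) (f, m)" using a assms(2-6) by (intro esafe_cellE) auto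
  then show "esafe B (cellE t a b c d) (f, m) \<and> esafe B (Num 1) (f, m) \<and>
      M X' Y (m(ev (cellE t a b c d) (f, m) := ev (Num 1) (f, m)))"
    using a W_B M_set[OF *(2) assms(2-6)] assms(8) by simp
qed (use assms(7) in simp)

end

lemma set_take_Suc: "i < length xs \<Longrightarrow> set (take (Suc i) xs) = insert (xs ! i) (set (take i xs))"
  by (simp add: take_Suc_conv_app_nth)

text \<open>One encoded automaton inside the input, from address \<open>b\<close> on. The expression
  \<open>eb\<close> for this address will be \<open>Num 0\<close> or \<open>Var 2\<close>; both have
  cost 1, so the numerical time bounds are shared.\<close>

locale segment = machine W B N N1 xs for W B N N1 :: nat and xs :: "nat list" +
  fixes code :: "'a \<Rightarrow> nat" and eb :: exp and b :: nat and qs vs :: "nat list"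
    and ts :: "(nat \<times> ('a, nat) symbol option \<times> nat) list" and ini fin :: nat
  assumes eb: "\<And>f m. f 2 = N1 \<Longrightarrow> ev eb (f, m) = b" "\<And>s. esafe B eb s" "ecost eb = 1"
    and seg: "b + length (auto_word code qs vs ts ini fin) \<le> N"
      "\<And>i. i < length (auto_word code qs vs ts ini fin) \<Longrightarrow>
        xs ! (b + i) = auto_word code qs vs ts ini fin ! i"
begin

abbreviation "src i \<equiv> fst (ts ! i)"
abbreviation "lab i \<equiv> fst (snd (ts ! i))"
abbreviation "tgt i \<equiv> snd (snd (ts ! i))"

lemma length_word: "length (auto_word code qs vs ts ini fin) = 5 + length qs + length vs + 4 * length ts"
  by (simp add: auto_word_def)

lemma seg_less: "b + (5 + length qs + length vs + 4 * length ts) \<le> N"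
  using seg(1) by (simp add: length_word)

lemma lengths_less: "b < W" "length qs < W" "length vs < W" "length ts < W"
  using seg_less W by linarith+

lemma M_word:
  assumes "M X Y m" "i < 5 + length qs + length vs + 4 * length ts"
  shows "m (b + i) = auto_word code qs vs ts ini fin ! i" "m (b + i) < W"
proof -
  have i: "b + i < N" using assms(2) seg_less by linarith
  then have "m (b + i) = xs ! (b + i)" using assms(1) by (simp add: M_def)
  then show "m (b + i) = auto_word code qs vs ts ini fin ! i" "m (b + i) < W"
    using seg(2)[of i] assms(2) length_word xs i nth_mem[of "b + i" xs] by auto
qed

lemma M_head:
  assumes "M X Y m"
  shows "m b = length qs" "m (b + 1) = length vs" "m (b + 2) = length ts" "m (b + 3) = ini" "m (b + 4) = fin"
  using M_word(1)[OF assms, of 0] M_word(1)[OF assms, of 1] M_word(1)[OF assms, of 2]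
    M_word(1)[OF assms, of 3] M_word(1)[OF assms, of 4]
  by (simp_all add: auto_word_def)

lemma M_state: "M X Y m \<Longrightarrow> i < length qs \<Longrightarrow> m (b + 5 + i) = qs ! i"
  using M_word(1)[of X Y m "5 + i"] by (simp add: auto_word_def nth_append add.assoc)

lemma M_var: "M X Y m \<Longrightarrow> i < length vs \<Longrightarrow> m (b + 5 + length qs + i) = vs ! i"
  using M_word(1)[of X Y m "5 + length qs + i"] by (simp add: auto_word_def nth_append add.assoc)

lemma M_trans:
  assumes "M X Y m" "i < length ts" "k < 4"
  shows "m (b + 5 + length qs + length vs + 4 * i + k) = trans_word code (ts ! i) ! k"
  using M_word(1)[OF assms(1), of "5 + length qs + length vs + 4 * i + k"] assms(2,3)
    nth_concat_trans[OF assms(2,3), of code]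
  by (simp add: auto_word_def nth_append add.assoc)

lemma trans_word_ts: "trans_word code (ts ! i) = [src i, kind (lab i), arg code (lab i), tgt i]"
  by (metis prod.collapse trans_word_eq)

lemma ev_headE:
  assumes "M X Y m" "f 2 = N1"
  shows "ev (headE eb 0) (f, m) = length qs" "ev (headE eb (Suc 0)) (f, m) = length vs"
    "ev (headE eb 2) (f, m) = length ts" "ev (headE eb 3) (f, m) = ini" "ev (headE eb 4) (f, m) = fin"
  using M_head[OF assms(1)] assms(2) eb(1) by (simp_all add: headE_def)

lemma ev_stateE:
  "M X Y m \<Longrightarrow> f 2 = N1 \<Longrightarrow> f r < length qs \<Longrightarrow> ev (stateE eb (Var r)) (f, m) = qs ! f r"
  using M_state[of X Y m "f r"] eb(1) by (simp add: stateE_def)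

lemma ev_varE:
  "M X Y m \<Longrightarrow> f 2 = N1 \<Longrightarrow> f r < length vs \<Longrightarrow> ev (varE eb (Var r)) (f, m) = vs ! f r"
  using M_var[of X Y m "f r"] eb(1) ev_headE(1) by (simp add: varE_def)

lemma ev_transE:
  assumes "M X Y m" "f 2 = N1" "f r < length ts"
  shows "ev (transE eb (Var r) 0) (f, m) = src (f r)" "ev (transE eb (Var r) (Suc 0)) (f, m) = kind (lab (f r))"
    "ev (transE eb (Var r) 2) (f, m) = arg code (lab (f r))" "ev (transE eb (Var r) 3) (f, m) = tgt (f r)"
proof -
  have "ev (transE eb (Var r) k) (f, m) = trans_word code (ts ! f r) ! k" if "k < 4" for k
    using M_trans[OF assms(1,3) that] eb(1) ev_headE[of X Y m f] assms(1,2) by (simp add: transE_def)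
  from this[of 0] this[of 1] this[of 2] this[of 3]
  show "ev (transE eb (Var r) 0) (f, m) = src (f r)" "ev (transE eb (Var r) (Suc 0)) (f, m) = kind (lab (f r))"
    "ev (transE eb (Var r) 2) (f, m) = arg code (lab (f r))" "ev (transE eb (Var r) 3) (f, m) = tgt (f r)"
    unfolding trans_word_ts by simp_all
qed

lemmas ev_access = ev_headE ev_stateE ev_varE ev_transE

lemma esafe_headE: "f 2 = N1 \<Longrightarrow> k < 10 \<Longrightarrow> esafe B (headE eb k) (f, m)"
  using eb W_B lengths_less by (simp add: headE_def)

lemma esafe_stateE: "f 2 = N1 \<Longrightarrow> f r < length qs \<Longrightarrow> esafe B (stateE eb (Var r)) (f, m)"
  using eb W_B lengths_less by (simp add: stateE_def)

lemma esafe_varE: "M X Y m \<Longrightarrow> f 2 = N1 \<Longrightarrow> f r < length vs \<Longrightarrow> esafe B (varE eb (Var r)) (f, m)"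
  using eb W_B lengths_less ev_headE(1)[of X Y m f] esafe_headE[of f 0 m] by (simp add: varE_def)

lemma esafe_transE:
  "M X Y m \<Longrightarrow> f 2 = N1 \<Longrightarrow> f r < length ts \<Longrightarrow> k < 4 \<Longrightarrow> esafe B (transE eb (Var r) k) (f, m)"
  using eb W_B lengths_less ev_headE[of X Y m f] esafe_headE[of f 0 m] esafe_headE[of f 1 m]
  by (simp add: transE_def)

lemmas esafe_access = esafe_headE esafe_stateE esafe_varE esafe_transE

end

section \<open>Warshall's algorithm on relations\<close>

definition pairs :: "nat \<Rightarrow> (nat \<times> nat) set \<Rightarrow> (nat \<times> nat \<times> nat \<times> nat \<times> nat) set" where
  "pairs u S = (\<lambda>(p, q). (3 + u, p, q, 0, 0)) ` S"

lemma pairs_iff: "(t, p, q, c, d) \<in> pairs u S \<longleftrightarrow> t = 3 + u \<and> (p, q) \<in> S \<and> c = 0 \<and> d = 0"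
  by (auto simp: pairs_def)

lemma pairs_insert: "insert (3 + u, p, q, 0, 0) (X \<union> pairs u S) = X \<union> pairs u (insert (p, q) S)"
  by (auto simp: pairs_def)

text \<open>\<open>P\<close> is the set of combinations of a transition and two states visited so
  far; the loop invariants are instances with growing \<open>P\<close>.\<close>

definition op_marks ::
    "('a \<Rightarrow> nat) \<Rightarrow> nat \<Rightarrow> (nat \<times> nat \<times> nat \<times> nat \<times> nat) set \<Rightarrow>
      ((nat \<times> ('a, nat) symbol option \<times> nat) \<times> nat \<times> nat) set \<Rightarrow> (nat \<times> nat \<times> nat \<times> nat \<times> nat) set" where
  "op_marks code u X P = (\<lambda>(t, p, q). (5 + u, kind (fst (snd t)), arg code (fst (snd t)), p, q)) `
    {x \<in> P. case x of (t, p, q) \<Rightarrow> 2 \<le> kind (fst (snd t)) \<and>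
      (3 + u, p, fst t, 0, 0) \<in> X \<and> (3 + u, snd (snd t), q, 0, 0) \<in> X}"

text \<open>An unfinished pass of Warshall's algorithm with pivot \<open>k\<close>, in which the
  pairs in \<open>P\<close> have been treated. Pairs are always tested against \<open>S\<close>, the
  relation before the pass.\<close>

definition transit :: "(nat \<times> nat) set \<Rightarrow> nat \<Rightarrow> (nat \<times> nat) set \<Rightarrow> (nat \<times> nat) set" where
  "transit S k P = S \<union> {(p, q). (p, q) \<in> P \<and> (p, k) \<in> S \<and> (k, q) \<in> S}"

definition close_under :: "nat set \<Rightarrow> (nat \<times> nat) set \<Rightarrow> nat list \<Rightarrow> (nat \<times> nat) set" where
  "close_under Q S ks = foldl (\<lambda>S k. transit S k (Q \<times> Q)) S ks"

text \<open>A pass changes neither the row nor the column of its pivot: a pair \<open>(p, k)\<close>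
  is added only if it is already present. Hence updating in place reads the same values as the old
  relation.\<close>

lemma transit_col: "(p, k) \<in> transit S k P \<longleftrightarrow> (p, k) \<in> S" "(k, q) \<in> transit S k P \<longleftrightarrow> (k, q) \<in> S"
  by (auto simp: transit_def)

lemma transit_insert:
  "transit S k (insert (p, q) P) =
    (if (p, k) \<in> S \<and> (k, q) \<in> S then insert (p, q) (transit S k P) else transit S k P)"
  by (auto simp: transit_def)

lemma close_under_sound:
  assumes "S \<subseteq> T\<^sup>*" shows "close_under Q S ks \<subseteq> T\<^sup>*"
  using assms unfolding close_under_def
proof (induction ks arbitrary: S)
  case (Cons k ks)
  have "transit S k (Q \<times> Q) \<subseteq> T\<^sup>*"
    using Cons.prems by (auto simp: transit_def intro: rtrancl_trans)
  then show ?case using Cons.IH by simp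
qed simp

lemma close_under_Q: "S \<subseteq> Q \<times> Q \<Longrightarrow> close_under Q S ks \<subseteq> Q \<times> Q"
  unfolding close_under_def
proof (induction ks arbitrary: S)
  case (Cons k ks)
  have "transit S k (Q \<times> Q) \<subseteq> Q \<times> Q" using Cons.prems by (auto simp: transit_def)
  from Cons.IH[OF this] show ?case by simp
qed simp

lemma close_under_mono: "S \<subseteq> close_under Q S ks"
proof -
  have "S' \<subseteq> S \<Longrightarrow> S' \<subseteq> close_under Q S ks" for S'
    unfolding close_under_def
  proof (induction ks arbitrary: S)
    case (Cons k ks)
    have "S' \<subseteq> transit S k (Q \<times> Q)" using Cons.prems by (auto simp: transit_def)
    from Cons.IH[OF this] show ?case by simp
  qed simp
  then show ?thesis by blast
qed

text \<open>Warshall's invariant without paths: after the pivots in \<open>K\<close>, the relation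
  is closed under composition through every point of \<open>K\<close>. A pass with a further pivot
  must preserve this for the old points.\<close>

lemma close_under_closed:
  assumes "S \<subseteq> Q \<times> Q" "k \<in> set ks" "(p, k) \<in> close_under Q S ks" "(k, q) \<in> close_under Q S ks"
  shows "(p, q) \<in> close_under Q S ks"
proof -
  define closed where "closed S K \<longleftrightarrow> (\<forall>k\<in>K. \<forall>p q. (p, k) \<in> S \<longrightarrow> (k, q) \<in> S \<longrightarrow> (p, q) \<in> S)" for S :: "(nat \<times> nat) set" and K
  have step: "closed (transit S k (Q \<times> Q)) (insert k K)" if "closed S K" "S \<subseteq> Q \<times> Q" for S k K
    unfolding closed_def
  proof (intro ballI allI impI)
    fix k' p q assume k': "k' \<in> insert k K" and pq: "(p, k') \<in> transit S k (Q \<times> Q)" "(k', q) \<in> transit S k (Q \<times> Q)"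
    have pqQ: "p \<in> Q" "q \<in> Q" using pq that(2) by (auto simp: transit_def)
    show "(p, q) \<in> transit S k (Q \<times> Q)"
    proof (cases "k' = k")
      case True
      then show ?thesis using pq pqQ transit_col by (auto simp: transit_def)
    next
      case False
      then have "k' \<in> K" using k' by simp
      then have c: "(x, k') \<in> S \<Longrightarrow> (k', y) \<in> S \<Longrightarrow> (x, y) \<in> S" for x y
        using that(1) unfolding closed_def by blast
      show ?thesis
      proof (cases "(p, k') \<in> S")
        case pk: True
        show ?thesis
        proof (cases "(k', q) \<in> S")
          case True
          then show ?thesis using c pk by (auto simp: transit_def)
        next
          case False
          \<comment> \<open>The pair \<open>(k', q)\<close> is new, so it came through
            \<open>k\<close>. Closure at \<open>k'\<close> composes \<open>(p, k')\<close> and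
            \<open>(k', k)\<close> to \<open>(p, k)\<close>, and the pass adds
            \<open>(p, q)\<close>.\<close>
          then have "(k', k) \<in> S" "(k, q) \<in> S" using pq(2) by (auto simp: transit_def)
          then show ?thesis using c[OF pk] pqQ by (auto simp: transit_def)
        qed
      next
        case False
        then have pk: "(p, k) \<in> S" "(k, k') \<in> S" using pq(1) by (auto simp: transit_def)
        \<comment> \<open>Either \<open>(k', q)\<close> is old and closure at \<open>k'\<close>
          composes it with \<open>(k, k')\<close>, or it came through \<open>k\<close>
          itself.\<close>
        then have "(k, q) \<in> S" using pq(2) c by (auto simp: transit_def)
        then show ?thesis using pk pqQ by (auto simp: transit_def)
      qed
    qed
  qed
  have "closed (close_under Q S ks) (set ks \<union> K)" if "closed S K" "S \<subseteq> Q \<times> Q" for S K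
    using that unfolding close_under_def
  proof (induction ks arbitrary: S K)
    case (Cons k ks)
    have "transit S k (Q \<times> Q) \<subseteq> Q \<times> Q" using Cons.prems(2) by (auto simp: transit_def)
    from Cons.IH[OF step[OF Cons.prems] this] show ?case by simp
  qed simp
  from this[of S "{}"] assms show ?thesis unfolding closed_def by auto
qed

text \<open>Every element of \<open>qs\<close> has been a pivot, so a path can be absorbed one edge
  at a time; the identity pairs start the induction.\<close>

lemma close_under_eq:
  assumes "S \<subseteq> set qs \<times> set qs" "Id_on (set qs) \<subseteq> S"
  shows "close_under (set qs) S qs = S\<^sup>* \<inter> set qs \<times> set qs"
proof
  show "close_under (set qs) S qs \<subseteq> S\<^sup>* \<inter> set qs \<times> set qs"
    using close_under_sound[of S S "set qs" qs] close_under_Q[OF assms(1), of qs] by auto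
next
  have "(p, q) \<in> close_under (set qs) S qs" if "(p, q) \<in> S\<^sup>*" "p \<in> set qs" for p q
    using that
  proof (induction rule: rtrancl_induct)
    case base
    then show ?case using assms(2) close_under_mono[of S "set qs" qs] by auto
  next
    case (step q r)
    then have "(q, r) \<in> close_under (set qs) S qs" "q \<in> set qs"
      using assms(1) close_under_mono[of S "set qs" qs] by auto
    then show ?case using close_under_closed[OF assms(1)] step by blast
  qed
  then show "S\<^sup>* \<inter> set qs \<times> set qs \<subseteq> close_under (set qs) S qs" by auto
qed

section \<open>Time-bounded triples for the tables of one automaton\<close>

context segment
begin

lemma qs_less: "q \<in> set qs \<Longrightarrow> q < W"
proof -
  assume "q \<in> set qs"
  then obtain i where i: "i < length qs" "q = qs ! i" by (auto simp: in_set_conv_nth)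
  have "xs ! (b + (5 + i)) = q"
    using seg(2)[of "5 + i"] i by (simp add: length_word auto_word_def nth_append)
  then show ?thesis using i seg_less xs nth_mem[of "b + (5 + i)" xs] by force
qed

lemma vs_less: "x \<in> set vs \<Longrightarrow> x < W"
proof -
  assume "x \<in> set vs"
  then obtain i where i: "i < length vs" "x = vs ! i" by (auto simp: in_set_conv_nth)
  have "xs ! (b + (5 + length qs + i)) = x"
    using seg(2)[of "5 + length qs + i"] i by (simp add: length_word auto_word_def nth_append)
  then show ?thesis using i seg_less xs nth_mem[of "b + (5 + length qs + i)" xs] by force
qed

lemma ts_less:
  assumes "i < length ts" shows "src i < W" "kind (lab i) < W" "arg code (lab i) < W" "tgt i < W"
proof -
  have *: "trans_word code (ts ! i) ! k < W" if "k < 4" for k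
  proof -
    have "xs ! (b + (5 + length qs + length vs + 4 * i + k)) = trans_word code (ts ! i) ! k"
      using seg(2)[of "5 + length qs + length vs + 4 * i + k"] assms that
      by (simp add: length_word auto_word_def nth_append nth_concat_trans add.assoc)
    then show ?thesis
      using assms that seg_less xs nth_mem[of "b + (5 + length qs + length vs + 4 * i + k)" xs] by force
  qed
  show "src i < W" "kind (lab i) < W" "arg code (lab i) < W" "tgt i < W"
    using *[of 0] *[of 1] *[of 2] *[of 3] unfolding trans_word_ts by simp_all
qed

lemma flags_triple:
  assumes "u \<le> 1"
  shows "triple B G0 (M X Y) (flags eb u) (M (X \<union> {(1 + u, x, 0, 0, 0) |x. x \<in> set vs}) Y)
    (100 * ((length vs + 1) * 1))"
proof -
  \<comment> \<open>As in all table loops, the invariant is the target set with the traversed list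
    cut to its first \<open>i\<close> entries.\<close>
  define I where "I i = M (X \<union> {(1 + u, x, 0, 0, 0) |x. x \<in> set (take i vs)}) Y" for i
  have "triple B G0 (M X Y) (flags eb u) (I (length vs)) (100 * ((length vs + 1) * 1))"
    unfolding flags_def
  proof (rule triple_For[where I = I and K = 40])
    fix i assume i: "0 \<le> i" "i < length vs"
    show "triple B ((10, i) # G0) (I i) (Write (cellE (1 + u) (varE eb (Var 10)) \<zero> \<zero> \<zero>) (Num 1))
        (I (Suc i)) (40 * 1)"
      unfolding I_def
    proof (rule triple_mark)
      show "insert (1 + u, vs ! i, 0, 0, 0) (X \<union> {(1 + u, x, 0, 0, 0) |x. x \<in> set (take i vs)}) =
          X \<union> {(1 + u, x, 0, 0, 0) |x. x \<in> set (take (Suc i) vs)}"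
        using set_take_Suc[OF i(2)] by auto
    qed (use assms i vs_less W10 less_B in \<open>simp_all add: ev_access esafe_access eb(3)\<close>)
  qed (use W10 W_B lengths_less less_B eb in \<open>simp_all add: I_def ev_access esafe_access\<close>)
  then show ?thesis by (simp add: I_def)
qed

lemma eps_edges_triple:
  assumes "u \<le> 1"
  shows "triple B G0 (M X Y) (eps_edges eb u)
    (M (X \<union> pairs u (Id_on (set qs) \<union> {(p, q) |p l q. (p, l, q) \<in> set ts \<and> kind l \<noteq> 1})) Y)
    (100 * ((length qs + 1) * 1) + 300 * ((length ts + 1) * 1))"
proof -
  define I where "I i = M (X \<union> pairs u (Id_on (set (take i qs)))) Y" for i
  define S where "S i = Id_on (set qs) \<union> {(p, q) |p l q. (p, l, q) \<in> set (take i ts) \<and> kind l \<noteq> 1}" for i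
  define J where "J i = M (X \<union> pairs u (S i)) Y" for i
  have S: "S (Suc i) = (if kind (lab i) = 1 then S i else insert (src i, tgt i) (S i))"
    if "i < length ts" for i
    using set_take_Suc[OF that] by (cases "ts ! i") (auto simp: S_def)
  have "triple B G0 (M X Y) (For 10 11 \<zero> (headE eb 0)
      (Write (cellE (3 + u) (stateE eb (Var 10)) (stateE eb (Var 10)) \<zero> \<zero>) (Num 1)))
      (I (length qs)) (100 * ((length qs + 1) * 1))"
  proof (rule triple_For[where I = I and K = 40])
    fix i assume i: "0 \<le> i" "i < length qs"
    show "triple B ((10, i) # G0) (I i)
        (Write (cellE (3 + u) (stateE eb (Var 10)) (stateE eb (Var 10)) \<zero> \<zero>) (Num 1)) (I (Suc i)) (40 * 1)"
      unfolding I_def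
    proof (rule triple_mark)
      show "insert (3 + u, qs ! i, qs ! i, 0, 0) (X \<union> pairs u (Id_on (set (take i qs)))) =
          X \<union> pairs u (Id_on (set (take (Suc i) qs)))"
        unfolding pairs_insert set_take_Suc[OF i(2)] by (auto simp: pairs_iff)
    qed (use assms i qs_less W10 less_B in \<open>simp_all add: ev_access esafe_access eb(3)\<close>)
  qed (use W10 W_B lengths_less less_B eb in \<open>simp_all add: I_def pairs_def ev_access esafe_access\<close>)
  moreover have "triple B G0 (I (length qs)) (For 10 11 \<zero> (headE eb 2)
      (Cond (eqE (transE eb (Var 10) 1) (Num 1)) Skip
        (Write (cellE (3 + u) (transE eb (Var 10) 0) (transE eb (Var 10) 3) \<zero> \<zero>) (Num 1))))
      (J (length ts)) (300 * ((length ts + 1) * 1))"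
  proof (rule triple_For[where I = J and K = 200])
    fix i assume i: "0 \<le> i" "i < length ts"
    show "triple B ((10, i) # G0) (J i)
        (Cond (eqE (transE eb (Var 10) 1) (Num 1)) Skip
          (Write (cellE (3 + u) (transE eb (Var 10) 0) (transE eb (Var 10) 3) \<zero> \<zero>) (Num 1)))
        (J (Suc i)) (200 * 1)"
    proof (rule triple_Cond[where T' = 80 and ?P1.0 = "\<lambda>m. J i m \<and> kind (lab i) = 1" and ?P2.0 = "\<lambda>m. J i m \<and> kind (lab i) \<noteq> 1"])
      show "triple B ((10, i) # G0) (\<lambda>m. J i m \<and> kind (lab i) = 1) Skip (J (Suc i)) 80"
        by (rule triple_Skip) (simp add: J_def S[OF i(2)])
      show "triple B ((10, i) # G0) (\<lambda>m. J i m \<and> kind (lab i) \<noteq> 1)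
          (Write (cellE (3 + u) (transE eb (Var 10) 0) (transE eb (Var 10) 3) \<zero> \<zero>) (Num 1)) (J (Suc i)) 80"
      proof (cases "kind (lab i) = 1")
        case False
        have "triple B ((10, i) # G0) (M (X \<union> pairs u (S i)) Y)
          (Write (cellE (3 + u) (transE eb (Var 10) 0) (transE eb (Var 10) 3) \<zero> \<zero>) (Num 1)) (J (Suc i)) 80"
          unfolding J_def
        proof (rule triple_mark)
          show "insert (3 + u, src i, tgt i, 0, 0) (X \<union> pairs u (S i)) = X \<union> pairs u (S (Suc i))"
            using False by (simp add: S[OF i(2)] pairs_insert del: insert_iff)
        qed (use assms i ts_less W10 less_B in \<open>simp_all add: ev_access esafe_access eb(3)\<close>)
        then show ?thesis by (rule triple_conseq) (auto simp: J_def)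
      qed (simp add: triple_def)
    qed (use i ts_less[OF i(2)] W_B less_B in \<open>simp_all add: J_def ev_access esafe_access esafe_eqE eb(3)\<close>)
  qed (use W10 W_B lengths_less less_B eb in \<open>simp_all add: I_def J_def S_def ev_access esafe_access\<close>)
  ultimately have "triple B G0 (M X Y) (eps_edges eb u) (J (length ts))
      (100 * ((length qs + 1) * 1) + 300 * ((length ts + 1) * 1))"
    unfolding eps_edges_def by (rule triple_Seq) auto
  then show ?thesis by (simp add: J_def S_def)
qed

text \<open>The memory holds the unfinished relation, but both tests concern the row or column of
  the pivot, where by \<open>transit_col\<close> it agrees with \<open>S\<close>. The hypothesis on
  \<open>X\<close> makes \<open>S\<close> the only source of these flags.\<close>

lemma warshall_body:
  assumes u: "u \<le> 1" and X: "\<And>p q. (3 + u, p, q, 0, 0) \<notin> X"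
    and i: "k < length qs" "i < length qs" "j < length qs"
  shows "triple B ((14, j) # (12, i) # (10, k) # G0)
    (M (X \<union> pairs u (transit S (qs ! k) P)) Y)
    (Cond (readE (3 + u) (stateE eb (Var 12)) (stateE eb (Var 10)) \<zero> \<zero>)
      (Cond (readE (3 + u) (stateE eb (Var 10)) (stateE eb (Var 14)) \<zero> \<zero>)
        (Write (cellE (3 + u) (stateE eb (Var 12)) (stateE eb (Var 14)) \<zero> \<zero>) (Num 1))
        Skip)
      Skip)
    (M (X \<union> pairs u (transit S (qs ! k) (insert (qs ! i, qs ! j) P))) Y) (200 * 1)"
    (is "triple B ?G ?P0 (Cond ?e1 (Cond ?e2 ?w Skip) Skip) ?Q _")
proof -
  let ?p = "qs ! i" and ?k = "qs ! k" and ?q = "qs ! j"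
  have l: "?p < W" "?k < W" "?q < W" using i qs_less by auto
  have u6: "3 + u \<in> {1..6}" "3 + u < 10" using u by auto
  have 1: "esafe B ?e1 (f, m) \<and> ev ?e1 (f, m) = of_bool ((?p, ?k) \<in> S)"
    "esafe B ?e2 (f, m) \<and> ev ?e2 (f, m) = of_bool ((?k, ?q) \<in> S)"
    if "agree ?G f" "?P0 m" for f m
    using that i l u6 W10 less_B
    by (simp_all add: ev_readE esafe_readE ev_access esafe_access pairs_iff X transit_col)
  have w: "triple B ?G (\<lambda>m. ?P0 m \<and> (?p, ?k) \<in> S \<and> (?k, ?q) \<in> S) ?w ?Q 50"
  proof (cases "(?p, ?k) \<in> S \<and> (?k, ?q) \<in> S")
    case True
    have "triple B ?G ?P0 ?w ?Q 50"
    proof (rule triple_mark)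
      show "insert (3 + u, ?p, ?q, 0, 0) (X \<union> pairs u (transit S ?k P)) =
          X \<union> pairs u (transit S ?k (insert (?p, ?q) P))"
        unfolding pairs_insert transit_insert using True by simp
    qed (use u6 i l W10 less_B in \<open>simp_all add: ev_access esafe_access eb(3)\<close>)
    then show ?thesis by (rule triple_conseq) auto
  next
    case False
    then show ?thesis unfolding triple_def by blast
  qed
  show ?thesis
  proof (rule triple_Cond[where T' = 120 and ?P1.0 = "\<lambda>m. ?P0 m \<and> (?p, ?k) \<in> S"
        and ?P2.0 = "\<lambda>m. ?P0 m \<and> (?p, ?k) \<notin> S"])
    show "triple B ?G (\<lambda>m. ?P0 m \<and> (?p, ?k) \<in> S) (Cond ?e2 ?w Skip) ?Q 120"
    proof (rule triple_Cond[OF _ w, where ?P2.0 = "\<lambda>m. ?P0 m \<and> (?k, ?q) \<notin> S"])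
      show "triple B ?G (\<lambda>m. ?P0 m \<and> (?k, ?q) \<notin> S) Skip ?Q 50"
        by (rule triple_Skip) (simp add: transit_insert)
    qed (use 1 in \<open>simp_all add: eb(3)\<close>)
    show "triple B ?G (\<lambda>m. ?P0 m \<and> (?p, ?k) \<notin> S) Skip ?Q 120"
      by (rule triple_Skip) (simp add: transit_insert)
  qed (use 1 in \<open>simp_all add: eb(3)\<close>)
qed

lemma warshall_triple:
  assumes u: "u \<le> 1" and X: "\<And>p q. (3 + u, p, q, 0, 0) \<notin> X" and S: "S \<subseteq> set qs \<times> set qs"
  shows "triple B G0 (M (X \<union> pairs u S) Y) (warshall eb u)
    (M (X \<union> pairs u (close_under (set qs) S qs)) Y)
    (500 * ((length qs + 1) * ((length qs + 1) * ((length qs + 1) * 1))))"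
proof -
  let ?n = "length qs"
  define Q where "Q = set qs"
  \<comment> \<open>One invariant per loop: \<open>T k\<close> after \<open>k\<close> pivots,
    \<open>J k i\<close> within pivot \<open>k\<close> after \<open>i\<close> rows,
    \<open>L k i j\<close> within row \<open>i\<close> after \<open>j\<close> columns. A completed
    inner invariant is the next outer one.\<close>
  define T where "T k = close_under Q S (take k qs)" for k
  define I where "I k = M (X \<union> pairs u (T k)) Y" for k
  define J where "J k i = M (X \<union> pairs u (transit (T k) (qs ! k) (set (take i qs) \<times> Q))) Y" for k i
  define L where "L k i j = M (X \<union> pairs u (transit (T k) (qs ! k)
    (set (take i qs) \<times> Q \<union> {qs ! i} \<times> set (take j qs)))) Y" for k i j
  have T: "T (Suc k) = transit (T k) (qs ! k) (Q \<times> Q)" if "k < ?n" for k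
    using that by (simp add: T_def close_under_def take_Suc_conv_app_nth)
  have "triple B G0 (M (X \<union> pairs u S) Y) (warshall eb u) (I ?n)
      (500 * ((?n + 1) * ((?n + 1) * ((?n + 1) * 1))))"
    unfolding warshall_def
  proof (rule triple_For[where I = I and K = 400])
    fix k assume k: "0 \<le> k" "k < ?n"
    have "triple B ((10, k) # G0) (I k) (For 12 13 \<zero> (headE eb 0) (For 14 15 \<zero> (headE eb 0)
      (Cond (readE (3 + u) (stateE eb (Var 12)) (stateE eb (Var 10)) \<zero> \<zero>)
        (Cond (readE (3 + u) (stateE eb (Var 10)) (stateE eb (Var 14)) \<zero> \<zero>)
          (Write (cellE (3 + u) (stateE eb (Var 12)) (stateE eb (Var 14)) \<zero> \<zero>) (Num 1))
          Skip)
        Skip))) (J k ?n) (400 * ((?n + 1) * ((?n + 1) * 1)))"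
    proof (rule triple_For[where I = "J k" and K = 300])
      fix i assume i: "0 \<le> i" "i < ?n"
      have "triple B ((12, i) # (10, k) # G0) (J k i) (For 14 15 \<zero> (headE eb 0)
        (Cond (readE (3 + u) (stateE eb (Var 12)) (stateE eb (Var 10)) \<zero> \<zero>)
          (Cond (readE (3 + u) (stateE eb (Var 10)) (stateE eb (Var 14)) \<zero> \<zero>)
            (Write (cellE (3 + u) (stateE eb (Var 12)) (stateE eb (Var 14)) \<zero> \<zero>) (Num 1))
            Skip)
          Skip)) (L k i ?n) (300 * ((?n + 1) * 1))"
      proof (rule triple_For[where I = "L k i" and K = 200])
        fix j assume j: "0 \<le> j" "j < ?n"
        have "set (take i qs) \<times> Q \<union> {qs ! i} \<times> set (take (Suc j) qs) =
            insert (qs ! i, qs ! j) (set (take i qs) \<times> Q \<union> {qs ! i} \<times> set (take j qs))"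
          using set_take_Suc[OF j(2)] by auto
        then show "triple B ((14, j) # (12, i) # (10, k) # G0) (L k i j)
          (Cond (readE (3 + u) (stateE eb (Var 12)) (stateE eb (Var 10)) \<zero> \<zero>)
            (Cond (readE (3 + u) (stateE eb (Var 10)) (stateE eb (Var 14)) \<zero> \<zero>)
              (Write (cellE (3 + u) (stateE eb (Var 12)) (stateE eb (Var 14)) \<zero> \<zero>) (Num 1))
              Skip)
            Skip) (L k i (Suc j)) (200 * 1)"
          unfolding L_def using warshall_body[OF u X k(2) i(2) j(2)] by simp
      qed (use W10 W_B lengths_less less_B eb in \<open>simp_all add: J_def L_def ev_access esafe_access\<close>)
      moreover have "L k i ?n = J k (Suc i)"
      proof -
        have "set (take i qs) \<times> Q \<union> {qs ! i} \<times> set qs = set (take (Suc i) qs) \<times> Q"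
          using set_take_Suc[OF i(2)] by (auto simp: Q_def)
        then show ?thesis by (simp add: J_def L_def)
      qed
      ultimately show "triple B ((12, i) # (10, k) # G0) (J k i) (For 14 15 \<zero> (headE eb 0)
        (Cond (readE (3 + u) (stateE eb (Var 12)) (stateE eb (Var 10)) \<zero> \<zero>)
          (Cond (readE (3 + u) (stateE eb (Var 10)) (stateE eb (Var 14)) \<zero> \<zero>)
            (Write (cellE (3 + u) (stateE eb (Var 12)) (stateE eb (Var 14)) \<zero> \<zero>) (Num 1))
            Skip)
          Skip)) (J k (Suc i)) (300 * ((?n + 1) * 1))" by simp
    qed (use W10 W_B lengths_less less_B eb in \<open>simp_all add: I_def J_def transit_def ev_access esafe_access\<close>)
    then show "triple B ((10, k) # G0) (I k) (For 12 13 \<zero> (headE eb 0) (For 14 15 \<zero> (headE eb 0)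
      (Cond (readE (3 + u) (stateE eb (Var 12)) (stateE eb (Var 10)) \<zero> \<zero>)
        (Cond (readE (3 + u) (stateE eb (Var 10)) (stateE eb (Var 14)) \<zero> \<zero>)
          (Write (cellE (3 + u) (stateE eb (Var 12)) (stateE eb (Var 14)) \<zero> \<zero>) (Num 1))
          Skip)
        Skip))) (I (Suc k)) (400 * ((?n + 1) * ((?n + 1) * 1)))"
      by (simp add: I_def J_def T[OF k(2)] Q_def)
  qed (use W10 W_B lengths_less less_B eb in \<open>simp_all add: I_def T_def close_under_def ev_access esafe_access\<close>)
  then show ?thesis by (simp add: I_def T_def Q_def)
qed

lemma op_marks_insert:
  "op_marks code u X (insert (t, p, q) P) =
    (if 2 \<le> kind (fst (snd t)) \<and> (3 + u, p, fst t, 0, 0) \<in> X \<and> (3 + u, snd (snd t), q, 0, 0) \<in> X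
     then insert (5 + u, kind (fst (snd t)), arg code (fst (snd t)), p, q) (op_marks code u X P)
     else op_marks code u X P)"
proof -
  have "{x \<in> insert a P. R x} = (if R a then insert a {x \<in> P. R x} else {x \<in> P. R x})" for a R
    by auto
  then show ?thesis unfolding op_marks_def by simp
qed

text \<open>Marks carry tag 5 or 6 and the tests read tag 3 or 4, so entries written earlier do not
  influence later tests.\<close>

lemma op_marks_flag: "u \<le> 1 \<Longrightarrow> (3 + u, p, q, c, d) \<in> X \<union> op_marks code u X P \<longleftrightarrow> (3 + u, p, q, c, d) \<in> X"
  by (auto simp: op_marks_def)

lemma op_table_body:
  assumes u: "u \<le> 1" and i: "k < length ts" "i < length qs" "j < length qs" and kd: "2 \<le> kind (lab k)"
  shows "triple B ((14, j) # (12, i) # (10, k) # G0)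
    (M (X \<union> op_marks code u X P) Y)
    (Cond (readE (3 + u) (stateE eb (Var 12)) (transE eb (Var 10) 0) \<zero> \<zero>)
      (Cond (readE (3 + u) (transE eb (Var 10) 3) (stateE eb (Var 14)) \<zero> \<zero>)
        (Write (cellE (5 + u) (transE eb (Var 10) 1) (transE eb (Var 10) 2)
          (stateE eb (Var 12)) (stateE eb (Var 14))) (Num 1))
        Skip)
      Skip)
    (M (X \<union> op_marks code u X (insert (ts ! k, qs ! i, qs ! j) P)) Y) (300 * 1)"
    (is "triple B ?G ?P0 (Cond ?e1 (Cond ?e2 ?w Skip) Skip) ?Q _")
proof -
  let ?p = "qs ! i" and ?q = "qs ! j"
  let ?b1 = "(3 + u, ?p, src k, 0, 0) \<in> X" and ?b2 = "(3 + u, tgt k, ?q, 0, 0) \<in> X"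
  have l: "?p < W" "?q < W" using i qs_less by auto
  note t = ts_less[OF i(1)]
  have u6: "3 + u \<in> {1..6}" "3 + u < 10" "5 + u \<in> {1..6}" using u by auto
  have 1: "esafe B ?e1 (f, m) \<and> ev ?e1 (f, m) = of_bool ?b1"
    "esafe B ?e2 (f, m) \<and> ev ?e2 (f, m) = of_bool ?b2"
    if "agree ?G f" "?P0 m" for f m
    using that i l u6 W10 less_B t
    by (simp_all add: ev_readE esafe_readE ev_access esafe_access op_marks_flag[OF u, simplified])
  have w: "triple B ?G (\<lambda>m. ?P0 m \<and> ?b1 \<and> ?b2) ?w ?Q 110"
  proof (cases "?b1 \<and> ?b2")
    case True
    have "triple B ?G ?P0 ?w ?Q 110"
    proof (rule triple_mark)
      show "insert (5 + u, kind (lab k), arg code (lab k), ?p, ?q) (X \<union> op_marks code u X P) =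
          X \<union> op_marks code u X (insert (ts ! k, ?p, ?q) P)"
        unfolding op_marks_insert using True kd by simp
    qed (use u6 i l t W10 less_B in \<open>simp_all add: ev_access esafe_access eb(3)\<close>)
    then show ?thesis by (rule triple_conseq) auto
  next
    case False
    then show ?thesis unfolding triple_def by blast
  qed
  show ?thesis
  proof (rule triple_Cond[where T' = 200 and ?P1.0 = "\<lambda>m. ?P0 m \<and> ?b1" and ?P2.0 = "\<lambda>m. ?P0 m \<and> \<not> ?b1"])
    show "triple B ?G (\<lambda>m. ?P0 m \<and> ?b1) (Cond ?e2 ?w Skip) ?Q 200"
    proof (rule triple_Cond[OF _ w, where ?P2.0 = "\<lambda>m. ?P0 m \<and> \<not> ?b2"])
      show "triple B ?G (\<lambda>m. ?P0 m \<and> \<not> ?b2) Skip ?Q 110"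
        by (rule triple_Skip) (simp add: op_marks_insert)
    qed (use 1 in \<open>simp_all add: eb(3)\<close>)
    show "triple B ?G (\<lambda>m. ?P0 m \<and> \<not> ?b1) Skip ?Q 200"
      by (rule triple_Skip) (simp add: op_marks_insert)
  qed (use 1 in \<open>simp_all add: eb(3)\<close>)
qed

lemma op_table_triple:
  assumes u: "u \<le> 1"
  shows "triple B G0 (M X Y) (op_table eb u)
    (M (X \<union> op_marks code u X (set ts \<times> set qs \<times> set qs)) Y)
    (600 * ((length ts + 1) * ((length qs + 1) * ((length qs + 1) * 1))))"
proof -
  let ?n = "length qs"
  define Q where "Q = set qs"
  define I where "I k = M (X \<union> op_marks code u X (set (take k ts) \<times> Q \<times> Q)) Y" for k
  define J where "J k i = M (X \<union> op_marks code u X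
    (set (take k ts) \<times> Q \<times> Q \<union> {ts ! k} \<times> set (take i qs) \<times> Q)) Y" for k i
  define L where "L k i j = M (X \<union> op_marks code u X
    (set (take k ts) \<times> Q \<times> Q \<union> {ts ! k} \<times> set (take i qs) \<times> Q \<union> {ts ! k} \<times> {qs ! i} \<times> set (take j qs))) Y" for k i j
  let ?c3 = "Cond (readE (3 + u) (stateE eb (Var 12)) (transE eb (Var 10) 0) \<zero> \<zero>)
      (Cond (readE (3 + u) (transE eb (Var 10) 3) (stateE eb (Var 14)) \<zero> \<zero>)
        (Write (cellE (5 + u) (transE eb (Var 10) 1) (transE eb (Var 10) 2)
          (stateE eb (Var 12)) (stateE eb (Var 14))) (Num 1))
        Skip)
      Skip"
  let ?c2 = "For 14 15 \<zero> (headE eb 0) ?c3"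
  let ?c1 = "For 12 13 \<zero> (headE eb 0) ?c2"
  have "triple B G0 (M X Y) (op_table eb u) (I (length ts)) (600 * ((length ts + 1) * ((?n + 1) * ((?n + 1) * 1))))"
    unfolding op_table_def
  proof (rule triple_For[where I = I and K = 550])
    fix k assume k: "0 \<le> k" "k < length ts"
    show "triple B ((10, k) # G0) (I k) (Cond (Minus (transE eb (Var 10) 1) (Num 1)) ?c1 Skip) (I (Suc k))
      (550 * ((?n + 1) * ((?n + 1) * 1)))"
    proof (rule triple_Cond[where T' = "500 * ((?n + 1) * ((?n + 1) * 1))"
        and ?P1.0 = "\<lambda>m. I k m \<and> 2 \<le> kind (lab k)" and ?P2.0 = "\<lambda>m. I k m \<and> \<not> 2 \<le> kind (lab k)"])
      show "triple B ((10, k) # G0) (\<lambda>m. I k m \<and> 2 \<le> kind (lab k)) ?c1 (I (Suc k)) (500 * ((?n + 1) * ((?n + 1) * 1)))"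
      proof (cases "2 \<le> kind (lab k)")
        case kd: True
        have "triple B ((10, k) # G0) (I k) ?c1 (J k ?n) (500 * ((?n + 1) * ((?n + 1) * 1)))"
        proof (rule triple_For[where I = "J k" and K = 400])
          fix i assume i: "0 \<le> i" "i < ?n"
          have "triple B ((12, i) # (10, k) # G0) (J k i) ?c2 (L k i ?n) (400 * ((?n + 1) * 1))"
          proof (rule triple_For[where I = "L k i" and K = 300])
            fix j assume j: "0 \<le> j" "j < ?n"
            have "set (take k ts) \<times> Q \<times> Q \<union> {ts ! k} \<times> set (take i qs) \<times> Q \<union> {ts ! k} \<times> {qs ! i} \<times> set (take (Suc j) qs) =
                insert (ts ! k, qs ! i, qs ! j)
                (set (take k ts) \<times> Q \<times> Q \<union> {ts ! k} \<times> set (take i qs) \<times> Q \<union> {ts ! k} \<times> {qs ! i} \<times> set (take j qs))"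
              using set_take_Suc[OF j(2)] by auto
            then show "triple B ((14, j) # (12, i) # (10, k) # G0) (L k i j) ?c3 (L k i (Suc j)) (300 * 1)"
              unfolding L_def using op_table_body[OF u k(2) i(2) j(2) kd] by simp
          qed (use W10 W_B lengths_less less_B eb in \<open>simp_all add: J_def L_def ev_access esafe_access\<close>)
          moreover have "L k i ?n = J k (Suc i)"
          proof -
            have "set (take k ts) \<times> Q \<times> Q \<union> {ts ! k} \<times> set (take i qs) \<times> Q \<union> {ts ! k} \<times> {qs ! i} \<times> set qs =
                set (take k ts) \<times> Q \<times> Q \<union> {ts ! k} \<times> set (take (Suc i) qs) \<times> Q"
              using set_take_Suc[OF i(2)] by (auto simp: Q_def)
            then show ?thesis by (simp add: J_def L_def)
          qed
          ultimately show "triple B ((12, i) # (10, k) # G0) (J k i) ?c2 (J k (Suc i)) (400 * ((?n + 1) * 1))"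
            by simp
        qed (use W10 W_B lengths_less less_B eb in \<open>simp_all add: I_def J_def ev_access esafe_access\<close>)
        moreover have "J k ?n = I (Suc k)"
        proof -
          have "set (take k ts) \<times> Q \<times> Q \<union> {ts ! k} \<times> set qs \<times> Q = set (take (Suc k) ts) \<times> Q \<times> Q"
            using set_take_Suc[OF k(2)] by (auto simp: Q_def)
          then show ?thesis by (simp add: J_def I_def)
        qed
        ultimately have "triple B ((10, k) # G0) (I k) ?c1 (I (Suc k)) (500 * ((?n + 1) * ((?n + 1) * 1)))" by simp
        then show ?thesis by (rule triple_conseq) auto
      qed (simp add: triple_def)
      \<comment> \<open>Transitions on letters or on the empty word yield no marks, so skipping them
        preserves the invariant.\<close>
      have "op_marks code u X (set (take (Suc k) ts) \<times> Q \<times> Q) = op_marks code u X (set (take k ts) \<times> Q \<times> Q)"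
        if "\<not> 2 \<le> kind (lab k)"
        unfolding set_take_Suc[OF k(2)] op_marks_def using that by (intro arg_cong2[of _ _ _ _ image]) auto
      then show "triple B ((10, k) # G0) (\<lambda>m. I k m \<and> \<not> 2 \<le> kind (lab k)) Skip (I (Suc k)) (500 * ((?n + 1) * ((?n + 1) * 1)))"
        by (intro triple_Skip) (auto simp: I_def)
      show "ecost (Minus (transE eb (Var 10) 1) (Num 1)) + 2 + 500 * ((?n + 1) * ((?n + 1) * 1)) \<le> 550 * ((?n + 1) * ((?n + 1) * 1))"
        by (simp add: eb(3))
    next
      fix f m assume "agree ((10, k) # G0) f" "I k m"
      then show "esafe B (Minus (transE eb (Var 10) 1) (Num 1)) (f, m) \<and>
          (if ev (Minus (transE eb (Var 10) 1) (Num 1)) (f, m) \<noteq> 0 then I k m \<and> 2 \<le> kind (lab k)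
           else I k m \<and> \<not> 2 \<le> kind (lab k))"
        using k W_B by (auto simp: I_def ev_access esafe_access)
    qed
  qed (use W10 W_B lengths_less less_B eb in \<open>simp_all add: I_def op_marks_def ev_access esafe_access\<close>)
  then show ?thesis by (simp add: I_def Q_def)
qed

end

text \<open>Tag 9 with zero digits is above all addresses with smaller tags, so the space behind it
  is free for an output of arbitrary length.\<close>

lemma enc_less_OUT:
  assumes "t < 9" "a < W" "b < W" "c < W" "d < W" "e < W"
  shows "enc W t a b c d e < enc W 9 0 0 0 0 0"
proof -
  have s: "x * W + y < x' * W" if "x < x'" "y < W" for x x' y
  proof -
    have "x * W + y < Suc x * W" using that by simp
    also have "\<dots> \<le> x' * W" using that by (intro mult_le_mono1) simp
    finally show ?thesis .
  qed
  have "enc W t a b c d e < 9 * W * W * W * W * W"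
    unfolding enc_def using assms by (intro s)
  then show ?thesis by (simp add: enc_def)
qed

lemma concat_map_nth: "concat (map (\<lambda>i. F (xs ! i)) [0..<length xs]) = concat (map F xs)"
proof -
  have "map (\<lambda>i. F (xs ! i)) [0..<length xs] = map F (map ((!) xs) [0..<length xs])" by simp
  then show ?thesis by (simp only: map_nth)
qed

text \<open>The write pointer lives in the memory cell addressed by register 5, not in a register,
  because assertions describe the memory only.\<close>

definition emit :: "exp \<Rightarrow> com" where
  "emit e = Write (Deref (Var 5)) e ;; Write (Var 5) (Plus (Deref (Var 5)) (Num 1))"

lemma writes_emit [simp]: "writes (emit e) = {}"
  by (simp add: emit_def)

lemma writes_push [simp]: "writes (push e) = {}"
  by (simp add: push_def)

context machine
begin

lemma push_triple:
  assumes "\<And>f m. agree G f \<Longrightarrow> M X Y m \<Longrightarrow> f 4 = W \<and> ev e (f, m) = x \<and> esafe B e (f, m)"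
    and "Suc (length Y) < W" "x < W" "ecost e + 100 \<le> T"
  shows "triple B G (M X Y) (push e) (M X (Y @ [x])) T"
  unfolding triple_def
proof (intro allI impI)
  fix f m assume *: "agree G f" "M X Y m"
  note e = assms(1)[OF *]
  have 8: "m (enc W 8 0 0 0 0 0) = length Y" using *(2) by (simp add: M_def)
  \<comment> \<open>The new list entry is not stored in the length cell, so the length can still be
    read for its increment.\<close>
  have ne: "enc W 8 0 0 0 0 0 \<noteq> enc W 7 (length Y) 0 0 0 0"
    using W10 assms(2) by (simp add: enc_eq_iff)
  have s8: "esafe B (cellE 8 \<zero> \<zero> \<zero> \<zero>) (f, m')" for m'
    using e W10 W_B by (intro esafe_cellE) simp_all
  have s7: "esafe B (cellE 7 (readE 8 \<zero> \<zero> \<zero> \<zero>) \<zero> \<zero> \<zero>) (f, m)"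
    using e W10 W_B assms(2) 8 s8[of m] by (intro esafe_cellE) (simp_all add: readE_def)
  have r: "run (push e) (f, m) =
      (f, m(enc W 7 (length Y) 0 0 0 0 := x, enc W 8 0 0 0 0 0 := Suc (length Y)))"
    using e 8 ne by (simp add: push_def readE_def)
  have "safe B (push e) (f, m)"
    using e s8 s7 8 ne W_B assms(2) less_B[OF assms(2)] by (simp add: push_def readE_def)
  moreover have "cost (push e) (f, m) \<le> T" using assms(4) by (simp add: push_def)
  ultimately show "safe B (push e) (f, m) \<and> cost (push e) (f, m) \<le> T \<and> M X (Y @ [x]) (snd (run (push e) (f, m)))"
    using M_push[OF *(2) assms(2,3)] by (simp add: r)
qed

definition OUT :: nat where "OUT = enc W 9 0 0 0 0 0"

lemma OUT_B: "OUT < W ^ 6" "OUT * 10 \<le> B"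
proof -
  show "OUT < W ^ 6" unfolding OUT_def using W10 by (intro enc_less) auto
  then show "OUT * 10 \<le> B" using W6_B by linarith
qed

lemma M_OUT: "M X Y m \<Longrightarrow> OUT \<le> i \<Longrightarrow> M X Y (m(i := x))"
proof -
  assume m: "M X Y m" and i: "OUT \<le> i"
  have n: "N < i" using enc_ge[of 9 W 0 0 0 0 0] i W by (simp add: OUT_def)
  have e: "enc W t a b c d 0 \<noteq> i" if "t < 9" "a < W" "b < W" "c < W" "d < W" for t a b c d
    using enc_less_OUT[of t a W b c d 0] that i W10 by (simp add: OUT_def)
  show ?thesis unfolding M_def
  proof (intro conjI ballI allI impI)
    fix t a b c d assume "t \<in> {1..6::nat}" "a < W" "b < W" "c < W" "d < W"
    then show "(m(i := x)) (enc W t a b c d 0) = of_bool ((t, a, b, c, d) \<in> X)"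
      using e[of t a b c d] M_flag[OF m] by simp
  next
    fix j assume "j < length Y"
    then show "(m(i := x)) (enc W 7 j 0 0 0 0) = Y ! j" using e[of 7 j 0 0 0] m W10 by (simp add: M_def)
  qed (use m n e[of 8 0 0 0 0] W10 in \<open>simp_all add: M_def\<close>)
qed

end

text \<open>
  The cell \<open>OUT\<close> holds the address of the first cell behind the output; the output itself
  starts at \<open>OUT + 1\<close>.
\<close>

locale emission = machine +
  fixes X :: "(nat \<times> nat \<times> nat \<times> nat \<times> nat) set" and Y :: "nat list" and LM :: nat
  assumes LM: "OUT + LM + 5 \<le> B"
begin

abbreviation G1 :: "(nat \<times> nat) list" where
  "G1 \<equiv> [(5, OUT), (6, length Y), (4, W), (2, N1)]"

definition Em :: "nat list \<Rightarrow> (nat \<Rightarrow> nat) \<Rightarrow> bool" where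
  "Em out m \<longleftrightarrow> M X Y m \<and> m OUT = OUT + 1 + length out \<and> (\<forall>i<length out. m (OUT + 1 + i) = out ! i)"

text \<open>Output is append-only, so a phase is described by the list it adds to any earlier output
  for which there is room. The conjunct \<open>length L \<le> T\<close> lets a time bound serve as a
  bound on the output length as well.\<close>

definition emits :: "(nat \<times> nat) list \<Rightarrow> com \<Rightarrow> nat list \<Rightarrow> nat \<Rightarrow> bool" where
  "emits G c L T \<longleftrightarrow> length L \<le> T \<and>
    (\<forall>out. length out + length L \<le> LM \<longrightarrow> triple B G (Em out) c (Em (out @ L)) T)"

lemma emitsD:
  "emits G c L T \<Longrightarrow> length (out @ L) \<le> LM \<Longrightarrow> triple B G (Em out) c (Em (out @ L)) T"
  by (simp add: emits_def)

lemma emits_mono: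
  assumes "emits G c L T" "T \<le> T'" shows "emits G c L T'"
  unfolding emits_def
proof (intro conjI allI impI)
  show "length L \<le> T'" using assms by (simp add: emits_def)
  fix out :: "nat list" assume "length out + length L \<le> LM"
  then have "triple B G (Em out) c (Em (out @ L)) T" by (intro emitsD[OF assms(1)]) simp
  then show "triple B G (Em out) c (Em (out @ L)) T'"
    by (rule triple_conseq) (simp_all add: assms(2))
qed

lemma emits_Skip: "emits G Skip [] T"
  by (simp add: emits_def triple_Skip)

lemma emits_emit:
  assumes "\<And>f m. agree G f \<Longrightarrow> M X Y m \<Longrightarrow> f 5 = OUT \<and> ev e (f, m) = x \<and> esafe B e (f, m)"
    and "ecost e + 9 \<le> T"
  shows "emits G (emit e) [x] T"
  unfolding emits_def triple_def
proof (intro conjI allI impI)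
  fix out f m assume l: "length out + length [x] \<le> LM" and *: "agree G f" "Em out m"
  have m: "M X Y m" "m OUT = OUT + 1 + length out" "\<forall>i<length out. m (OUT + 1 + i) = out ! i"
    using *(2) by (auto simp: Em_def)
  note e = assms(1)[OF *(1) m(1)]
  show "safe B (emit e) (f, m)" using e m(2) l LM W_B by (simp add: emit_def)
  show "cost (emit e) (f, m) \<le> T" using assms(2) by (simp add: emit_def)
  have r: "snd (run (emit e) (f, m)) = m(OUT + 1 + length out := x, OUT := OUT + 1 + Suc (length out))"
    using e m(2) by (simp add: emit_def)
  show "Em (out @ [x]) (snd (run (emit e) (f, m)))"
    unfolding r Em_def
  proof (intro conjI allI impI)
    show "M X Y (m(OUT + 1 + length out := x, OUT := OUT + 1 + Suc (length out)))"
      by (rule M_OUT[OF M_OUT[OF m(1)]]) simp_all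
  next
    fix i assume "i < length (out @ [x])"
    then show "(m(OUT + 1 + length out := x, OUT := OUT + 1 + Suc (length out))) (OUT + 1 + i) = (out @ [x]) ! i"
      using m(3) by (cases "i = length out") (simp_all add: nth_append)
  qed simp
qed (use assms(2) in simp)

lemma emits_Seq:
  assumes "emits G c1 L1 T1" "emits G c2 L2 T2" "fst ` set G \<inter> writes c1 = {}" "T1 + T2 \<le> T"
  shows "emits G (c1 ;; c2) (L1 @ L2) T"
  unfolding emits_def
proof (intro conjI allI impI)
  fix out :: "nat list" assume "length out + length (L1 @ L2) \<le> LM"
  then have "triple B G (Em out) c1 (Em (out @ L1)) T1"
    "triple B G (Em (out @ L1)) c2 (Em ((out @ L1) @ L2)) T2"
    by (auto intro!: emitsD[OF assms(1)] emitsD[OF assms(2)] simp del: append_assoc)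
  from triple_Seq[OF this assms(3,4)] show "triple B G (Em out) (c1 ;; c2) (Em (out @ L1 @ L2)) T"
    by simp
qed (use assms in \<open>simp add: emits_def\<close>)

text \<open>The test reads only fixed registers and tables, none of which change during output. Its
  outcome \<open>P\<close> is thus known in advance, and each branch has to be treated under its own
  assumption only.\<close>

lemma emits_Cond:
  assumes "\<And>f m. agree G f \<Longrightarrow> M X Y m \<Longrightarrow> esafe B e (f, m) \<and> (ev e (f, m) \<noteq> 0 \<longleftrightarrow> P)"
    and "P \<Longrightarrow> emits G c1 L1 T'" "\<not> P \<Longrightarrow> emits G c2 L2 T'" "ecost e + 2 + T' \<le> T"
  shows "emits G (Cond e c1 c2) (if P then L1 else L2) T"
  unfolding emits_def
proof (intro conjI allI impI)
  show "length (if P then L1 else L2) \<le> T" using assms(2-4) by (auto simp: emits_def)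
  fix out :: "nat list" assume l: "length out + length (if P then L1 else L2) \<le> LM"
  let ?L = "if P then L1 else L2"
  show "triple B G (Em out) (Cond e c1 c2) (Em (out @ ?L)) T"
  proof (rule triple_Cond[where ?P1.0 = "\<lambda>m. Em out m \<and> P" and ?P2.0 = "\<lambda>m. Em out m \<and> \<not> P" and T' = T'])
    show "triple B G (\<lambda>m. Em out m \<and> P) c1 (Em (out @ ?L)) T'"
    proof (cases P)
      case True
      then show ?thesis using assms(2) l unfolding emits_def by simp
    qed (simp add: triple_def)
    show "triple B G (\<lambda>m. Em out m \<and> \<not> P) c2 (Em (out @ ?L)) T'"
    proof (cases P)
      case False
      then show ?thesis using assms(3) l unfolding emits_def by simp
    qed (simp add: triple_def)
  qed (use assms(1,4) in \<open>auto simp: Em_def\<close>)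
qed

text \<open>Times may differ from pass to pass. This is essential for the letter transitions, where
  only some passes enter the inner loop.\<close>

lemma emits_For_sum:
  assumes "\<And>f m. agree G f \<Longrightarrow> M X Y m \<Longrightarrow>
      esafe B e1 (f, m) \<and> esafe B e2 (f, m) \<and> ev e1 (f, m) = 0 \<and> ev e2 (f, m) = u"
    and body: "\<And>i. i < u \<Longrightarrow> emits ((r, i) # G) c (L i) (T i)"
    and "u < B" "fst ` set G \<inter> ({r, h} \<union> writes c) = {}"
    and "ecost e1 + ecost e2 + 4 + (\<Sum>i\<in>{0..<u}. T i + 5) \<le> T'"
  shows "emits G (For r h e1 e2 c) (concat (map L [0..<u])) T'"
  unfolding emits_def
proof (intro conjI allI impI)
  let ?L = "\<lambda>k. concat (map L [0..<k])"
  have "length (?L k) \<le> (\<Sum>i\<in>{0..<k}. T i + 5)" if "k \<le> u" for k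
    using that
  proof (induction k)
    case (Suc k)
    have "length (L k) \<le> T k" using body[of k] Suc.prems by (simp add: emits_def)
    then show ?case using Suc by simp
  qed simp
  then show "length (?L u) \<le> T'" using assms(5) by (meson order_refl order_trans le_add2)
  fix out :: "nat list" assume l: "length out + length (?L u) \<le> LM"
  \<comment> \<open>Partial outputs are prefixes of the whole one, so room for the whole suffices in
    every pass.\<close>
  have mono: "length (?L k) \<le> length (?L u)" if "k \<le> u" for k
  proof -
    have "[0..<u] = [0..<k] @ [k..<u]" using that upt_add_eq_append[of 0 k "u - k"] by simp
    then show ?thesis by simp
  qed
  show "triple B G (Em out) (For r h e1 e2 c) (Em (out @ ?L u)) T'"
  proof (rule triple_For_sum[where I = "\<lambda>i. Em (out @ ?L i)" and T = T])
    fix i assume i: "0 \<le> i" "i < u"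
    have "length ((out @ ?L i) @ L i) \<le> LM" using mono[of "Suc i"] i l by simp
    from emitsD[OF body[OF i(2)] this]
    show "triple B ((r, i) # G) (Em (out @ ?L i)) c (Em (out @ ?L (Suc i))) (T i)" by simp
  qed (use assms(1,3,4,5) W_B in \<open>auto simp: Em_def\<close>)
qed

lemma emits_For:
  assumes "\<And>f m. agree G f \<Longrightarrow> M X Y m \<Longrightarrow>
      esafe B e1 (f, m) \<and> esafe B e2 (f, m) \<and> ev e1 (f, m) = 0 \<and> ev e2 (f, m) = u"
    and "\<And>i. i < u \<Longrightarrow> emits ((r, i) # G) c (L i) (K * Z)"
    and "u < B" "fst ` set G \<inter> ({r, h} \<union> writes c) = {}"
    and T: "ecost e1 + ecost e2 + 9 + K \<le> K'" "1 \<le> Z" "concat (map L [0..<u]) = L'"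
  shows "emits G (For r h e1 e2 c) L' (K' * ((u + 1) * Z))"
  unfolding T(3)[symmetric]
proof (rule emits_For_sum[OF assms(1-4)])
  have "ecost e1 + ecost e2 + 4 + u * (K * Z + 5) \<le> (ecost e1 + ecost e2 + 9 + K) * ((u + 1) * Z)"
  proof -
    have "ecost e1 + ecost e2 + 4 \<le> (ecost e1 + ecost e2 + 9 + K) * Z" using T(2) by (cases Z) auto
    moreover have "u * (K * Z + 5) \<le> u * ((ecost e1 + ecost e2 + 9 + K) * Z)"
      using T(2) by (intro mult_le_mono) (auto simp: algebra_simps)
    ultimately show ?thesis by (simp add: algebra_simps)
  qed
  also have "\<dots> \<le> K' * ((u + 1) * Z)" using T by (intro mult_le_mono) auto
  finally show "ecost e1 + ecost e2 + 4 + (\<Sum>i\<in>{0..<u}. K * Z + 5) \<le> K' * ((u + 1) * Z)" by simp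
qed auto

end

section \<open>Writing the join automaton\<close>

fun emit_list :: "exp list \<Rightarrow> com" where
  "emit_list [] = Skip"
| "emit_list (e # es) = emit e ;; emit_list es"

definition baseE :: "exp \<Rightarrow> exp \<Rightarrow> exp" where
  "baseE a b = encE (Num 0) a b \<zero> \<zero> \<zero>"

definition linkE :: "exp \<Rightarrow> exp" where
  "linkE i = encE (Num 1) (stateE (Num 0) (Var 10)) (stateE (Var 2) (Var 12))
    (stateE (Num 0) (Var 14)) (stateE (Var 2) (Var 16)) i"

definition mvarE :: exp where
  "mvarE = Deref (cellE 7 (Var 18) \<zero> \<zero> \<zero>)"

definition write_states :: com where
  "write_states =
    For 10 11 \<zero> (headE (Num 0) 0) (For 12 13 \<zero> (headE (Var 2) 0)
      (emit (baseE (stateE (Num 0) (Var 10)) (stateE (Var 2) (Var 12))))) ;;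
    For 10 11 \<zero> (headE (Num 0) 0) (For 12 13 \<zero> (headE (Var 2) 0)
      (For 14 15 \<zero> (headE (Num 0) 0) (For 16 17 \<zero> (headE (Var 2) 0)
        (For 18 19 \<zero> (Plus (Plus (Var 6) (Var 6)) (Num 1)) (emit (linkE (Var 18)))))))"

definition write_vars :: com where
  "write_vars = For 18 19 \<zero> (Var 6) (emit mvarE)"

definition write_letters :: com where
  "write_letters =
    For 10 11 \<zero> (headE (Num 0) 2) (Cond (eqE (transE (Num 0) (Var 10) 1) (Num 1))
      (For 12 13 \<zero> (headE (Var 2) 2) (Cond (eqE (transE (Var 2) (Var 12) 1) (Num 1))
        (Cond (eqE (transE (Num 0) (Var 10) 2) (transE (Var 2) (Var 12) 2))
          (emit_list [baseE (transE (Num 0) (Var 10) 0) (transE (Var 2) (Var 12) 0), Num 1,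
            transE (Num 0) (Var 10) 2, baseE (transE (Num 0) (Var 10) 3) (transE (Var 2) (Var 12) 3)])
          Skip)
        Skip))
      Skip)"

text \<open>\<open>f\<close> is 1 exactly for variables of both automata, and the other factor is
  the absolute difference of two flags; a nonzero product means disagreement on a common variable.
  \<open>kd\<close> is 2 for \<open>Open\<close> and 3 for \<open>Close\<close>.\<close>

definition write_link :: "nat \<Rightarrow> exp \<Rightarrow> com" where
  "write_link kd i =
    (let d1 = readE 5 (Num kd) mvarE (stateE (Num 0) (Var 10)) (stateE (Num 0) (Var 14));
         d2 = readE 6 (Num kd) mvarE (stateE (Var 2) (Var 12)) (stateE (Var 2) (Var 16));
         f = Times (readE 1 mvarE \<zero> \<zero> \<zero>) (readE 2 mvarE \<zero> \<zero> \<zero>)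
     in Cond (Times f (Plus (Minus d1 d2) (Minus d2 d1))) Skip
          (Cond (Plus d1 d2)
            (emit_list [linkE i, Num kd, mvarE, linkE (Plus i (Num 1))])
            (emit_list [linkE i, Num 0, Num 0, linkE (Plus i (Num 1))])))"

text \<open>At an inconsistent position \<open>write_link\<close> emits nothing. The other
  transitions of the chain are written all the same, but no run gets across the gap.\<close>

definition write_chain :: com where
  "write_chain =
    Cond (readE 3 (stateE (Num 0) (Var 10)) (stateE (Num 0) (Var 14)) \<zero> \<zero>)
      (Cond (readE 4 (stateE (Var 2) (Var 12)) (stateE (Var 2) (Var 16)) \<zero> \<zero>)
        (emit_list [baseE (stateE (Num 0) (Var 10)) (stateE (Var 2) (Var 12)), Num 0, Num 0, linkE (Num 0)] ;;
         For 18 19 \<zero> (Var 6) (write_link 2 (Var 18)) ;;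
         For 18 19 \<zero> (Var 6) (write_link 3 (Plus (Var 6) (Var 18))) ;;
         emit_list [linkE (Plus (Var 6) (Var 6)), Num 0, Num 0,
           baseE (stateE (Num 0) (Var 14)) (stateE (Var 2) (Var 16))])
        Skip)
      Skip"

definition write_chains :: com where
  "write_chains =
    For 10 11 \<zero> (headE (Num 0) 0) (For 12 13 \<zero> (headE (Var 2) 0)
      (For 14 15 \<zero> (headE (Num 0) 0) (For 16 17 \<zero> (headE (Var 2) 0) write_chain)))"

text \<open>The number of states is computed from the input sizes. The number of transitions depends
  on the tables and is not known yet, so 0 is written as a placeholder for
  \<open>fix_count\<close>.\<close>

definition write_head :: com where
  "write_head =
    (let n = Times (headE (Num 0) 0) (headE (Var 2) 0)
     in emit_list [Plus n (Times (Times n n) (Plus (Plus (Var 6) (Var 6)) (Num 1))), Var 6, Num 0,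
          baseE (headE (Num 0) 3) (headE (Var 2) 3), baseE (headE (Num 0) 4) (headE (Var 2) 4)])"

text \<open>
  The number of transitions is found from the length of the output, as the \<open>i\<close> for which
  \<open>4 * i\<close> words follow the states and variables.
\<close>

definition fix_count :: com where
  "fix_count =
    For 10 11 \<zero> (Minus (Deref (Var 5)) (Var 5))
      (Cond (eqE (Plus (Plus (Times (Num 4) (Var 10)) (Var 6)) (Plus (Deref (Plus (Var 5) (Num 1))) (Num 6)))
          (Minus (Deref (Var 5)) (Var 5)))
        (Write (Plus (Var 5) (Num 3)) (Var 10)) Skip)"

lemma ev_baseE [simp]: "ev (baseE a b) s = enc (fst s 4) 0 (ev a s) (ev b s) 0 0 0"
  by (simp add: baseE_def)

lemma ecost_baseE [simp]: "ecost (baseE a b) = ecost a + ecost b + 19" "ecost (linkE i) = ecost i + 40"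
  "ecost mvarE = 22"
  by (simp_all add: baseE_def linkE_def mvarE_def)

text \<open>The last assumption makes every chain position, at most twice the number of variables of
  the join, a digit in base \<open>W\<close>, as needed for state names.\<close>

locale two_segments = machine W B N N1 xs +
  s1: segment W B N N1 xs code "Num 0" 0 qs1 vs1 ts1 i1 f1 +
  s2: segment W B N N1 xs code "Var 2" N1 qs2 vs2 ts2 i2 f2
  for W B N N1 :: nat and xs :: "nat list" and code :: "'a \<Rightarrow> nat"
    and qs1 vs1 ts1 i1 f1 qs2 vs2 ts2 i2 f2 +
  assumes vars_less: "2 * (length vs1 + length vs2) + 10 \<le> W"
begin

definition mv :: "nat list" where
  "mv = vs1 @ filter (\<lambda>x. x \<notin> set vs1) vs2"

lemma length_mv: "length mv \<le> length vs1 + length vs2"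
  by (simp add: mv_def)

lemma mv_less: "2 * length mv + 10 \<le> W"
  using vars_less mult_le_mono2[OF length_mv, of 2] by linarith

lemma mv_elem: "x \<in> set mv \<Longrightarrow> x < W"
  using s1.vs_less s2.vs_less by (auto simp: mv_def)

lemma merge_vars_triple:
  assumes X: "\<And>x. x < W \<Longrightarrow> (1, x, 0, 0, 0) \<in> X \<longleftrightarrow> x \<in> set vs1"
  shows "triple B G0 (M X []) (merge_vars (Num 0) (Var 2)) (M X mv)
    (300 * ((length vs1 + 1) * 1) + 400 * ((length vs2 + 1) * 1))"
proof -
  define I where "I i = M X (take i vs1)" for i
  define J where "J i = M X (vs1 @ filter (\<lambda>x. x \<notin> set vs1) (take i vs2))" for i
  have "triple B G0 (M X []) (For 10 11 \<zero> (headE (Num 0) 1) (push (varE (Num 0) (Var 10))))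
      (I (length vs1)) (300 * ((length vs1 + 1) * 1))"
  proof (rule triple_For[where I = I and K = 200])
    fix i assume i: "0 \<le> i" "i < length vs1"
    show "triple B ((10, i) # G0) (I i) (push (varE (Num 0) (Var 10))) (I (Suc i)) (200 * 1)"
      unfolding I_def take_Suc_conv_app_nth[OF i(2)]
      by (rule push_triple) (use i vars_less s1.vs_less in \<open>simp_all add: s1.ev_access s1.esafe_access\<close>)
  qed (use W10 W_B s1.lengths_less less_B in \<open>simp_all add: I_def s1.ev_access s1.esafe_access\<close>)
  moreover have "triple B G0 (I (length vs1))
      (For 10 11 \<zero> (headE (Var 2) 1) (Cond (readE 1 (varE (Var 2) (Var 10)) \<zero> \<zero> \<zero>) Skip (push (varE (Var 2) (Var 10)))))
      (J (length vs2)) (400 * ((length vs2 + 1) * 1))"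
  proof (rule triple_For[where I = J and K = 300])
    fix i assume i: "0 \<le> i" "i < length vs2"
    have x: "vs2 ! i < W" using i s2.vs_less by simp
    have l: "length (filter (\<lambda>x. x \<notin> set vs1) (take i vs2)) \<le> i"
      by (metis i(2) length_filter_le length_take less_imp_le min.absorb2)
    show "triple B ((10, i) # G0) (J i)
      (Cond (readE 1 (varE (Var 2) (Var 10)) \<zero> \<zero> \<zero>) Skip (push (varE (Var 2) (Var 10)))) (J (Suc i)) (300 * 1)"
    proof (rule triple_Cond[where T' = 200 and ?P1.0 = "\<lambda>m. J i m \<and> vs2 ! i \<in> set vs1" and ?P2.0 = "\<lambda>m. J i m \<and> vs2 ! i \<notin> set vs1"])
      show "triple B ((10, i) # G0) (\<lambda>m. J i m \<and> vs2 ! i \<in> set vs1) Skip (J (Suc i)) 200"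
        by (rule triple_Skip) (simp add: J_def take_Suc_conv_app_nth[OF i(2)])
      show "triple B ((10, i) # G0) (\<lambda>m. J i m \<and> vs2 ! i \<notin> set vs1) (push (varE (Var 2) (Var 10))) (J (Suc i)) 200"
      proof (cases "vs2 ! i \<in> set vs1")
        case False
        have "triple B ((10, i) # G0) (J i) (push (varE (Var 2) (Var 10)))
            (M X ((vs1 @ filter (\<lambda>x. x \<notin> set vs1) (take i vs2)) @ [vs2 ! i])) 200"
          unfolding J_def
          by (rule push_triple) (use i l x vars_less in \<open>simp_all add: s2.ev_access s2.esafe_access\<close>)
        then show ?thesis
          by (rule triple_conseq) (simp_all add: J_def take_Suc_conv_app_nth[OF i(2)] False)
      qed (simp add: triple_def)
    qed (use i x W10 less_B X in \<open>simp_all add: J_def ev_readE esafe_readE s2.ev_access s2.esafe_access\<close>)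
  qed (use W10 W_B s2.lengths_less less_B in \<open>simp_all add: I_def J_def s2.ev_access s2.esafe_access\<close>)
  ultimately have "triple B G0 (M X []) (merge_vars (Num 0) (Var 2)) (J (length vs2))
      (300 * ((length vs1 + 1) * 1) + 400 * ((length vs2 + 1) * 1))"
    unfolding merge_vars_def by (rule triple_Seq) auto
  then show ?thesis by (simp add: J_def mv_def)
qed

end

context two_segments
begin

text \<open>Kept in the very shape in which \<open>emits_Seq\<close> adds up the output phases, and
  used both as time bound and as bound on the output length.\<close>

definition out_time :: nat where
  "out_time = 300 +
    ((500 * ((length qs1 + 1) * ((length qs2 + 1) * 1)) +
      800 * ((length qs1 + 1) * ((length qs2 + 1) * ((length qs1 + 1) * ((length qs2 + 1) * ((2 * length mv + 1 + 1) * 1)))))) +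
     (100 * ((length mv + 1) * 1) +
      ((300 * (length ts1 + 1) + 1000 * (length (filter (\<lambda>t. kind (fst (snd t)) = 1) ts1) * (length ts2 + 1))) +
       5000 * ((length qs1 + 1) * ((length qs2 + 1) * ((length qs1 + 1) * ((length qs2 + 1) * ((length mv + 1) * 1))))))))"

end

lemma (in machine) esafe_enc:
  assumes "fst s 4 = W" "ev t s < 10" "ev a s < W" "ev b s < W" "ev c s < W" "ev d s < W" "ev e s < W"
    "esafe B t s" "esafe B a s" "esafe B b s" "esafe B c s" "esafe B d s" "esafe B e s"
  shows "esafe B (encE t a b c d e) s"
proof -
  have "enc W (ev t s) (ev a s) (ev b s) (ev c s) (ev d s) (ev e s) < B"
    using assms by (intro enc_less_B) auto
  then show ?thesis using assms W10 by (intro esafe_encE) auto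
qed

lemma (in emission) emits_list:
  assumes "length L = length es"
    and "\<And>f m. agree G f \<Longrightarrow> M X Y m \<Longrightarrow>
      f 5 = OUT \<and> map (\<lambda>e. ev e (f, m)) es = L \<and> list_all (\<lambda>e. esafe B e (f, m)) es"
    and "(\<Sum>e\<leftarrow>es. ecost e + 9) \<le> T"
  shows "emits G (emit_list es) L T"
  using assms
proof (induction es arbitrary: L T)
  case (Cons e es)
  then obtain x L' where L: "L = x # L'" by (cases L) auto
  have "emits G (emit_list es) L' (\<Sum>e\<leftarrow>es. ecost e + 9)"
    using Cons.prems L by (intro Cons.IH) auto
  moreover have "emits G (emit e) [x] (ecost e + 9)"
    using Cons.prems L by (intro emits_emit) auto
  ultimately show ?case
    using emits_Seq[of G "emit e" "[x]" "ecost e + 9" "emit_list es" L' "\<Sum>e\<leftarrow>es. ecost e + 9" T] Cons.prems(3) L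
    by simp
qed (simp add: emits_Skip)

type_synonym 'a transition = "nat \<times> ('a, nat) symbol option \<times> nat"

text \<open>\<open>LM\<close> bounds the output length. The factor 6 leaves room for
  \<open>fix_count\<close>, which computes \<open>4 * i\<close> plus further lengths for
  \<open>i\<close> up to the output length.\<close>

locale writer = two_segments W B N N1 xs code qs1 vs1 ts1 i1 f1 qs2 vs2 ts2 i2 f2
  for W B N N1 :: nat and xs :: "nat list" and code :: "'a \<Rightarrow> nat"
    and qs1 vs1 ts1 i1 f1 qs2 vs2 ts2 i2 f2 +
  fixes X :: "(nat \<times> nat \<times> nat \<times> nat \<times> nat) set" and LM :: nat
  assumes LM': "OUT + 6 * LM + 100 \<le> B"
begin

sublocale emission W B N N1 xs X mv LM
  by unfold_locales (use LM' in linarith)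

abbreviation base :: "nat \<Rightarrow> nat \<Rightarrow> nat" where
  "base p1 p2 \<equiv> enc W 0 p1 p2 0 0 0"

abbreviation chain :: "nat \<Rightarrow> nat \<Rightarrow> nat \<Rightarrow> nat \<Rightarrow> nat \<Rightarrow> nat" where
  "chain p1 p2 q1 q2 i \<equiv> enc W 1 p1 p2 q1 q2 i"

definition states_list :: "nat list" where
  "states_list = concat (map (\<lambda>p1. concat (map (\<lambda>p2. [base p1 p2]) qs2)) qs1) @
    concat (map (\<lambda>p1. concat (map (\<lambda>p2. concat (map (\<lambda>q1. concat (map (\<lambda>q2.
      concat (map (\<lambda>i. [chain p1 p2 q1 q2 i]) [0..<2 * length mv + 1])) qs2)) qs1)) qs2)) qs1)"

text \<open>Here and in the next definitions the nesting of \<open>if\<close> and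
  \<open>concat\<close> mirrors the nesting of conditionals and loops in the program, so that the
  rules for \<open>emits\<close> apply level by level.\<close>

definition letter_trans :: "'a transition \<Rightarrow> 'a transition \<Rightarrow> 'a transition list" where
  "letter_trans t1 t2 = (if kind (fst (snd t2)) = 1 then
      if arg code (fst (snd t1)) = arg code (fst (snd t2)) then
        [(base (fst t1) (fst t2), fst (snd t1), base (snd (snd t1)) (snd (snd t2)))]
      else []
    else [])"

definition letters_list :: "'a transition list" where
  "letters_list = concat (map (\<lambda>t1. if kind (fst (snd t1)) = 1 then concat (map (letter_trans t1) ts2) else []) ts1)"

text \<open>\<open>off\<close> is 0 in the \<open>Open\<close> half of a chain and
  \<open>length mv\<close> in the \<open>Close\<close> half, so \<open>off + j\<close> is the
  position in the chain.\<close>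

definition link_trans ::
    "(nat \<Rightarrow> ('a, nat) symbol) \<Rightarrow> nat \<Rightarrow> nat \<Rightarrow> nat \<Rightarrow> nat \<Rightarrow> nat \<Rightarrow> nat \<Rightarrow> 'a transition list" where
  "link_trans op off p1 p2 q1 q2 j =
    (let x = mv ! j; kd = kind (Some (op x));
         d1 = (5, kd, x, p1, q1) \<in> X; d2 = (6, kd, x, p2, q2) \<in> X
     in if (1, x, 0, 0, 0) \<in> X \<and> (2, x, 0, 0, 0) \<in> X \<and> d1 \<noteq> d2 then []
        else if d1 \<or> d2 then [(chain p1 p2 q1 q2 (off + j), Some (op x), chain p1 p2 q1 q2 (off + j + 1))]
        else [(chain p1 p2 q1 q2 (off + j), None, chain p1 p2 q1 q2 (off + j + 1))])"

definition chain_trans :: "nat \<Rightarrow> nat \<Rightarrow> nat \<Rightarrow> nat \<Rightarrow> 'a transition list" where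
  "chain_trans p1 p2 q1 q2 =
    (if (3, p1, q1, 0, 0) \<in> X then if (4, p2, q2, 0, 0) \<in> X then
      [(base p1 p2, None, chain p1 p2 q1 q2 0)] @
      concat (map (link_trans Open 0 p1 p2 q1 q2) [0..<length mv]) @
      concat (map (link_trans Close (length mv) p1 p2 q1 q2) [0..<length mv]) @
      [(chain p1 p2 q1 q2 (2 * length mv), None, base q1 q2)]
     else [] else [])"

definition chains_list :: "'a transition list" where
  "chains_list = concat (map (\<lambda>p1. concat (map (\<lambda>p2. concat (map (\<lambda>q1. concat (map (\<lambda>q2.
    chain_trans p1 p2 q1 q2) qs2)) qs1)) qs2)) qs1)"

abbreviation word :: "'a transition list \<Rightarrow> nat list" where
  "word ts \<equiv> concat (map (trans_word code) ts)"

lemma word_concat: "word (concat (map F zs)) = concat (map (\<lambda>z. word (F z)) zs)"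
  by (induction zs) auto

lemma word_if: "word (if b then l else l') = (if b then word l else word l')"
  by simp

lemmas ev_acc = s1.ev_access s2.ev_access
lemmas esafe_acc = s1.esafe_access s2.esafe_access

lemma W_consts: "0 < W" "1 < W" "2 < W" "3 < W" "1 < B" "0 < B" "2 < B" "3 < B" "4 < B" "5 < B" "6 < B" "10 < B"
  "length mv < W" "length mv < B" "Suc (2 * length mv) < B" "Suc (2 * length mv) < W" "2 * length mv < B" "2 * length mv < W"
  "Suc (length mv + length mv) < B" "length mv + length mv < B" "length mv + length mv < W"
  using W10 W_B mv_less by linarith+

lemma len_less: "length qs1 < B" "length qs2 < B" "length ts1 < B" "length ts2 < B"
  using s1.lengths_less s2.lengths_less less_B by auto

text \<open>From the inside outwards the constant grows by 100 per loop level, which covers the loop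
  overhead demanded by \<open>emits_For\<close>.\<close>

lemma write_states_emits:
  "emits G1 write_states states_list
    (500 * ((length qs1 + 1) * ((length qs2 + 1) * 1)) +
     800 * ((length qs1 + 1) * ((length qs2 + 1) * ((length qs1 + 1) * ((length qs2 + 1) * ((2 * length mv + 1 + 1) * 1))))))"
  unfolding write_states_def states_list_def
proof (rule emits_Seq[OF _ _ _ order_refl])
  show "emits G1 (For 10 11 \<zero> (headE \<zero> 0) (For 12 13 \<zero> (headE (Var 2) 0)
      (emit (baseE (stateE \<zero> (Var 10)) (stateE (Var 2) (Var 12))))))
    (concat (map (\<lambda>p1. concat (map (\<lambda>p2. [base p1 p2]) qs2)) qs1))
    (500 * ((length qs1 + 1) * ((length qs2 + 1) * 1)))"
  proof (rule emits_For[OF _ _ _ _ _ _ concat_map_nth, where K = 400])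
    fix i assume i: "i < length qs1"
    show "emits ((10, i) # G1) (For 12 13 \<zero> (headE (Var 2) 0)
        (emit (baseE (stateE \<zero> (Var 10)) (stateE (Var 2) (Var 12)))))
      (concat (map (\<lambda>p2. [base (qs1 ! i) p2]) qs2)) (400 * ((length qs2 + 1) * 1))"
    proof (rule emits_For[OF _ _ _ _ _ _ concat_map_nth, where K = 300])
      fix j assume j: "j < length qs2"
      show "emits ((12, j) # (10, i) # G1) (emit (baseE (stateE \<zero> (Var 10)) (stateE (Var 2) (Var 12))))
          [base (qs1 ! i) (qs2 ! j)] (300 * 1)"
        by (rule emits_emit) (use i j s1.qs_less s2.qs_less W_consts in
          \<open>simp_all add: ev_acc esafe_acc esafe_enc baseE_def\<close>)
    qed (use W_consts len_less in \<open>simp_all add: ev_acc esafe_acc\<close>)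
  qed (use W_consts len_less in \<open>simp_all add: ev_acc esafe_acc\<close>)
next
  show "emits G1 (For 10 11 \<zero> (headE \<zero> 0) (For 12 13 \<zero> (headE (Var 2) 0)
      (For 14 15 \<zero> (headE \<zero> 0) (For 16 17 \<zero> (headE (Var 2) 0)
        (For 18 19 \<zero> (Plus (Plus (Var 6) (Var 6)) (Num 1)) (emit (linkE (Var 18))))))))
    (concat (map (\<lambda>p1. concat (map (\<lambda>p2. concat (map (\<lambda>q1. concat (map (\<lambda>q2.
      concat (map (\<lambda>i. [chain p1 p2 q1 q2 i]) [0..<2 * length mv + 1])) qs2)) qs1)) qs2)) qs1))
    (800 * ((length qs1 + 1) * ((length qs2 + 1) * ((length qs1 + 1) * ((length qs2 + 1) * ((2 * length mv + 1 + 1) * 1))))))"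
  proof (rule emits_For[OF _ _ _ _ _ _ concat_map_nth, where K = 700])
    fix a assume a: "a < length qs1"
    show "emits ((10, a) # G1) (For 12 13 \<zero> (headE (Var 2) 0)
      (For 14 15 \<zero> (headE \<zero> 0) (For 16 17 \<zero> (headE (Var 2) 0)
        (For 18 19 \<zero> (Plus (Plus (Var 6) (Var 6)) (Num 1)) (emit (linkE (Var 18)))))))
      (concat (map (\<lambda>p2. concat (map (\<lambda>q1. concat (map (\<lambda>q2.
        concat (map (\<lambda>i. [chain (qs1 ! a) p2 q1 q2 i]) [0..<2 * length mv + 1])) qs2)) qs1)) qs2))
      (700 * ((length qs2 + 1) * ((length qs1 + 1) * ((length qs2 + 1) * ((2 * length mv + 1 + 1) * 1)))))"
    proof (rule emits_For[OF _ _ _ _ _ _ concat_map_nth, where K = 600])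
      fix b assume b: "b < length qs2"
      show "emits ((12, b) # (10, a) # G1) (For 14 15 \<zero> (headE \<zero> 0) (For 16 17 \<zero> (headE (Var 2) 0)
          (For 18 19 \<zero> (Plus (Plus (Var 6) (Var 6)) (Num 1)) (emit (linkE (Var 18))))))
        (concat (map (\<lambda>q1. concat (map (\<lambda>q2.
          concat (map (\<lambda>i. [chain (qs1 ! a) (qs2 ! b) q1 q2 i]) [0..<2 * length mv + 1])) qs2)) qs1))
        (600 * ((length qs1 + 1) * ((length qs2 + 1) * ((2 * length mv + 1 + 1) * 1))))"
      proof (rule emits_For[OF _ _ _ _ _ _ concat_map_nth, where K = 500])
        fix c assume c: "c < length qs1"
        show "emits ((14, c) # (12, b) # (10, a) # G1) (For 16 17 \<zero> (headE (Var 2) 0)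
            (For 18 19 \<zero> (Plus (Plus (Var 6) (Var 6)) (Num 1)) (emit (linkE (Var 18)))))
          (concat (map (\<lambda>q2.
            concat (map (\<lambda>i. [chain (qs1 ! a) (qs2 ! b) (qs1 ! c) q2 i]) [0..<2 * length mv + 1])) qs2))
          (500 * ((length qs2 + 1) * ((2 * length mv + 1 + 1) * 1)))"
        proof (rule emits_For[OF _ _ _ _ _ _ concat_map_nth, where K = 400])
          fix d assume d: "d < length qs2"
          show "emits ((16, d) # (14, c) # (12, b) # (10, a) # G1)
              (For 18 19 \<zero> (Plus (Plus (Var 6) (Var 6)) (Num 1)) (emit (linkE (Var 18))))
            (concat (map (\<lambda>i. [chain (qs1 ! a) (qs2 ! b) (qs1 ! c) (qs2 ! d) i]) [0..<2 * length mv + 1]))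
            (400 * ((2 * length mv + 1 + 1) * 1))"
          proof (rule emits_For[OF _ _ _ _ _ _ refl, where K = 300])
            fix i assume "i < 2 * length mv + 1"
            then have i: "i < W" using W_consts by linarith
            show "emits ((18, i) # (16, d) # (14, c) # (12, b) # (10, a) # G1) (emit (linkE (Var 18)))
                [chain (qs1 ! a) (qs2 ! b) (qs1 ! c) (qs2 ! d) i] (300 * 1)"
              by (rule emits_emit) (use i a b c d s1.qs_less s2.qs_less W_consts in
                \<open>simp_all add: ev_acc esafe_acc esafe_enc linkE_def\<close>)
          qed (use W_consts len_less in \<open>simp_all add: ev_acc esafe_acc mult_2\<close>)
        qed (use W_consts len_less in \<open>simp_all add: ev_acc esafe_acc\<close>)
      qed (use W_consts len_less in \<open>simp_all add: ev_acc esafe_acc\<close>)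
    qed (use W_consts len_less in \<open>simp_all add: ev_acc esafe_acc\<close>)
  qed (use W_consts len_less in \<open>simp_all add: ev_acc esafe_acc\<close>)
qed simp

lemma write_vars_emits: "emits G1 write_vars mv (100 * ((length mv + 1) * 1))"
proof -
  have "emits G1 write_vars (concat (map (\<lambda>x. [x]) mv)) (100 * ((length mv + 1) * 1))"
    unfolding write_vars_def
  proof (rule emits_For[OF _ _ _ _ _ _ concat_map_nth, where K = 50])
    fix j assume j: "j < length mv"
    show "emits ((18, j) # G1) (emit mvarE) [mv ! j] (50 * 1)"
    proof (rule emits_emit)
      fix f m assume *: "agree ((18, j) # G1) f" "M X mv m"
      then have "m (enc W 7 j 0 0 0 0) = mv ! j" using j by (simp add: M_def)
      moreover have "j < W" using j W_consts(13) by simp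
      ultimately show "f 5 = OUT \<and> ev mvarE (f, m) = mv ! j \<and> esafe B mvarE (f, m)"
        using * W_consts by (simp add: mvarE_def esafe_cellE)
    qed simp
  qed (use W_consts in simp_all)
  then show ?thesis by simp
qed

text \<open>A pass of the outer loop is expensive only for a letter transition. Summing individual
  times yields the number of letter transitions of the first automaton, \<open>O(n^2)\<close>, as
  factor; a uniform bound would yield all \<open>O(v n^2)\<close> of them and a factor
  \<open>v\<close> too many.\<close>

lemma write_letters_emits:
  "emits G1 write_letters (word letters_list)
    (300 * (length ts1 + 1) + 1000 * (length (filter (\<lambda>t. kind (fst (snd t)) = 1) ts1) * (length ts2 + 1)))"
proof -
  let ?F = "\<lambda>t1. if kind (fst (snd t1)) = 1 then concat (map (\<lambda>t2. word (letter_trans t1 t2)) ts2) else []"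
  let ?T = "\<lambda>i. 200 + (if kind (fst (snd (ts1 ! i))) = 1 then 1000 * (length ts2 + 1) else 0)"
  have "emits G1 write_letters (concat (map (\<lambda>i. ?F (ts1 ! i)) [0..<length ts1]))
    (300 * (length ts1 + 1) + 1000 * (length (filter (\<lambda>t. kind (fst (snd t)) = 1) ts1) * (length ts2 + 1)))"
    unfolding write_letters_def
  proof (rule emits_For_sum[where T = ?T])
    fix i assume i: "i < length ts1"
    note t1 = s1.ts_less[OF i]
    show "emits ((10, i) # G1) (Cond (eqE (transE \<zero> (Var 10) 1) (Num 1))
      (For 12 13 \<zero> (headE (Var 2) 2) (Cond (eqE (transE (Var 2) (Var 12) 1) (Num 1))
        (Cond (eqE (transE \<zero> (Var 10) 2) (transE (Var 2) (Var 12) 2))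
          (emit_list [baseE (transE \<zero> (Var 10) 0) (transE (Var 2) (Var 12) 0), Num 1,
            transE \<zero> (Var 10) 2, baseE (transE \<zero> (Var 10) 3) (transE (Var 2) (Var 12) 3)])
          Skip)
        Skip))
      Skip) (?F (ts1 ! i)) (?T i)"
    proof (rule emits_Cond[where T' = "?T i - 100"])
      assume k1: "kind (fst (snd (ts1 ! i))) = 1"
      have "emits ((10, i) # G1) (For 12 13 \<zero> (headE (Var 2) 2) (Cond (eqE (transE (Var 2) (Var 12) 1) (Num 1))
        (Cond (eqE (transE \<zero> (Var 10) 2) (transE (Var 2) (Var 12) 2))
          (emit_list [baseE (transE \<zero> (Var 10) 0) (transE (Var 2) (Var 12) 0), Num 1,
            transE \<zero> (Var 10) 2, baseE (transE \<zero> (Var 10) 3) (transE (Var 2) (Var 12) 3)])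
          Skip)
        Skip)) (concat (map (\<lambda>t2. word (letter_trans (ts1 ! i) t2)) ts2)) (1000 * ((length ts2 + 1) * 1))"
      proof (rule emits_For[OF _ _ _ _ _ _ concat_map_nth, where K = 900])
        fix j assume j: "j < length ts2"
        note t2 = s2.ts_less[OF j]
        show "emits ((12, j) # (10, i) # G1) (Cond (eqE (transE (Var 2) (Var 12) 1) (Num 1))
          (Cond (eqE (transE \<zero> (Var 10) 2) (transE (Var 2) (Var 12) 2))
            (emit_list [baseE (transE \<zero> (Var 10) 0) (transE (Var 2) (Var 12) 0), Num 1,
              transE \<zero> (Var 10) 2, baseE (transE \<zero> (Var 10) 3) (transE (Var 2) (Var 12) 3)])
            Skip)
          Skip) (word (letter_trans (ts1 ! i) (ts2 ! j))) (900 * 1)"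
          unfolding letter_trans_def word_if
        proof (rule emits_Cond[where T' = 700])
          show "emits ((12, j) # (10, i) # G1)
            (Cond (eqE (transE \<zero> (Var 10) 2) (transE (Var 2) (Var 12) 2))
              (emit_list [baseE (transE \<zero> (Var 10) 0) (transE (Var 2) (Var 12) 0), Num 1,
                transE \<zero> (Var 10) 2, baseE (transE \<zero> (Var 10) 3) (transE (Var 2) (Var 12) 3)])
              Skip)
            (if arg code (s1.lab i) = arg code (s2.lab j)
             then word [(base (s1.src i) (s2.src j), s1.lab i, base (s1.tgt i) (s2.tgt j))] else word []) 700"
          proof (rule emits_Cond[where T' = 500])
            have *: "word [(base (s1.src i) (s2.src j), s1.lab i, base (s1.tgt i) (s2.tgt j))] =
                [base (s1.src i) (s2.src j), 1, arg code (s1.lab i), base (s1.tgt i) (s2.tgt j)]"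
              using k1 by (simp add: trans_word_eq del: trans_word.simps)
            show "emits ((12, j) # (10, i) # G1)
              (emit_list [baseE (transE \<zero> (Var 10) 0) (transE (Var 2) (Var 12) 0), Num 1,
                transE \<zero> (Var 10) 2, baseE (transE \<zero> (Var 10) 3) (transE (Var 2) (Var 12) 3)])
              (word [(base (s1.src i) (s2.src j), s1.lab i, base (s1.tgt i) (s2.tgt j))]) 500"
              unfolding * by (rule emits_list)
                (use i j t1 t2 W_consts in \<open>simp_all add: ev_acc esafe_acc esafe_enc baseE_def\<close>)
          qed (use i j t1 t2 W_consts less_B in \<open>simp_all add: ev_acc esafe_acc esafe_eqE emits_Skip\<close>)
        qed (use i j t1 t2 W_consts less_B in \<open>simp_all add: ev_acc esafe_acc esafe_eqE emits_Skip\<close>)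
      qed (use W_consts len_less in \<open>simp_all add: ev_acc esafe_acc\<close>)
      then show "emits ((10, i) # G1) (For 12 13 \<zero> (headE (Var 2) 2) (Cond (eqE (transE (Var 2) (Var 12) 1) (Num 1))
        (Cond (eqE (transE \<zero> (Var 10) 2) (transE (Var 2) (Var 12) 2))
          (emit_list [baseE (transE \<zero> (Var 10) 0) (transE (Var 2) (Var 12) 0), Num 1,
            transE \<zero> (Var 10) 2, baseE (transE \<zero> (Var 10) 3) (transE (Var 2) (Var 12) 3)])
          Skip)
        Skip)) (concat (map (\<lambda>t2. word (letter_trans (ts1 ! i) t2)) ts2)) (?T i - 100)"
        by (rule emits_mono) (simp add: k1)
    qed (use i t1 W_consts less_B in \<open>simp_all add: ev_acc esafe_acc esafe_eqE emits_Skip\<close>)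
  next
    let ?S = "{i. i < length ts1 \<and> kind (fst (snd (ts1 ! i))) = 1}"
    have "(\<Sum>i\<in>{0..<length ts1}. ?T i + 5) =
        205 * length ts1 + (\<Sum>i\<in>{0..<length ts1}. if kind (fst (snd (ts1 ! i))) = 1 then 1000 * (length ts2 + 1) else 0)"
      by (simp add: sum.distrib)
    also have "(\<Sum>i\<in>{0..<length ts1}. if kind (fst (snd (ts1 ! i))) = 1 then 1000 * (length ts2 + 1) else 0) =
        (\<Sum>i\<in>?S. 1000 * (length ts2 + 1))"
      by (rule sum.mono_neutral_cong_right) auto
    also have "\<dots> = 1000 * (length (filter (\<lambda>t. kind (fst (snd t)) = 1) ts1) * (length ts2 + 1))"
      by (simp add: length_filter_conv_card algebra_simps)
    finally show "ecost \<zero> + ecost (headE \<zero> 2) + 4 + (\<Sum>i\<in>{0..<length ts1}. ?T i + 5)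
        \<le> 300 * (length ts1 + 1) + 1000 * (length (filter (\<lambda>t. kind (fst (snd t)) = 1) ts1) * (length ts2 + 1))"
      by simp
  qed (use W_consts len_less in \<open>simp_all add: ev_acc esafe_acc\<close>)
  then show ?thesis
    unfolding concat_map_nth[where F = ?F] letters_list_def word_concat word_if list.map(1) concat.simps(1)
    by simp
qed

lemma ev_mvarE:
  assumes "M X mv m" "f 4 = W" "f 18 < length mv"
  shows "ev mvarE (f, m) = mv ! f 18" "esafe B mvarE (f, m)" "mv ! f 18 < W"
proof -
  have "f 18 < W" using assms(3) W_consts(13) by simp
  then show "esafe B mvarE (f, m)" using assms W_consts by (simp add: mvarE_def esafe_cellE)
qed (use assms mv_elem in \<open>simp_all add: mvarE_def M_def\<close>)

lemma write_link_emits: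
  fixes op :: "nat \<Rightarrow> ('a, nat) symbol"
  assumes "a < length qs1" "b < length qs2" "c < length qs1" "d < length qs2" "j < length mv"
    and op: "\<And>x. kind (Some (op x)) = kd" "\<And>x. arg code (Some (op x)) = x" "2 \<le> kd" "kd \<le> 3"
    and i: "\<And>f m. f 18 = j \<Longrightarrow> f 6 = length mv \<Longrightarrow> ev i (f, m) = off + j \<and> esafe B i (f, m)" "ecost i \<le> 3"
      "off \<le> length mv"
  shows "emits ((18, j) # (16, d) # (14, c) # (12, b) # (10, a) # G1) (write_link kd i)
    (word (link_trans op off (qs1 ! a) (qs2 ! b) (qs1 ! c) (qs2 ! d) j)) (1000 * 1)"
proof -
  let ?G = "(18, j) # (16, d) # (14, c) # (12, b) # (10, a) # G1"
  let ?p1 = "qs1 ! a" and ?p2 = "qs2 ! b" and ?q1 = "qs1 ! c" and ?q2 = "qs2 ! d" and ?x = "mv ! j"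
  let ?d1 = "(5, kd, ?x, ?p1, ?q1) \<in> X" and ?d2 = "(6, kd, ?x, ?p2, ?q2) \<in> X"
  have l: "?p1 < W" "?p2 < W" "?q1 < W" "?q2 < W" "?x < W" "kd < W" "kd < B" "off + j + 1 < W" "off + j < W"
    "off + j + 1 < B"
    using assms s1.qs_less s2.qs_less mv_elem W10 W_B mv_less by auto
  have w: "word (link_trans op off ?p1 ?p2 ?q1 ?q2 j) =
    (if (1, ?x, 0, 0, 0) \<in> X \<and> (2, ?x, 0, 0, 0) \<in> X \<and> ?d1 \<noteq> ?d2 then []
     else if ?d1 \<or> ?d2 then [chain ?p1 ?p2 ?q1 ?q2 (off + j), kd, ?x, chain ?p1 ?p2 ?q1 ?q2 (off + j + 1)]
     else [chain ?p1 ?p2 ?q1 ?q2 (off + j), 0, 0, chain ?p1 ?p2 ?q1 ?q2 (off + j + 1)])"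
    by (simp add: link_trans_def Let_def op trans_word_eq del: trans_word.simps) (simp add: kind_def arg_def)
  have ev: "f 4 = W \<and> f 2 = N1 \<and> f 5 = OUT \<and> ev mvarE (f, m) = ?x \<and> esafe B mvarE (f, m) \<and>
     ev (stateE \<zero> (Var 10)) (f, m) = ?p1 \<and> ev (stateE (Var 2) (Var 12)) (f, m) = ?p2 \<and>
     ev (stateE \<zero> (Var 14)) (f, m) = ?q1 \<and> ev (stateE (Var 2) (Var 16)) (f, m) = ?q2 \<and>
     esafe B (stateE \<zero> (Var 10)) (f, m) \<and> esafe B (stateE (Var 2) (Var 12)) (f, m) \<and>
     esafe B (stateE \<zero> (Var 14)) (f, m) \<and> esafe B (stateE (Var 2) (Var 16)) (f, m) \<and>
     ev i (f, m) = off + j \<and> esafe B i (f, m)"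
    if "agree ?G f" "M X mv m" for f m
    using that assms(1-5) i(1)[of f m] ev_mvarE[of m f] by (simp add: ev_acc esafe_acc)
  have rd: "ev (readE 1 mvarE \<zero> \<zero> \<zero>) (f, m) = of_bool ((1, ?x, 0, 0, 0) \<in> X) \<and>
     ev (readE 2 mvarE \<zero> \<zero> \<zero>) (f, m) = of_bool ((2, ?x, 0, 0, 0) \<in> X) \<and>
     ev (readE 5 (Num kd) mvarE (stateE \<zero> (Var 10)) (stateE \<zero> (Var 14))) (f, m) = of_bool ?d1 \<and>
     ev (readE 6 (Num kd) mvarE (stateE (Var 2) (Var 12)) (stateE (Var 2) (Var 16))) (f, m) = of_bool ?d2 \<and>
     esafe B (readE 1 mvarE \<zero> \<zero> \<zero>) (f, m) \<and> esafe B (readE 2 mvarE \<zero> \<zero> \<zero>) (f, m) \<and>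
     esafe B (readE 5 (Num kd) mvarE (stateE \<zero> (Var 10)) (stateE \<zero> (Var 14))) (f, m) \<and>
     esafe B (readE 6 (Num kd) mvarE (stateE (Var 2) (Var 12)) (stateE (Var 2) (Var 16))) (f, m)"
    if "agree ?G f" "M X mv m" for f m
  proof -
    have M: "M X mv (snd (f, m))" using that(2) by simp
    note e = ev[OF that]
    have "ev (readE 1 mvarE \<zero> \<zero> \<zero>) (f, m) = of_bool ((1, ?x, 0, 0, 0) \<in> X)"
      by (subst ev_readE[OF M]) (use e l(1-7) W_consts(1) in simp_all)
    moreover have "esafe B (readE 1 mvarE \<zero> \<zero> \<zero>) (f, m)"
      by (rule esafe_readE) (use e l(1-7) W_consts(1,6) in simp_all)
    moreover     have "ev (readE 2 mvarE \<zero> \<zero> \<zero>) (f, m) = of_bool ((2, ?x, 0, 0, 0) \<in> X)"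
      by (subst ev_readE[OF M]) (use e l(1-7) W_consts(1) in simp_all)
    moreover have "esafe B (readE 2 mvarE \<zero> \<zero> \<zero>) (f, m)"
      by (rule esafe_readE) (use e l(1-7) W_consts(1,6) in simp_all)
    moreover     have "ev (readE 5 (Num kd) mvarE (stateE \<zero> (Var 10)) (stateE \<zero> (Var 14))) (f, m) = of_bool ?d1"
      by (subst ev_readE[OF M]) (use e l(1-7) W_consts(1) in simp_all)
    moreover have "esafe B (readE 5 (Num kd) mvarE (stateE \<zero> (Var 10)) (stateE \<zero> (Var 14))) (f, m)"
      by (rule esafe_readE) (use e l(1-7) W_consts(1,6) in simp_all)
    moreover     have "ev (readE 6 (Num kd) mvarE (stateE (Var 2) (Var 12)) (stateE (Var 2) (Var 16))) (f, m) = of_bool ?d2"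
      by (subst ev_readE[OF M]) (use e l(1-7) W_consts(1) in simp_all)
    moreover have "esafe B (readE 6 (Num kd) mvarE (stateE (Var 2) (Var 12)) (stateE (Var 2) (Var 16))) (f, m)"
      by (rule esafe_readE) (use e l(1-7) W_consts(1,6) in simp_all)
    ultimately show ?thesis by blast
  qed
  have lk: "ev (linkE i) (f, m) = chain ?p1 ?p2 ?q1 ?q2 (off + j) \<and> esafe B (linkE i) (f, m)"
    if "agree ?G f" "M X mv m" for f m
    using ev[OF that] l W_consts(1,5,6) unfolding linkE_def by (intro conjI esafe_enc) simp_all
  have lk': "ev (linkE (Plus i (Num 1))) (f, m) = chain ?p1 ?p2 ?q1 ?q2 (Suc (off + j)) \<and>
      esafe B (linkE (Plus i (Num 1))) (f, m)"
    if "agree ?G f" "M X mv m" for f m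
    using ev[OF that] l W_consts(1,5,6) unfolding linkE_def by (intro conjI esafe_enc) simp_all
  show ?thesis
    unfolding w write_link_def Let_def
  proof (rule emits_Cond[where T' = 600])
    show "emits ?G (Cond (Plus (readE 5 (Num kd) mvarE (stateE \<zero> (Var 10)) (stateE \<zero> (Var 14)))
          (readE 6 (Num kd) mvarE (stateE (Var 2) (Var 12)) (stateE (Var 2) (Var 16))))
        (emit_list [linkE i, Num kd, mvarE, linkE (Plus i (Num 1))])
        (emit_list [linkE i, \<zero>, \<zero>, linkE (Plus i (Num 1))]))
      (if ?d1 \<or> ?d2 then [chain ?p1 ?p2 ?q1 ?q2 (off + j), kd, ?x, chain ?p1 ?p2 ?q1 ?q2 (off + j + 1)]
       else [chain ?p1 ?p2 ?q1 ?q2 (off + j), 0, 0, chain ?p1 ?p2 ?q1 ?q2 (off + j + 1)]) 600"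
    proof (rule emits_Cond[where T' = 400])
      show "emits ?G (emit_list [linkE i, Num kd, mvarE, linkE (Plus i (Num 1))])
          [chain ?p1 ?p2 ?q1 ?q2 (off + j), kd, ?x, chain ?p1 ?p2 ?q1 ?q2 (off + j + 1)] 400"
      proof (rule emits_list)
        fix f m assume *: "agree ?G f" "M X mv m"
        show "f 5 = OUT \<and> map (\<lambda>e. ev e (f, m)) [linkE i, Num kd, mvarE, linkE (Plus i (Num 1))] =
            [chain ?p1 ?p2 ?q1 ?q2 (off + j), kd, ?x, chain ?p1 ?p2 ?q1 ?q2 (off + j + 1)] \<and>
            list_all (\<lambda>e. esafe B e (f, m)) [linkE i, Num kd, mvarE, linkE (Plus i (Num 1))]"
          using lk[OF *] lk'[OF *] ev[OF *] l(7) by simp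
      qed (use i(2) in simp_all)
      show "emits ?G (emit_list [linkE i, \<zero>, \<zero>, linkE (Plus i (Num 1))])
          [chain ?p1 ?p2 ?q1 ?q2 (off + j), 0, 0, chain ?p1 ?p2 ?q1 ?q2 (off + j + 1)] 400"
      proof (rule emits_list)
        fix f m assume *: "agree ?G f" "M X mv m"
        show "f 5 = OUT \<and> map (\<lambda>e. ev e (f, m)) [linkE i, \<zero>, \<zero>, linkE (Plus i (Num 1))] =
            [chain ?p1 ?p2 ?q1 ?q2 (off + j), 0, 0, chain ?p1 ?p2 ?q1 ?q2 (off + j + 1)] \<and>
            list_all (\<lambda>e. esafe B e (f, m)) [linkE i, \<zero>, \<zero>, linkE (Plus i (Num 1))]"
          using lk[OF *] lk'[OF *] ev[OF *] W_consts(6) by simp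
      qed (use i(2) in simp_all)
    next
      fix f m assume *: "agree ?G f" "M X mv m"
      show "esafe B (Plus (readE 5 (Num kd) mvarE (stateE \<zero> (Var 10)) (stateE \<zero> (Var 14)))
          (readE 6 (Num kd) mvarE (stateE (Var 2) (Var 12)) (stateE (Var 2) (Var 16)))) (f, m) \<and>
        (ev (Plus (readE 5 (Num kd) mvarE (stateE \<zero> (Var 10)) (stateE \<zero> (Var 14)))
          (readE 6 (Num kd) mvarE (stateE (Var 2) (Var 12)) (stateE (Var 2) (Var 16)))) (f, m) \<noteq> 0 \<longleftrightarrow> ?d1 \<or> ?d2)"
        using rd[OF *] W_consts(5-7) by (cases ?d1; cases ?d2) simp_all
    qed simp
  next
    fix f m assume *: "agree ?G f" "M X mv m"
    let ?e1 = "readE 5 (Num kd) mvarE (stateE \<zero> (Var 10)) (stateE \<zero> (Var 14))"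
    let ?e2 = "readE 6 (Num kd) mvarE (stateE (Var 2) (Var 12)) (stateE (Var 2) (Var 16))"
    let ?e = "Times (Times (readE 1 mvarE \<zero> \<zero> \<zero>) (readE 2 mvarE \<zero> \<zero> \<zero>)) (Plus (Minus ?e1 ?e2) (Minus ?e2 ?e1))"
    show "esafe B ?e (f, m) \<and>
      (ev ?e (f, m) \<noteq> 0 \<longleftrightarrow> (1, ?x, 0, 0, 0) \<in> X \<and> (2, ?x, 0, 0, 0) \<in> X \<and> ?d1 \<noteq> ?d2)"
      using rd[OF *] W_consts(5-7)
      by (cases ?d1; cases ?d2; cases "(1, ?x, 0, 0, 0) \<in> X"; cases "(2, ?x, 0, 0, 0) \<in> X") simp_all
  qed (simp_all add: emits_Skip)
qed

lemma write_chain_emits: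
  assumes i: "a < length qs1" "b < length qs2" "c < length qs1" "d < length qs2"
  shows "emits ((16, d) # (14, c) # (12, b) # (10, a) # G1) write_chain
    (word (chain_trans (qs1 ! a) (qs2 ! b) (qs1 ! c) (qs2 ! d))) (4000 * ((length mv + 1) * 1))"
proof -
  let ?G = "(16, d) # (14, c) # (12, b) # (10, a) # G1"
  let ?p1 = "qs1 ! a" and ?p2 = "qs2 ! b" and ?q1 = "qs1 ! c" and ?q2 = "qs2 ! d"
  let ?r1 = "(3, ?p1, ?q1, 0, 0) \<in> X" and ?r2 = "(4, ?p2, ?q2, 0, 0) \<in> X"
  have l: "?p1 < W" "?p2 < W" "?q1 < W" "?q2 < W"
    using assms s1.qs_less s2.qs_less by auto
  have ev: "f 4 = W \<and> f 2 = N1 \<and> f 5 = OUT \<and> f 6 = length mv \<and>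
     ev (stateE \<zero> (Var 10)) (f, m) = ?p1 \<and> ev (stateE (Var 2) (Var 12)) (f, m) = ?p2 \<and>
     ev (stateE \<zero> (Var 14)) (f, m) = ?q1 \<and> ev (stateE (Var 2) (Var 16)) (f, m) = ?q2 \<and>
     esafe B (stateE \<zero> (Var 10)) (f, m) \<and> esafe B (stateE (Var 2) (Var 12)) (f, m) \<and>
     esafe B (stateE \<zero> (Var 14)) (f, m) \<and> esafe B (stateE (Var 2) (Var 16)) (f, m)"
    if "agree ?G f" "M X mv m" for f m
    using that assms by (simp add: ev_acc esafe_acc)
  have lk: "ev (linkE i) (f, m) = chain ?p1 ?p2 ?q1 ?q2 (ev i (f, m)) \<and> esafe B (linkE i) (f, m)"
    if "agree ?G f" "M X mv m" "ev i (f, m) < W" "esafe B i (f, m)" for f m i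
    using ev[OF that(1,2)] that(3,4) l W_consts(5) unfolding linkE_def by (intro conjI esafe_enc) simp_all
  have bs: "esafe B (baseE (stateE \<zero> (Var 10)) (stateE (Var 2) (Var 12))) (f, m) \<and>
      esafe B (baseE (stateE \<zero> (Var 14)) (stateE (Var 2) (Var 16))) (f, m)"
    if "agree ?G f" "M X mv m" for f m
    using ev[OF that] l W_consts(1,6) unfolding baseE_def by (intro conjI esafe_enc) simp_all
  have first: "emits ?G (emit_list [baseE (stateE \<zero> (Var 10)) (stateE (Var 2) (Var 12)), \<zero>, \<zero>, linkE \<zero>])
      [base ?p1 ?p2, 0, 0, chain ?p1 ?p2 ?q1 ?q2 0] 300"
  proof (rule emits_list)
    fix f m assume *: "agree ?G f" "M X mv m"
    show "f 5 = OUT \<and> map (\<lambda>e. ev e (f, m)) [baseE (stateE \<zero> (Var 10)) (stateE (Var 2) (Var 12)), \<zero>, \<zero>, linkE \<zero>] =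
        [base ?p1 ?p2, 0, 0, chain ?p1 ?p2 ?q1 ?q2 0] \<and>
        list_all (\<lambda>e. esafe B e (f, m)) [baseE (stateE \<zero> (Var 10)) (stateE (Var 2) (Var 12)), \<zero>, \<zero>, linkE \<zero>]"
      using ev[OF *] lk[OF *, of \<zero>] bs[OF *] W_consts(1,6) by simp
  qed simp_all
  have last: "emits ?G (emit_list [linkE (Plus (Var 6) (Var 6)), \<zero>, \<zero>, baseE (stateE \<zero> (Var 14)) (stateE (Var 2) (Var 16))])
      [chain ?p1 ?p2 ?q1 ?q2 (2 * length mv), 0, 0, base ?q1 ?q2] 300"
  proof (rule emits_list)
    fix f m assume *: "agree ?G f" "M X mv m"
    show "f 5 = OUT \<and> map (\<lambda>e. ev e (f, m)) [linkE (Plus (Var 6) (Var 6)), \<zero>, \<zero>, baseE (stateE \<zero> (Var 14)) (stateE (Var 2) (Var 16))] =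
        [chain ?p1 ?p2 ?q1 ?q2 (2 * length mv), 0, 0, base ?q1 ?q2] \<and>
        list_all (\<lambda>e. esafe B e (f, m)) [linkE (Plus (Var 6) (Var 6)), \<zero>, \<zero>, baseE (stateE \<zero> (Var 14)) (stateE (Var 2) (Var 16))]"
      using ev[OF *] lk[OF *, of "Plus (Var 6) (Var 6)"] bs[OF *] W_consts(6,17-21) by (simp add: mult_2)
  qed simp_all
  have opens: "emits ?G (For 18 19 \<zero> (Var 6) (write_link 2 (Var 18)))
      (word (concat (map (link_trans Open 0 ?p1 ?p2 ?q1 ?q2) [0..<length mv]))) (1100 * ((length mv + 1) * 1))"
    unfolding word_concat
  proof (rule emits_For[OF _ _ _ _ _ _ refl, where K = 1000])
    fix j assume "j < length mv"
    then show "emits ((18, j) # ?G) (write_link 2 (Var 18)) (word (link_trans Open 0 ?p1 ?p2 ?q1 ?q2 j)) (1000 * 1)"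
      by (intro write_link_emits i) (simp_all add: kind_def arg_def)
  qed (use W_consts(6,14) in \<open>simp_all add: write_link_def Let_def\<close>)
  have closes: "emits ?G (For 18 19 \<zero> (Var 6) (write_link 3 (Plus (Var 6) (Var 18))))
      (word (concat (map (link_trans Close (length mv) ?p1 ?p2 ?q1 ?q2) [0..<length mv]))) (1100 * ((length mv + 1) * 1))"
    unfolding word_concat
  proof (rule emits_For[OF _ _ _ _ _ _ refl, where K = 1000])
    fix j assume j: "j < length mv"
    have "length mv + j < B" using j W_consts(20) by linarith
    then show "emits ((18, j) # ?G) (write_link 3 (Plus (Var 6) (Var 18)))
        (word (link_trans Close (length mv) ?p1 ?p2 ?q1 ?q2 j)) (1000 * 1)"
      using j by (intro write_link_emits i) (simp_all add: kind_def arg_def)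
  qed (use W_consts(6,14) in \<open>simp_all add: write_link_def Let_def\<close>)
  let ?L = "[(base ?p1 ?p2, None, chain ?p1 ?p2 ?q1 ?q2 0)] @
      concat (map (link_trans Open 0 ?p1 ?p2 ?q1 ?q2) [0..<length mv]) @
      concat (map (link_trans Close (length mv) ?p1 ?p2 ?q1 ?q2) [0..<length mv]) @
      [(chain ?p1 ?p2 ?q1 ?q2 (2 * length mv), None, base ?q1 ?q2)]"
  let ?c = "emit_list [baseE (stateE \<zero> (Var 10)) (stateE (Var 2) (Var 12)), \<zero>, \<zero>, linkE \<zero>] ;;
         For 18 19 \<zero> (Var 6) (write_link 2 (Var 18)) ;;
         For 18 19 \<zero> (Var 6) (write_link 3 (Plus (Var 6) (Var 18))) ;;
         emit_list [linkE (Plus (Var 6) (Var 6)), \<zero>, \<zero>, baseE (stateE \<zero> (Var 14)) (stateE (Var 2) (Var 16))]"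
  have wl: "writes (write_link k i) = {}" for k i by (simp add: write_link_def Let_def)
  have all: "emits ?G ?c (word ?L) (300 + (1100 * ((length mv + 1) * 1) + (1100 * ((length mv + 1) * 1) + 300)))"
  proof -
    have "word ?L = [base ?p1 ?p2, 0, 0, chain ?p1 ?p2 ?q1 ?q2 0] @
       (word (concat (map (link_trans Open 0 ?p1 ?p2 ?q1 ?q2) [0..<length mv])) @
       (word (concat (map (link_trans Close (length mv) ?p1 ?p2 ?q1 ?q2) [0..<length mv])) @
       [chain ?p1 ?p2 ?q1 ?q2 (2 * length mv), 0, 0, base ?q1 ?q2]))"
      unfolding map_append concat_append by simp
    then show ?thesis
      using emits_Seq[OF first emits_Seq[OF opens emits_Seq[OF closes last _ order_refl] _ order_refl] _ order_refl]
      by (simp add: wl)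
  qed
  have rd: "ev (readE 3 (stateE \<zero> (Var 10)) (stateE \<zero> (Var 14)) \<zero> \<zero>) (f, m) = of_bool ?r1 \<and>
      ev (readE 4 (stateE (Var 2) (Var 12)) (stateE (Var 2) (Var 16)) \<zero> \<zero>) (f, m) = of_bool ?r2 \<and>
      esafe B (readE 3 (stateE \<zero> (Var 10)) (stateE \<zero> (Var 14)) \<zero> \<zero>) (f, m) \<and>
      esafe B (readE 4 (stateE (Var 2) (Var 12)) (stateE (Var 2) (Var 16)) \<zero> \<zero>) (f, m)"
    if "agree ?G f" "M X mv m" for f m
  proof -
    have M: "M X mv (snd (f, m))" using that(2) by simp
    note e = ev[OF that]
    have "ev (readE 3 (stateE \<zero> (Var 10)) (stateE \<zero> (Var 14)) \<zero> \<zero>) (f, m) = of_bool ?r1"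
      by (subst ev_readE[OF M]) (use e l W_consts(1) in simp_all)
    moreover have "ev (readE 4 (stateE (Var 2) (Var 12)) (stateE (Var 2) (Var 16)) \<zero> \<zero>) (f, m) = of_bool ?r2"
      by (subst ev_readE[OF M]) (use e l W_consts(1) in simp_all)
    moreover have "esafe B (readE 3 (stateE \<zero> (Var 10)) (stateE \<zero> (Var 14)) \<zero> \<zero>) (f, m)"
      by (rule esafe_readE) (use e l W_consts(1,6) in simp_all)
    moreover have "esafe B (readE 4 (stateE (Var 2) (Var 12)) (stateE (Var 2) (Var 16)) \<zero> \<zero>) (f, m)"
      by (rule esafe_readE) (use e l W_consts(1,6) in simp_all)
    ultimately show ?thesis by blast
  qed
  have nil: "word [] = []" by simp
  have "emits ?G write_chain (if ?r1 then (if ?r2 then word ?L else []) else []) (4000 * ((length mv + 1) * 1))"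
    unfolding write_chain_def
  proof (rule emits_Cond[where T' = "3500 * ((length mv + 1) * 1)"])
    show "emits ?G (Cond (readE 4 (stateE (Var 2) (Var 12)) (stateE (Var 2) (Var 16)) \<zero> \<zero>) ?c Skip)
        (if ?r2 then word ?L else []) (3500 * ((length mv + 1) * 1))"
    proof (rule emits_Cond[where T' = "2900 * ((length mv + 1) * 1)"])
      show "emits ?G ?c (word ?L) (2900 * ((length mv + 1) * 1))"
        by (rule emits_mono[OF all]) simp
    next
      fix f m assume *: "agree ?G f" "M X mv m"
      then show "esafe B (readE 4 (stateE (Var 2) (Var 12)) (stateE (Var 2) (Var 16)) \<zero> \<zero>) (f, m) \<and>
          (ev (readE 4 (stateE (Var 2) (Var 12)) (stateE (Var 2) (Var 16)) \<zero> \<zero>) (f, m) \<noteq> 0 \<longleftrightarrow> ?r2)"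
        using rd[OF *] by (cases ?r2) simp_all
    qed (simp_all add: emits_Skip)
  next
    fix f m assume *: "agree ?G f" "M X mv m"
    then show "esafe B (readE 3 (stateE \<zero> (Var 10)) (stateE \<zero> (Var 14)) \<zero> \<zero>) (f, m) \<and>
        (ev (readE 3 (stateE \<zero> (Var 10)) (stateE \<zero> (Var 14)) \<zero> \<zero>) (f, m) \<noteq> 0 \<longleftrightarrow> ?r1)"
      using rd[OF *] by (cases ?r1) simp_all
  qed (simp_all add: emits_Skip)
  then show ?thesis unfolding chain_trans_def word_if nil .
qed

lemma write_chains_emits:
  "emits G1 write_chains (word chains_list)
    (5000 * ((length qs1 + 1) * ((length qs2 + 1) * ((length qs1 + 1) * ((length qs2 + 1) * ((length mv + 1) * 1))))))"
  unfolding write_chains_def chains_list_def word_concat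
proof (rule emits_For[OF _ _ _ _ _ _ concat_map_nth, where K = 4600])
  have wl: "writes write_chain = {18, 19}" by (simp add: write_chain_def write_link_def Let_def)
  fix a assume a: "a < length qs1"
  show "emits ((10, a) # G1) (For 12 13 \<zero> (headE (Var 2) 0)
      (For 14 15 \<zero> (headE \<zero> 0) (For 16 17 \<zero> (headE (Var 2) 0) write_chain)))
    (concat (map (\<lambda>p2. concat (map (\<lambda>q1. concat (map (\<lambda>q2. word (chain_trans (qs1 ! a) p2 q1 q2)) qs2)) qs1)) qs2))
    (4600 * ((length qs2 + 1) * ((length qs1 + 1) * ((length qs2 + 1) * ((length mv + 1) * 1)))))"
  proof (rule emits_For[OF _ _ _ _ _ _ concat_map_nth, where K = 4400])
    fix b assume b: "b < length qs2"
    show "emits ((12, b) # (10, a) # G1) (For 14 15 \<zero> (headE \<zero> 0) (For 16 17 \<zero> (headE (Var 2) 0) write_chain))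
      (concat (map (\<lambda>q1. concat (map (\<lambda>q2. word (chain_trans (qs1 ! a) (qs2 ! b) q1 q2)) qs2)) qs1))
      (4400 * ((length qs1 + 1) * ((length qs2 + 1) * ((length mv + 1) * 1))))"
    proof (rule emits_For[OF _ _ _ _ _ _ concat_map_nth, where K = 4200])
      fix c assume c: "c < length qs1"
      show "emits ((14, c) # (12, b) # (10, a) # G1) (For 16 17 \<zero> (headE (Var 2) 0) write_chain)
        (concat (map (\<lambda>q2. word (chain_trans (qs1 ! a) (qs2 ! b) (qs1 ! c) q2)) qs2))
        (4200 * ((length qs2 + 1) * ((length mv + 1) * 1)))"
      proof (rule emits_For[OF _ _ _ _ _ _ concat_map_nth, where K = 4000])
        fix d assume d: "d < length qs2"
        show "emits ((16, d) # (14, c) # (12, b) # (10, a) # G1) write_chain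
            (word (chain_trans (qs1 ! a) (qs2 ! b) (qs1 ! c) (qs2 ! d))) (4000 * ((length mv + 1) * 1))"
          using a b c d by (rule write_chain_emits)
      qed (use W_consts(6) len_less in \<open>simp_all add: ev_acc esafe_acc wl\<close>)
    qed (use W_consts(6) len_less in \<open>simp_all add: ev_acc esafe_acc wl\<close>)
  qed (use W_consts(6) len_less in \<open>simp_all add: ev_acc esafe_acc wl\<close>)
qed (use W_consts(6) len_less in \<open>simp_all add: ev_acc esafe_acc write_chain_def write_link_def Let_def\<close>)

lemma ini_less: "i1 < W" "f1 < W" "i2 < W" "f2 < W"
proof -
  have "xs ! 3 = i1" "xs ! 4 = f1" "xs ! (N1 + 3) = i2" "xs ! (N1 + 4) = f2"
    using s1.seg(2)[of 3] s1.seg(2)[of 4] s2.seg(2)[of 3] s2.seg(2)[of 4]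
    by (simp_all add: auto_word_def)
  moreover have "3 < N" "4 < N" "N1 + 3 < N" "N1 + 4 < N" using s1.seg_less s2.seg_less by linarith+
  ultimately show "i1 < W" "f1 < W" "i2 < W" "f2 < W" using xs nth_mem by metis+
qed

definition head :: "nat list" where
  "head = [length states_list, length mv, 0, base i1 i2, base f1 f2]"

lemma length_states_list:
  "length states_list = length qs1 * length qs2 +
    length qs1 * length qs2 * (length qs1 * length qs2) * (length mv + length mv + 1)"
  by (simp add: states_list_def length_concat o_def sum_list_triv mult_2 algebra_simps del: upt_Suc)

lemma head_bounds:
  "length qs1 * length qs2 * (length qs1 * length qs2) * (length mv + length mv + 1) < B"
  "length qs1 * length qs2 < B" "length qs1 * length qs2 * (length qs1 * length qs2) < B" "length states_list < B"
proof -
  have n: "length qs1 * length qs2 \<le> W * W" using s1.lengths_less s2.lengths_less by (intro mult_le_mono) auto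
  have n2: "length qs1 * length qs2 * (length qs1 * length qs2) \<le> W * W * (W * W)"
    by (intro mult_le_mono n)
  have n3: "length qs1 * length qs2 * (length qs1 * length qs2) * (length mv + length mv + 1) \<le> W * W * (W * W) * W"
    using W_consts by (intro mult_le_mono[OF n2]) linarith
  have W6: "W * W * (W * W) * W * W = W ^ 6" by (simp add: numeral_eq_Suc)
  have w: "W * W \<le> W * W * (W * W) * W * W" "W * W * (W * W) \<le> W * W * (W * W) * W * W"
    "W * W * (W * W) * W \<le> W * W * (W * W) * W * W"
    using W10 by (simp_all add: algebra_simps)
  have "0 < W ^ 6" using W10 by simp
  then show "length qs1 * length qs2 * (length qs1 * length qs2) * (length mv + length mv + 1) < B"
    "length qs1 * length qs2 < B" "length qs1 * length qs2 * (length qs1 * length qs2) < B" "length states_list < B"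
    unfolding length_states_list using n n2 n3 w W6 W6_B by linarith+
qed

lemma write_head_emits: "emits G1 write_head head 300"
  unfolding write_head_def Let_def
proof (rule emits_list)
  let ?n = "Times (headE \<zero> 0) (headE (Var 2) 0)"
  let ?es = "[Plus ?n (Times (Times ?n ?n) (Plus (Plus (Var 6) (Var 6)) (Num 1))), Var 6, \<zero>,
    baseE (headE \<zero> 3) (headE (Var 2) 3), baseE (headE \<zero> 4) (headE (Var 2) 4)]"
  fix f m assume *: "agree G1 f" "M X mv m"
  have h: "f 4 = W" "f 2 = N1" "f 5 = OUT" "f 6 = length mv"
    "ev (headE \<zero> 0) (f, m) = length qs1" "ev (headE (Var 2) 0) (f, m) = length qs2"
    "ev (headE \<zero> 3) (f, m) = i1" "ev (headE (Var 2) 3) (f, m) = i2"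
    "ev (headE \<zero> 4) (f, m) = f1" "ev (headE (Var 2) 4) (f, m) = f2"
    "esafe B (headE \<zero> 0) (f, m)" "esafe B (headE (Var 2) 0) (f, m)"
    "esafe B (headE \<zero> 3) (f, m)" "esafe B (headE (Var 2) 3) (f, m)"
    "esafe B (headE \<zero> 4) (f, m)" "esafe B (headE (Var 2) 4) (f, m)"
    using * by (simp_all add: ev_acc esafe_acc)
  have b: "esafe B (baseE (headE \<zero> 3) (headE (Var 2) 3)) (f, m)"
    "esafe B (baseE (headE \<zero> 4) (headE (Var 2) 4)) (f, m)"
    unfolding baseE_def using h ini_less W_consts(1,6) by (auto intro!: esafe_enc)
  show "f 5 = OUT \<and> map (\<lambda>e. ev e (f, m)) ?es = head \<and> list_all (\<lambda>e. esafe B e (f, m)) ?es"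
    using h b head_bounds W_consts(5,6,19,20) by (simp add: head_def length_states_list)
qed (simp_all add: head_def)

definition out_word :: "nat list" where
  "out_word = head @ states_list @ mv @ word (letters_list @ chains_list)"

text \<open>The machine cannot divide, so the count is searched linearly, which costs no more than
  the output itself up to a constant.\<close>

lemma fix_count_triple:
  assumes "length out_word \<le> LM"
  shows "triple B G1 (Em out_word) fix_count (Em (out_word[2 := length (letters_list @ chains_list)]))
    (200 * ((length out_word + 1 + 1) * 1))"
proof -
  let ?n = "length (letters_list @ chains_list)"
  \<comment> \<open>The placeholder is replaced in pass \<open>?n\<close>. Neither the write pointer
    nor word 0 of the output changes, so the tests give the same answers before and after.\<close>
  define I where "I i = Em (if ?n < i then out_word[2 := ?n] else out_word)" for i
  have len: "length out_word = 5 + length states_list + length mv + 4 * ?n"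
    by (simp add: out_word_def head_def)
  have hd: "out_word ! 0 = length states_list" by (simp add: out_word_def head_def)
  have facts: "m OUT = OUT + 1 + length out_word" "m (OUT + 1) = length states_list"
    if "I i m" for i m
  proof -
    define out where "out = (if ?n < i then out_word[2 := ?n] else out_word)"
    have e: "Em out m" using that by (simp add: I_def out_def)
    have o: "length out = length out_word" "out ! 0 = length states_list"
      using hd by (simp_all add: out_def)
    have "0 < length out" using o(1) len by linarith
    show "m OUT = OUT + 1 + length out_word" using e o(1) by (simp add: Em_def)
    have "m (OUT + 1 + 0) = out ! 0" using e \<open>0 < length out\<close> unfolding Em_def by blast
    then show "m (OUT + 1) = length states_list" using o(2) by simp
  qed
  have B: "OUT + length out_word + 100 \<le> B" using assms LM' by linarith
  have "triple B G1 (Em out_word) fix_count (I (length out_word + 1)) (200 * ((length out_word + 1 + 1) * 1))"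
    unfolding fix_count_def
  proof (rule triple_For[where I = I and K = 100])
    fix i assume i: "0 \<le> i" "i < length out_word + 1"
    have B': "4 * i + length mv + (length states_list + 6) < B" "OUT + 3 < B" "4 * i < B" "4 * i + length mv < B"
      "length states_list + 6 < B" "OUT + 1 < B" "length out_word + 1 < B"
      using i len assms LM' by linarith+
    show "triple B ((10, i) # G1) (I i)
      (Cond (eqE (Plus (Plus (Times (Num 4) (Var 10)) (Var 6)) (Plus (Deref (Plus (Var 5) (Num 1))) (Num 6)))
          (Minus (Deref (Var 5)) (Var 5)))
        (Write (Plus (Var 5) (Num 3)) (Var 10)) Skip) (I (Suc i)) (100 * 1)"
    proof (rule triple_Cond[where T' = 20 and ?P1.0 = "\<lambda>m. I i m \<and> i = ?n" and ?P2.0 = "\<lambda>m. I i m \<and> i \<noteq> ?n"])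
      show "triple B ((10, i) # G1) (\<lambda>m. I i m \<and> i \<noteq> ?n) Skip (I (Suc i)) 20"
      proof (rule triple_Skip)
        fix m assume *: "I i m \<and> i \<noteq> ?n"
        then have "(?n < Suc i) = (?n < i)" by linarith
        then show "I (Suc i) m" using * unfolding I_def by simp
      qed
      show "triple B ((10, i) # G1) (\<lambda>m. I i m \<and> i = ?n) (Write (Plus (Var 5) (Num 3)) (Var 10)) (I (Suc i)) 20"
      proof (rule triple_Write)
        fix f m assume *: "agree ((10, i) # G1) f" "I i m \<and> i = ?n"
        have "I ?n m" using *(2) by blast
        then have e: "Em out_word m" by (simp add: I_def)
        have "M X mv (m(OUT + 3 := ?n))" by (rule M_OUT) (use e in \<open>simp_all add: Em_def\<close>)
        moreover have "(m(OUT + 3 := ?n)) (OUT + 1 + k) = out_word[2 := ?n] ! k" if "k < length out_word" for k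
          using that e by (cases "k = 2") (simp_all add: Em_def)
        ultimately have "Em (out_word[2 := ?n]) (m(OUT + 3 := ?n))" using e by (simp add: Em_def)
        then show "esafe B (Plus (Var 5) (Num 3)) (f, m) \<and> esafe B (Var 10) (f, m) \<and>
            I (Suc i) (m(ev (Plus (Var 5) (Num 3)) (f, m) := ev (Var 10) (f, m)))"
          using * B' by (simp add: I_def)
      qed simp
    next
      fix f m assume *: "agree ((10, i) # G1) f" "I i m"
      note fa = facts[OF *(2)]
      have fs: "f 10 = i" "f 5 = OUT" "f 6 = length mv" using *(1) by simp_all
      \<comment> \<open>The constant 6 consists of the five header words and the one by which the
        pointer difference exceeds the output length.\<close>
      have "4 * i + length mv + (length states_list + 6) = length out_word + 1 \<longleftrightarrow> i = ?n"
        using len by linarith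
      moreover have "esafe B (eqE (Plus (Plus (Times (Num 4) (Var 10)) (Var 6)) (Plus (Deref (Plus (Var 5) (Num 1))) (Num 6)))
          (Minus (Deref (Var 5)) (Var 5))) (f, m)"
        by (rule esafe_eqE) (use fa fs B' W_consts(5,9,11) in simp_all)
      ultimately show "esafe B (eqE (Plus (Plus (Times (Num 4) (Var 10)) (Var 6)) (Plus (Deref (Plus (Var 5) (Num 1))) (Num 6)))
          (Minus (Deref (Var 5)) (Var 5))) (f, m) \<and>
        (if ev (eqE (Plus (Plus (Times (Num 4) (Var 10)) (Var 6)) (Plus (Deref (Plus (Var 5) (Num 1))) (Num 6)))
          (Minus (Deref (Var 5)) (Var 5))) (f, m) \<noteq> 0 then I i m \<and> i = ?n else I i m \<and> i \<noteq> ?n)"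
        using *(2) fa fs by (cases "i = ?n") simp_all
    qed simp
  next
    fix f m assume *: "agree G1 f" "Em out_word m"
    then have "I 0 m" by (simp add: I_def)
    then show "esafe B \<zero> (f, m) \<and> esafe B (Minus (Deref (Var 5)) (Var 5)) (f, m) \<and> ev \<zero> (f, m) = 0 \<and>
        ev (Minus (Deref (Var 5)) (Var 5)) (f, m) = length out_word + 1 \<and> I 0 m"
      using * W_consts(6) by (simp add: Em_def)
  qed (use B W_consts(5) in simp_all)
  moreover have "?n < length out_word + 1" using len by linarith
  ultimately show ?thesis by (simp add: I_def)
qed

definition final_word :: "nat list" where
  "final_word = auto_word code states_list mv (letters_list @ chains_list) (base i1 i2) (base f1 f2)"

lemma final_word_eq: "final_word = out_word[2 := length (letters_list @ chains_list)]"
  by (simp add: final_word_def auto_word_def out_word_def head_def)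

lemma writes_chains: "writes write_chains \<subseteq> {10..19}" "writes write_states \<subseteq> {10..19}"
  "writes write_vars \<subseteq> {10..19}" "writes write_letters \<subseteq> {10..19}" "writes fix_count \<subseteq> {10..19}"
  "writes write_head = {}"
  by (auto simp: write_chains_def write_chain_def write_link_def write_states_def write_vars_def
      write_letters_def fix_count_def write_head_def Let_def)

lemma out_word_emits:
  "emits G1 (write_head ;; write_states ;; write_vars ;; write_letters ;; write_chains) out_word out_time"
proof -
  have d: "fst ` set G1 \<inter> writes c = {}" if "writes c \<subseteq> {10..19}" for c
    using that by auto
  have w: "out_word = head @ (states_list @ (mv @ (word letters_list @ word chains_list)))"
    by (simp add: out_word_def)
  show ?thesis unfolding w out_time_def
    by (rule emits_Seq[OF write_head_emits emits_Seq[OF write_states_emits emits_Seq[OF write_vars_emits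
          emits_Seq[OF write_letters_emits write_chains_emits _ order_refl] _ order_refl] _ order_refl] _ order_refl])
      (use writes_chains d in simp_all)
qed

lemma output_triple:
  assumes "out_time \<le> LM"
  shows "triple B G1 (M X mv)
    (Write (Var 5) (Plus (Var 5) (Num 1)) ;;
     (write_head ;; write_states ;; write_vars ;; write_letters ;; write_chains) ;;
     fix_count ;; Write \<zero> (Var 5))
    (\<lambda>m. m 0 = OUT \<and> m OUT = OUT + 1 + length final_word \<and>
      (\<forall>i<length final_word. m (OUT + 1 + i) = final_word ! i))
    (1000 * (out_time + 1))"
proof -
  let ?e = "write_head ;; write_states ;; write_vars ;; write_letters ;; write_chains"
  have len: "length out_word \<le> out_time" using out_word_emits by (simp add: emits_def)
  have d: "fst ` set G1 \<inter> writes c = {}" if "writes c \<subseteq> {10..19}" for c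
    using that by auto
  have 1: "triple B G1 (M X mv) (Write (Var 5) (Plus (Var 5) (Num 1))) (Em []) 5"
  proof (rule triple_Write)
    fix f m assume *: "agree G1 f" "M X mv m"
    then have "M X mv (m(OUT := OUT + 1))" by (intro M_OUT) simp_all
    then show "esafe B (Var 5) (f, m) \<and> esafe B (Plus (Var 5) (Num 1)) (f, m) \<and>
        Em [] (m(ev (Var 5) (f, m) := ev (Plus (Var 5) (Num 1)) (f, m)))"
      using * LM' by (simp add: Em_def)
  qed simp
  have 2: "triple B G1 (Em []) ?e (Em out_word) out_time"
    using emitsD[OF out_word_emits, of "[]"] len assms by simp
  have 3: "triple B G1 (Em out_word) fix_count (Em final_word) (200 * ((out_time + 1 + 1) * 1))"
    unfolding final_word_eq
    by (rule triple_conseq[OF fix_count_triple]) (use len assms in simp_all)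
  \<comment> \<open>Triples say nothing about final registers, so the location of the output is
    handed over in cell 0. At this point the input may be overwritten.\<close>
  have 4: "triple B G1 (Em final_word) (Write \<zero> (Var 5))
      (\<lambda>m. m 0 = OUT \<and> m OUT = OUT + 1 + length final_word \<and>
        (\<forall>i<length final_word. m (OUT + 1 + i) = final_word ! i)) 5"
  proof (rule triple_Write)
    fix f m assume *: "agree G1 f" "Em final_word m"
    have "0 < OUT" using enc_ge[of 9 W 0 0 0 0 0] W10 by (simp add: OUT_def)
    then show "esafe B \<zero> (f, m) \<and> esafe B (Var 5) (f, m) \<and>
        (\<lambda>m. m 0 = OUT \<and> m OUT = OUT + 1 + length final_word \<and>
          (\<forall>i<length final_word. m (OUT + 1 + i) = final_word ! i))
        (m(ev \<zero> (f, m) := ev (Var 5) (f, m)))"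
      using * W_consts(6) by (simp add: Em_def)
  qed simp
  have we: "writes ?e \<subseteq> {10..19}" using writes_chains by auto
  show ?thesis
    by (rule triple_Seq[OF 1 triple_Seq[OF 2 triple_Seq[OF 3 4 _ order_refl] _ order_refl]])
      (use writes_chains(5) we d in simp_all)
qed

end

section \<open>The whole program\<close>

text \<open>
  Register 2 holds the address of the second automaton, 3 the length of the input, 4 the
  base \<open>W\<close>, 5 the address \<open>OUT\<close>, and 6 the number of variables of the join. The base is the
  sum of all input words rather than their maximum since this is a single loop without tests.
\<close>

definition tables :: com where
  "tables = flags \<zero> 0 ;; flags (Var 2) 1 ;; eps_edges \<zero> 0 ;; warshall \<zero> 0 ;;
    eps_edges (Var 2) 1 ;; warshall (Var 2) 1 ;; op_table \<zero> 0 ;; op_table (Var 2) 1 ;;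
    merge_vars \<zero> (Var 2)"

definition write_output :: com where
  "write_output = Write (Var 5) (Plus (Var 5) (Num 1)) ;;
     (write_head ;; write_states ;; write_vars ;; write_letters ;; write_chains) ;;
     fix_count ;; Write \<zero> (Var 5)"

text \<open>Relative to register 2: with 0 there it is the length of the first encoding, which is
  the address of the second; with this address in register 2 it is the length of the second
  encoding.\<close>

definition lengthE :: exp where
  "lengthE = Plus (Plus (Num 5) (headE (Var 2) 0)) (Plus (headE (Var 2) 1) (Times (Num 4) (headE (Var 2) 2)))"

text \<open>The start value 10 and the extra 1 for each word make the base exceed every input word
  and be at least \<open>N + 10\<close>. The sum is accumulated in cell \<open>N\<close>, the first
  one behind the input and below all table addresses.\<close>

definition word_base :: com where
  "word_base = Write (Var 3) (Num 10) ;;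
    For 10 11 \<zero> (Var 3) (Write (Var 3) (Plus (Deref (Var 3)) (Plus (Deref (Var 10)) (Num 1))))"

definition main :: com where
  "main = Assign 2 \<zero> ;; Assign 2 lengthE ;; Assign 3 (Plus (Var 2) lengthE) ;;
    word_base ;; Assign 4 (Deref (Var 3)) ;; tables ;;
    Assign 5 (encE (Num 9) \<zero> \<zero> \<zero> \<zero> \<zero>) ;; Assign 6 (Deref (cellE 8 \<zero> \<zero> \<zero> \<zero>)) ;; write_output"

definition program :: com where
  "program = main ;; Assign 0 (Plus (Deref \<zero>) (Num 1)) ;; Assign 1 (Minus (Deref (Deref \<zero>)) (Var 0))"

context two_segments
begin

definition edges1 :: "(nat \<times> nat) set" where
  "edges1 = Id_on (set qs1) \<union> {(p, q) |p l q. (p, l, q) \<in> set ts1 \<and> kind l \<noteq> 1}"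

definition edges2 :: "(nat \<times> nat) set" where
  "edges2 = Id_on (set qs2) \<union> {(p, q) |p l q. (p, l, q) \<in> set ts2 \<and> kind l \<noteq> 1}"

text \<open>The flag set after successive phases of \<open>tables\<close>: memberships, reachability
  in either automaton, operations in either automaton. The phases use different tags, so earlier
  answers stay valid.\<close>

definition X1 where "X1 = {} \<union> {(1 + 0, x, 0, 0, 0) |x. x \<in> set vs1} \<union> {(1 + 1, x, 0, 0, 0) |x. x \<in> set vs2}"
definition X2 where "X2 = X1 \<union> pairs 0 (close_under (set qs1) edges1 qs1)"
definition X3 where "X3 = X2 \<union> pairs 1 (close_under (set qs2) edges2 qs2)"
definition X4 where "X4 = X3 \<union> op_marks code 0 X3 (set ts1 \<times> set qs1 \<times> set qs1)"
definition X5 where "X5 = X4 \<union> op_marks code 1 X4 (set ts2 \<times> set qs2 \<times> set qs2)"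

definition table_time :: nat where
  "table_time = 100 * ((length vs1 + 1) * 1) + (100 * ((length vs2 + 1) * 1) +
    ((100 * ((length qs1 + 1) * 1) + 300 * ((length ts1 + 1) * 1)) +
    ((500 * ((length qs1 + 1) * ((length qs1 + 1) * ((length qs1 + 1) * 1)))) +
    ((100 * ((length qs2 + 1) * 1) + 300 * ((length ts2 + 1) * 1)) +
    ((500 * ((length qs2 + 1) * ((length qs2 + 1) * ((length qs2 + 1) * 1)))) +
    ((600 * ((length ts1 + 1) * ((length qs1 + 1) * ((length qs1 + 1) * 1)))) +
    ((600 * ((length ts2 + 1) * ((length qs2 + 1) * ((length qs2 + 1) * 1)))) +
    (300 * ((length vs1 + 1) * 1) + 400 * ((length vs2 + 1) * 1)))))))))"

lemma op_marks_iff: "(t, k, x, p, q) \<in> op_marks code u X P \<longleftrightarrow>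
    (\<exists>a l b. ((a, l, b), p, q) \<in> P \<and> t = 5 + u \<and> k = kind l \<and> x = arg code l \<and> 2 \<le> kind l \<and>
      (3 + u, p, a, 0, 0) \<in> X \<and> (3 + u, b, q, 0, 0) \<in> X)"
  by (auto simp: op_marks_def image_iff split: prod.splits)

lemma X5_flag: "(1, x, 0, 0, 0) \<in> X5 \<longleftrightarrow> x \<in> set vs1" "(2, x, 0, 0, 0) \<in> X5 \<longleftrightarrow> x \<in> set vs2"
  by (auto simp: X5_def X4_def X3_def X2_def X1_def pairs_iff op_marks_iff)

lemma X3_pair: "(3, p, q, 0, 0) \<in> X3 \<longleftrightarrow> (p, q) \<in> close_under (set qs1) edges1 qs1"
  "(4, p, q, 0, 0) \<in> X3 \<longleftrightarrow> (p, q) \<in> close_under (set qs2) edges2 qs2"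
  by (auto simp: X3_def X2_def X1_def pairs_iff)

lemma X5_pair: "(3, p, q, 0, 0) \<in> X5 \<longleftrightarrow> (p, q) \<in> close_under (set qs1) edges1 qs1"
  "(4, p, q, 0, 0) \<in> X5 \<longleftrightarrow> (p, q) \<in> close_under (set qs2) edges2 qs2"
  by (auto simp: X5_def X4_def op_marks_iff X3_pair)

lemma X5_op: "(5, k, x, p, q) \<in> X5 \<longleftrightarrow> (\<exists>a l b. (a, l, b) \<in> set ts1 \<and> p \<in> set qs1 \<and> q \<in> set qs1 \<and>
    k = kind l \<and> x = arg code l \<and> 2 \<le> kind l \<and>
    (p, a) \<in> close_under (set qs1) edges1 qs1 \<and> (b, q) \<in> close_under (set qs1) edges1 qs1)"
  "(6, k, x, p, q) \<in> X5 \<longleftrightarrow> (\<exists>a l b. (a, l, b) \<in> set ts2 \<and> p \<in> set qs2 \<and> q \<in> set qs2 \<and>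
    k = kind l \<and> x = arg code l \<and> 2 \<le> kind l \<and>
    (p, a) \<in> close_under (set qs2) edges2 qs2 \<and> (b, q) \<in> close_under (set qs2) edges2 qs2)"
proof -
  have "(5, k, x, p, q) \<notin> X3" "(6, k, x, p, q) \<notin> X3"
    by (auto simp: X3_def X2_def X1_def pairs_iff)
  moreover have "(4, p, q, 0, 0) \<in> X4 \<longleftrightarrow> (4, p, q, 0, 0) \<in> X3" for p q
    by (auto simp: X4_def op_marks_iff)
  ultimately show "(5, k, x, p, q) \<in> X5 \<longleftrightarrow> (\<exists>a l b. (a, l, b) \<in> set ts1 \<and> p \<in> set qs1 \<and> q \<in> set qs1 \<and>
    k = kind l \<and> x = arg code l \<and> 2 \<le> kind l \<and>
    (p, a) \<in> close_under (set qs1) edges1 qs1 \<and> (b, q) \<in> close_under (set qs1) edges1 qs1)"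
    "(6, k, x, p, q) \<in> X5 \<longleftrightarrow> (\<exists>a l b. (a, l, b) \<in> set ts2 \<and> p \<in> set qs2 \<and> q \<in> set qs2 \<and>
    k = kind l \<and> x = arg code l \<and> 2 \<le> kind l \<and>
    (p, a) \<in> close_under (set qs2) edges2 qs2 \<and> (b, q) \<in> close_under (set qs2) edges2 qs2)"
    by (simp_all add: X5_def X4_def op_marks_iff X3_pair)
qed

lemma writes_tables: "writes (flags e u) \<subseteq> {10..19}" "writes (eps_edges e u) \<subseteq> {10..19}"
  "writes (warshall e u) \<subseteq> {10..19}" "writes (op_table e u) \<subseteq> {10..19}" "writes (merge_vars e e') \<subseteq> {10..19}"
  by (auto simp: flags_def eps_edges_def warshall_def op_table_def merge_vars_def)

lemma tables_triple:
  assumes "edges1 \<subseteq> set qs1 \<times> set qs1" "edges2 \<subseteq> set qs2 \<times> set qs2"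
  shows "triple B G0 (M {} []) tables (M X5 mv) table_time"
proof -
  have d: "fst ` set G0 \<inter> writes c = {}" if "writes c \<subseteq> {10..19}" for c using that by auto
  note S = triple_Seq[OF _ _ _ order_refl]
  have 1: "triple B G0 (M {} []) (flags \<zero> 0) (M ({} \<union> {(1 + 0, x, 0, 0, 0) |x. x \<in> set vs1}) []) (100 * ((length vs1 + 1) * 1))"
    by (rule s1.flags_triple) simp
  have 2: "triple B G0 (M ({} \<union> {(1 + 0, x, 0, 0, 0) |x. x \<in> set vs1}) []) (flags (Var 2) 1) (M X1 []) (100 * ((length vs2 + 1) * 1))"
    unfolding X1_def by (rule s2.flags_triple) simp
  have 3: "triple B G0 (M X1 []) (eps_edges \<zero> 0) (M (X1 \<union> pairs 0 edges1) [])
      (100 * ((length qs1 + 1) * 1) + 300 * ((length ts1 + 1) * 1))"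
    unfolding edges1_def by (rule s1.eps_edges_triple) simp
  have 4: "triple B G0 (M (X1 \<union> pairs 0 edges1) []) (warshall \<zero> 0) (M X2 [])
      (500 * ((length qs1 + 1) * ((length qs1 + 1) * ((length qs1 + 1) * 1))))"
    unfolding X2_def by (rule s1.warshall_triple) (use assms in \<open>auto simp: X1_def\<close>)
  have 5: "triple B G0 (M X2 []) (eps_edges (Var 2) 1) (M (X2 \<union> pairs 1 edges2) [])
      (100 * ((length qs2 + 1) * 1) + 300 * ((length ts2 + 1) * 1))"
    unfolding edges2_def by (rule s2.eps_edges_triple) simp
  have 6: "triple B G0 (M (X2 \<union> pairs 1 edges2) []) (warshall (Var 2) 1) (M X3 [])
      (500 * ((length qs2 + 1) * ((length qs2 + 1) * ((length qs2 + 1) * 1))))"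
    unfolding X3_def by (rule s2.warshall_triple) (use assms in \<open>auto simp: X2_def X1_def pairs_iff\<close>)
  have 7: "triple B G0 (M X3 []) (op_table \<zero> 0) (M X4 [])
      (600 * ((length ts1 + 1) * ((length qs1 + 1) * ((length qs1 + 1) * 1))))"
    unfolding X4_def by (rule s1.op_table_triple) simp
  have 8: "triple B G0 (M X4 []) (op_table (Var 2) 1) (M X5 [])
      (600 * ((length ts2 + 1) * ((length qs2 + 1) * ((length qs2 + 1) * 1))))"
    unfolding X5_def by (rule s2.op_table_triple) simp
  have 9: "triple B G0 (M X5 []) (merge_vars \<zero> (Var 2)) (M X5 mv)
      (300 * ((length vs1 + 1) * 1) + 400 * ((length vs2 + 1) * 1))"
    by (rule merge_vars_triple) (rule X5_flag)
  show ?thesis unfolding tables_def table_time_def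
    by (intro S[OF 1] S[OF 2] S[OF 3] S[OF 4] S[OF 5] S[OF 6] S[OF 7] S[OF 8] 9 d writes_tables)
qed

lemma main_triple:
  assumes W: "W = 10 + (\<Sum>i<N. xs ! i + 1)" and N1: "N1 = length (auto_word code qs1 vs1 ts1 i1 f1)"
    and N: "N = N1 + length (auto_word code qs2 vs2 ts2 i2 f2)"
    and E: "edges1 \<subseteq> set qs1 \<times> set qs1" "edges2 \<subseteq> set qs2 \<times> set qs2"
    and B: "OUT + 6 * out_time + 100 \<le> B"
  shows "triple B [] (\<lambda>m. m = (\<lambda>i. if i < N then xs ! i else 0)) main
    (\<lambda>m. m 0 = OUT \<and> m OUT = OUT + 1 + length (writer.final_word W code qs1 vs1 ts1 i1 f1 qs2 vs2 ts2 i2 f2 X5) \<and>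
      (\<forall>i<length (writer.final_word W code qs1 vs1 ts1 i1 f1 qs2 vs2 ts2 i2 f2 X5).
        m (OUT + 1 + i) = writer.final_word W code qs1 vs1 ts1 i1 f1 qs2 vs2 ts2 i2 f2 X5 ! i))
    (500 + 100 * (N + 1) + table_time + 1000 * (out_time + 1))"
proof -
  interpret writer W B N N1 xs code qs1 vs1 ts1 i1 f1 qs2 vs2 ts2 i2 f2 X5 out_time
    by unfold_locales (rule B)
  let ?m = "\<lambda>i. if i < N then xs ! i else 0"
  let ?P = "\<lambda>m. m = ?m"
  let ?Q = "\<lambda>m. m 0 = OUT \<and> m OUT = OUT + 1 + length final_word \<and>
      (\<forall>i<length final_word. m (OUT + 1 + i) = final_word ! i)"
  let ?G3 = "[(3, N), (2, N1)]"
  let ?G4 = "[(4, W), (3, N), (2, N1)]"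
  let ?G6 = "[(6, length mv), (5, OUT), (4, W), (3, N), (2, N1)]"
  have NW: "N < W" using machine_axioms by (simp add: machine_def)
  have NB: "N + 10 < B" using NW W_B W10 by linarith
  have len: "N1 = 5 + length qs1 + length vs1 + 4 * length ts1"
    "N = N1 + (5 + length qs2 + length vs2 + 4 * length ts2)"
    using N1 N by (simp_all add: s1.length_word s2.length_word)
  define I where "I i m \<longleftrightarrow> (\<forall>j. j \<noteq> N \<longrightarrow> m j = ?m j) \<and> m N = 10 + (\<Sum>k<i. xs ! k + 1)" for i m
  have "m = ?m \<Longrightarrow> i < 5 + length qs1 + length vs1 + 4 * length ts1 \<Longrightarrow> m i = auto_word code qs1 vs1 ts1 i1 f1 ! i" for m i
    using s1.seg(2)[of i] len by (simp add: s1.length_word)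
  then have h1: "?m 0 = length qs1" "?m 1 = length vs1" "?m 2 = length ts1"
    using len by (simp_all add: auto_word_def)
  have "m = ?m \<Longrightarrow> i < 5 + length qs2 + length vs2 + 4 * length ts2 \<Longrightarrow> m (N1 + i) = auto_word code qs2 vs2 ts2 i2 f2 ! i" for m i
    using s2.seg(2)[of i] len by (simp add: s2.length_word)
  from this[OF refl, of 0] this[OF refl, of 1] this[OF refl, of 2]
  have h2: "?m N1 = length qs2" "?m (N1 + 1) = length vs2" "?m (N1 + 2) = length ts2"
    using len by (simp_all add: auto_word_def)
  have lenE: "ev lengthE (f, m) = 5 + length qs + length vs + 4 * length ts \<and> esafe B lengthE (f, m)"
    if "m (f 2) = length qs" "m (f 2 + 1) = length vs" "m (f 2 + 2) = length ts"
      "f 2 + 5 + length qs + length vs + 4 * length ts \<le> N"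
    for f m and qs vs :: "nat list" and ts :: "'a transition list"
  proof -
    have b: "f 2 + 5 + length qs + length vs + 4 * length ts + 5 < B" using that(4) NB by linarith
    have e: "ev (headE (Var 2) 0) (f, m) = length qs" "ev (headE (Var 2) 1) (f, m) = length vs"
      "ev (headE (Var 2) 2) (f, m) = length ts" "esafe B (headE (Var 2) 0) (f, m)"
      "esafe B (headE (Var 2) 1) (f, m)" "esafe B (headE (Var 2) 2) (f, m)"
      using that(1-3) b by (simp_all add: headE_def)
    show ?thesis using e b by (simp add: lengthE_def)
  qed
  \<comment> \<open>Only cell \<open>N\<close> has been written so far, and table addresses have a
    nonzero tag, hence are at least \<open>W\<close>, which exceeds \<open>N\<close>. So all tables
    still read zero.\<close>
  have I_M: "M {} [] m" if "I N m" for m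
  proof -
    have e: "enc W t a b c d 0 \<noteq> N \<and> \<not> enc W t a b c d 0 < N" if "0 < t" for t a b c d
      using enc_ge[OF that W10(2), of a b c d 0] NW by linarith
    have "m (enc W t a b c d 0) = 0" if "0 < t" for t a b c d
      using \<open>I N m\<close> e[OF that, of a b c d] unfolding I_def by simp
    then show ?thesis using that W10 by (auto simp: M_def I_def)
  qed
  have w: "triple B ?G3 ?P word_base (I N) (10 + 50 * ((N + 1) * 1))"
    unfolding word_base_def
  proof (rule triple_Seq[OF _ _ _ order_refl])
    show "triple B ?G3 ?P (Write (Var 3) (Num 10)) (I 0) 10"
      by (rule triple_Write) (use NB in \<open>simp_all add: I_def\<close>)
    show "triple B ?G3 (I 0) (For 10 11 \<zero> (Var 3) (Write (Var 3) (Plus (Deref (Var 3)) (Plus (Deref (Var 10)) (Num 1)))))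
        (I N) (50 * ((N + 1) * 1))"
    proof (rule triple_For[where I = I and K = 20])
      fix i assume i: "0 \<le> i" "i < N"
      \<comment> \<open>Partial sums are bounded by the final base, so the accumulation cannot
        overflow.\<close>
      have "(\<Sum>k<Suc i. xs ! k + 1) \<le> (\<Sum>k<N. xs ! k + 1)" using i by (intro sum_mono2) auto
      then have "10 + (\<Sum>k<i. xs ! k + 1) + (xs ! i + 1) \<le> W" unfolding W by simp
      moreover have "W < B" using W_B W10 by linarith
      ultimately have b: "10 + (\<Sum>k<i. xs ! k + 1) + (xs ! i + 1) < B" by linarith
      show "triple B ((10, i) # ?G3) (I i) (Write (Var 3) (Plus (Deref (Var 3)) (Plus (Deref (Var 10)) (Num 1)))) (I (Suc i)) (20 * 1)"
      proof (rule triple_Write)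
        fix f m assume *: "agree ((10, i) # ?G3) f" "I i m"
        have e: "m N = 10 + (\<Sum>k<i. xs ! k + 1)" "m i = xs ! i" using * i by (simp_all add: I_def)
        have "I (Suc i) (m(N := m N + (m i + 1)))" using * i e by (simp add: I_def)
        then show "esafe B (Var 3) (f, m) \<and> esafe B (Plus (Deref (Var 3)) (Plus (Deref (Var 10)) (Num 1))) (f, m) \<and>
            I (Suc i) (m(ev (Var 3) (f, m) := ev (Plus (Deref (Var 3)) (Plus (Deref (Var 10)) (Num 1))) (f, m)))"
          using * e b NB by simp
      qed simp
    qed (use NB in simp_all)
  qed simp_all
  have t: "triple B ?G4 (I N) tables (M X5 mv) table_time"
    by (rule triple_conseq[OF triple_weaken[OF tables_triple[OF E]]]) (use I_M in auto)
  have o: "triple B ?G6 (M X5 mv) write_output ?Q (1000 * (out_time + 1))"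
    unfolding write_output_def by (rule triple_weaken[OF output_triple[OF order_refl]]) auto
  have 56: "triple B ?G4 (M X5 mv)
      (Assign 5 (encE (Num 9) \<zero> \<zero> \<zero> \<zero> \<zero>) ;; Assign 6 (Deref (cellE 8 \<zero> \<zero> \<zero> \<zero>)) ;; write_output) ?Q
      (100 + 1000 * (out_time + 1))"
  proof (rule triple_Assign[where x = OUT and T' = "50 + 1000 * (out_time + 1)"])
    fix f m assume *: "agree ?G4 f" "M X5 mv m"
    have "esafe B (encE (Num 9) \<zero> \<zero> \<zero> \<zero> \<zero>) (f, m)"
      by (rule esafe_enc) (use * W_consts(1,6,12) W_B in simp_all)
    then show "esafe B (encE (Num 9) \<zero> \<zero> \<zero> \<zero> \<zero>) (f, m) \<and> ev (encE (Num 9) \<zero> \<zero> \<zero> \<zero> \<zero>) (f, m) = OUT"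
      using * by (simp add: OUT_def)
  next
    show "triple B ((5, OUT) # ?G4) (M X5 mv) (Assign 6 (Deref (cellE 8 \<zero> \<zero> \<zero> \<zero>)) ;; write_output) ?Q
        (50 + 1000 * (out_time + 1))"
    proof (rule triple_Assign[OF _ o])
      fix f m assume *: "agree ((5, OUT) # ?G4) f" "M X5 mv m"
      have "esafe B (cellE 8 \<zero> \<zero> \<zero> \<zero>) (f, m)"
        by (rule esafe_cellE) (use * W_consts(1,6) in simp_all)
      then show "esafe B (Deref (cellE 8 \<zero> \<zero> \<zero> \<zero>)) (f, m) \<and> ev (Deref (cellE 8 \<zero> \<zero> \<zero> \<zero>)) (f, m) = length mv"
        using * by (simp add: M_def)
    qed simp_all
  qed simp_all
  have 4: "triple B ?G3 (I N) (Assign 4 (Deref (Var 3)) ;; tables ;;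
      Assign 5 (encE (Num 9) \<zero> \<zero> \<zero> \<zero> \<zero>) ;; Assign 6 (Deref (cellE 8 \<zero> \<zero> \<zero> \<zero>)) ;; write_output) ?Q
      (10 + (table_time + (100 + 1000 * (out_time + 1))))"
  proof (rule triple_Assign[OF _ triple_Seq[OF t 56 _ order_refl]])
    fix f m assume *: "agree ?G3 f" "I N m"
    then show "esafe B (Deref (Var 3)) (f, m) \<and> ev (Deref (Var 3)) (f, m) = W"
      using W by (simp add: I_def)
  next
    have "writes tables \<subseteq> {10..19}" using writes_tables unfolding tables_def by simp
    then show "fst ` set ?G4 \<inter> writes tables = {}" by auto
  qed simp_all
  have 3: "triple B [(2, N1)] ?P (Assign 3 (Plus (Var 2) lengthE) ;; word_base ;; Assign 4 (Deref (Var 3)) ;; tables ;;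
      Assign 5 (encE (Num 9) \<zero> \<zero> \<zero> \<zero> \<zero>) ;; Assign 6 (Deref (cellE 8 \<zero> \<zero> \<zero> \<zero>)) ;; write_output) ?Q
      (100 + (10 + 50 * ((N + 1) * 1) + (10 + (table_time + (100 + 1000 * (out_time + 1))))))"
  proof (rule triple_Assign[OF _ triple_Seq[OF w 4 _ order_refl]])
    fix f m assume *: "agree [(2, N1)] f" "?P m"
    then show "esafe B (Plus (Var 2) lengthE) (f, m) \<and> ev (Plus (Var 2) lengthE) (f, m) = N"
      using lenE[of m f qs2 vs2 ts2] h2 len NB by simp
  qed (simp_all add: word_base_def lengthE_def)
  have "triple B [] ?P main ?Q
      (200 + (100 + (10 + 50 * ((N + 1) * 1) + (10 + (table_time + (100 + 1000 * (out_time + 1)))))))"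
    \<comment> \<open>Register 2 is assigned twice, which \<open>triple_Assign\<close> excludes, so
      these two assignments are evaluated directly.\<close>
    unfolding triple_def
  proof (intro allI impI)
    fix f m assume *: "agree [] f" "?P m"
    let ?c = "Assign 3 (Plus (Var 2) lengthE) ;; word_base ;; Assign 4 (Deref (Var 3)) ;; tables ;;
      Assign 5 (encE (Num 9) \<zero> \<zero> \<zero> \<zero> \<zero>) ;; Assign 6 (Deref (cellE 8 \<zero> \<zero> \<zero> \<zero>)) ;; write_output"
    let ?T = "100 + (10 + 50 * ((N + 1) * 1) + (10 + (table_time + (100 + 1000 * (out_time + 1)))))"
    have l: "ev lengthE (f(2 := 0), m) = N1 \<and> esafe B lengthE (f(2 := 0), m)"
    proof -
      have "m 0 = length qs1" "m 1 = length vs1" "m 2 = length ts1"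
        using h1 unfolding *(2) .
      then have "ev lengthE (f(2 := 0), m) = 5 + length qs1 + length vs1 + 4 * length ts1 \<and>
          esafe B lengthE (f(2 := 0), m)"
        using len by (intro lenE) (simp_all only: fun_upd_same add_0)
      then show ?thesis using len(1) by simp
    qed
    define c where "c = ?c"
    have main: "main = (Assign 2 \<zero> ;; Assign 2 lengthE ;; c)" by (simp add: main_def c_def)
    have "safe B c (f(2 := N1), m) \<and> cost c (f(2 := N1), m) \<le> ?T \<and> ?Q (snd (run c (f(2 := N1), m)))"
      using 3 *(2) unfolding triple_def c_def by simp
    moreover have "ecost lengthE \<le> 100" by (simp add: lengthE_def)
    ultimately show "safe B main (f, m) \<and> cost main (f, m) \<le> 200 + ?T \<and> ?Q (snd (run main (f, m)))"
      unfolding main using l W_consts(6) by simp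
  qed
  then show ?thesis by (rule triple_conseq) simp_all
qed

end

section \<open>Correctness of the output\<close>

lemma distinct_concat_map:
  assumes "distinct zs" "\<And>z. z \<in> set zs \<Longrightarrow> distinct (F z)"
    and "\<And>z z' w. z \<in> set zs \<Longrightarrow> z' \<in> set zs \<Longrightarrow> w \<in> set (F z) \<Longrightarrow> w \<in> set (F z') \<Longrightarrow> z = z'"
  shows "distinct (concat (map F zs))"
  using assms
proof (induction zs)
  case (Cons z zs)
  have "distinct (concat (map F zs))" using Cons.prems by (intro Cons.IH) auto
  moreover have "set (F z) \<inter> set (concat (map F zs)) = {}"
    using Cons.prems(1) Cons.prems(3)[of z] by fastforce
  ultimately show ?case using Cons.prems(2) by simp
qed simp

lemma concat_map_product:
  "concat (map F (List.product as bs)) = concat (map (\<lambda>a. concat (map (\<lambda>b. F (a, b)) bs)) as)"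
  by (induction as) (auto simp: o_def)

lemma kind_simps [simp]: "kind None = 0" "kind (Some (Letter a)) = 1" "kind (Some (Open x)) = 2" "kind (Some (Close x)) = 3"
  by (simp_all add: kind_def)

lemma arg_simps [simp]: "arg code (Some (Letter a)) = code a" "arg code (Some (Open x)) = x" "arg code (Some (Close x)) = x"
  by (simp_all add: arg_def)

lemma kind_1_iff: "kind l = 1 \<longleftrightarrow> (\<exists>a. l = Some (Letter a))"
  by (auto simp: kind_def split: option.splits symbol.splits)

lemma letters_iff:
  assumes "inj code"
  shows "kind l = 1 \<and> kind l' = 1 \<and> arg code l = arg code l' \<longleftrightarrow> (\<exists>a. l = Some (Letter a) \<and> l' = Some (Letter a))"
  unfolding kind_1_iff using assms by (auto simp: inj_def)

lemma clr_Nil_eps_steps: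
  assumes "path A p r q" "clr r = []"
  shows "(p, q) \<in> {(p, q). \<exists>l. q \<in> delta A p l \<and> kind l \<noteq> 1}\<^sup>*"
  using assms
proof (induction rule: path.induct)
  case (path_eps q p r q')
  have "(p, q) \<in> {(p, q). \<exists>l. q \<in> delta A p l \<and> kind l \<noteq> 1}"
    using path_eps.hyps(1) by (auto intro!: exI[of _ None])
  then show ?case using path_eps by (meson converse_rtrancl_into_rtrancl)
next
  case (path_symbol q p y r q')
  then have "clr r = []" "kind (Some y) \<noteq> 1" by (cases y; simp)+
  then show ?case using path_symbol by (auto intro: converse_rtrancl_into_rtrancl)
qed simp

lemma eps_steps_clr_Nil:
  assumes "(p, q) \<in> {(p, q). \<exists>l. q \<in> delta A p l \<and> kind l \<noteq> 1}\<^sup>*"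
  shows "eps_reach A p q"
  using assms
proof (induction rule: converse_rtrancl_induct)
  case base
  show ?case using path_Nil by (auto simp: eps_reach_def intro!: exI[of _ "[]"])
next
  case (step p p')
  then obtain l r where l: "p' \<in> delta A p l" "kind l \<noteq> 1" "path A p' r q" "clr r = []"
    by (auto simp: eps_reach_def)
  show ?case
  proof (cases l)
    case None
    then have "path A p r q" using l by (auto intro: path_eps)
    then show ?thesis using l by (auto simp: eps_reach_def)
  next
    case (Some y)
    then have "path A p (y # r) q" using l by (auto intro: path_symbol)
    moreover have "clr (y # r) = []" using l Some by (cases y) auto
    ultimately show ?thesis unfolding eps_reach_def by blast
  qed
qed

text \<open>\<open>E\<close> extends the non-letter step relation by identity pairs only, so both
  have the same reflexive transitive closure.\<close>

lemma close_under_eps_reach: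
  assumes A: "vset_automaton A" and qs: "set qs = states A" and ts: "set ts = {(p, l, q). q \<in> delta A p l}"
  defines "E \<equiv> Id_on (set qs) \<union> {(p, q) |p l q. (p, l, q) \<in> set ts \<and> kind l \<noteq> 1}"
  shows "E \<subseteq> set qs \<times> set qs"
    and "(p, q) \<in> close_under (set qs) E qs \<longleftrightarrow> p \<in> states A \<and> q \<in> states A \<and> eps_reach A p q"
proof -
  let ?S = "{(p, q). \<exists>l. q \<in> delta A p l \<and> kind l \<noteq> 1}"
  show E: "E \<subseteq> set qs \<times> set qs"
    using A by (auto simp: E_def qs ts vset_automaton_def)
  have "E = Id_on (set qs) \<union> ?S" by (auto simp: E_def ts)
  then have "?S \<subseteq> E" "E \<subseteq> ?S\<^sup>*" by auto
  then have "E\<^sup>* = ?S\<^sup>*" by (rule rtrancl_subset)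
  moreover have "(p, q) \<in> ?S\<^sup>* \<longleftrightarrow> eps_reach A p q"
    using clr_Nil_eps_steps[of A p _ q] eps_steps_clr_Nil[of p q A] unfolding eps_reach_def by blast
  ultimately show "(p, q) \<in> close_under (set qs) E qs \<longleftrightarrow> p \<in> states A \<and> q \<in> states A \<and> eps_reach A p q"
    using close_under_eq[OF E] by (auto simp: E_def qs)
qed

text \<open>Justifies \<open>op_table\<close>: cut a letterless path at an occurrence of
  \<open>y\<close>, or join two letterless paths by a transition on \<open>y\<close>.\<close>

lemma eps_op_iff:
  assumes y: "y = Open x \<or> y = Close x"
  shows "eps_op A y p q \<longleftrightarrow> (\<exists>a b. b \<in> delta A a (Some y) \<and> eps_reach A p a \<and> eps_reach A b q)"
proof
  assume "eps_op A y p q"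
  then obtain r where r: "path A p r q" "clr r = []" "y \<in> set r" by (auto simp: eps_op_def)
  from split_list[OF r(3)] obtain r1 r2 where s: "r = r1 @ y # r2" by blast
  from r(1)[unfolded s] obtain a b where ab: "path A p r1 a" "b \<in> delta A a (Some y)" "path A b r2 q"
    by (rule path_letter_split)
  have "clr (y # r2) = clr r2" using y by auto
  then have "clr r1 = []" "clr r2 = []" using r(2) s by simp_all
  then show "\<exists>a b. b \<in> delta A a (Some y) \<and> eps_reach A p a \<and> eps_reach A b q"
    using ab unfolding eps_reach_def by blast
next
  assume "\<exists>a b. b \<in> delta A a (Some y) \<and> eps_reach A p a \<and> eps_reach A b q"
  then obtain a b r1 r2 where ab: "b \<in> delta A a (Some y)" "path A p r1 a" "clr r1 = []" "path A b r2 q" "clr r2 = []"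
    by (auto simp: eps_reach_def)
  have "path A p (r1 @ y # r2) q" by (rule path_append[OF ab(2) path_symbol[OF ab(1,4)]])
  moreover have "clr (y # r2) = clr r2" using y by auto
  ultimately show "eps_op A y p q" using ab(3,5) unfolding eps_op_def
    by (intro exI[of _ "r1 @ y # r2"]) simp
qed

fun name :: "nat \<Rightarrow> (nat, nat) jstate \<Rightarrow> nat" where
  "name W (Base p1 p2) = enc W 0 p1 p2 0 0 0"
| "name W (Link p1 p2 q1 q2 i) = enc W 1 p1 p2 q1 q2 i"

locale two_encodings = two_segments W B N N1 xs code qs1 vs1 ts1 i1 f1 qs2 vs2 ts2 i2 f2
  for W B N N1 :: nat and xs :: "nat list" and code :: "'a \<Rightarrow> nat"
    and qs1 vs1 ts1 i1 f1 qs2 vs2 ts2 i2 f2 +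
  fixes A1 A2 :: "('a, nat, nat) vset_automaton"
  assumes inj: "inj code"
    and A1: "vset_automaton A1" "functional A1" and A2: "vset_automaton A2" "functional A2"
    and l1: "distinct qs1" "set qs1 = states A1" "distinct vs1" "set vs1 = vars A1" "distinct ts1"
      "set ts1 = {(p, l, q). q \<in> delta A1 p l}" "i1 = initial A1" "f1 = final A1"
    and l2: "distinct qs2" "set qs2 = states A2" "distinct vs2" "set vs2 = vars A2" "distinct ts2"
      "set ts2 = {(p, l, q). q \<in> delta A2 p l}" "i2 = initial A2" "f2 = final A2"
    and room: "OUT + 6 * out_time + 100 \<le> B"
begin

lemma distinct_mv: "distinct mv" and set_mv: "set mv = vars A1 \<union> vars A2"
  using l1 l2 by (auto simp: mv_def)

sublocale two_automata A1 A2 mv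
  by unfold_locales (use A1 A2 distinct_mv set_mv in auto)

sublocale writer W B N N1 xs code qs1 vs1 ts1 i1 f1 qs2 vs2 ts2 i2 f2 X5 out_time
  by unfold_locales (rule room)

lemma X5_conn: "(3, p, q, 0, 0) \<in> X5 \<longleftrightarrow> p \<in> states A1 \<and> q \<in> states A1 \<and> eps_reach A1 p q"
  "(4, p, q, 0, 0) \<in> X5 \<longleftrightarrow> p \<in> states A2 \<and> q \<in> states A2 \<and> eps_reach A2 p q"
  unfolding X5_pair edges1_def edges2_def
  by (rule close_under_eps_reach(2)[OF A1(1) l1(2,6)] close_under_eps_reach(2)[OF A2(1) l2(2,6)])+

lemma edges_subset: "edges1 \<subseteq> set qs1 \<times> set qs1" "edges2 \<subseteq> set qs2 \<times> set qs2"
  unfolding edges1_def edges2_def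
  by (rule close_under_eps_reach(1)[OF A1(1) l1(2,6)] close_under_eps_reach(1)[OF A2(1) l2(2,6)])+

text \<open>Kind and argument determine a label that is an operation, so a mark stems from a
  transition on precisely this operation; the rest is \<open>eps_op_iff\<close>.\<close>

lemma X5_eps_op:
  fixes op :: "nat \<Rightarrow> ('a, nat) symbol"
  assumes op: "op = Open \<or> op = Close"
  shows "p \<in> states A1 \<Longrightarrow> q \<in> states A1 \<Longrightarrow> (5, kind (Some (op x)), x, p, q) \<in> X5 \<longleftrightarrow> eps_op A1 (op x) p q"
    and "p \<in> states A2 \<Longrightarrow> q \<in> states A2 \<Longrightarrow> (6, kind (Some (op x)), x, p, q) \<in> X5 \<longleftrightarrow> eps_op A2 (op x) p q"
proof -
  have l: "kind (Some (op x)) = kind l \<and> x = arg code l \<and> 2 \<le> kind l \<longleftrightarrow> l = Some (op x)" for l :: "('a, nat) symbol option"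
    using op by (auto simp: kind_def arg_def split: option.splits symbol.splits)
  have y: "op x = Open x \<or> op x = Close x" using op by auto
  have c: "(p, q) \<in> close_under (set qs1) edges1 qs1 \<longleftrightarrow> p \<in> states A1 \<and> q \<in> states A1 \<and> eps_reach A1 p q"
    "(p, q) \<in> close_under (set qs2) edges2 qs2 \<longleftrightarrow> p \<in> states A2 \<and> q \<in> states A2 \<and> eps_reach A2 p q" for p q
    using X5_conn[of p q] X5_pair[of p q] by simp_all
  have s1: "b \<in> delta A1 a l \<Longrightarrow> a \<in> states A1 \<and> b \<in> states A1" for a l b
    using A1(1) by (auto simp: vset_automaton_def)
  have s2: "b \<in> delta A2 a l \<Longrightarrow> a \<in> states A2 \<and> b \<in> states A2" for a l b
    using A2(1) by (auto simp: vset_automaton_def)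
  show "(5, kind (Some (op x)), x, p, q) \<in> X5 \<longleftrightarrow> eps_op A1 (op x) p q" if "p \<in> states A1" "q \<in> states A1"
  proof
    assume "(5, kind (Some (op x)), x, p, q) \<in> X5"
    then obtain a l' b where t: "(a, l', b) \<in> set ts1"
      and k: "kind (Some (op x)) = kind l' \<and> x = arg code l' \<and> 2 \<le> kind l'"
      and r: "eps_reach A1 p a" "eps_reach A1 b q"
      unfolding X5_op c by blast
    have "l' = Some (op x)" by (rule iffD1[OF l k])
    then have "b \<in> delta A1 a (Some (op x))" using t by (simp add: l1(6))
    note this r
    then show "eps_op A1 (op x) p q" unfolding eps_op_iff[OF y] by blast
  next
    assume "eps_op A1 (op x) p q"
    then obtain a b where ab: "b \<in> delta A1 a (Some (op x))" "eps_reach A1 p a" "eps_reach A1 b q"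
      unfolding eps_op_iff[OF y] by blast
    then have "(a, Some (op x), b) \<in> set ts1" by (simp add: l1(6))
    then show "(5, kind (Some (op x)), x, p, q) \<in> X5"
      unfolding X5_op c using ab that s1[OF ab(1)] l[of "Some (op x)"] l1(2)
      by (intro exI[of _ a] exI[of _ "Some (op x)"] exI[of _ b]) simp
  qed
  show "(6, kind (Some (op x)), x, p, q) \<in> X5 \<longleftrightarrow> eps_op A2 (op x) p q" if "p \<in> states A2" "q \<in> states A2"
  proof
    assume "(6, kind (Some (op x)), x, p, q) \<in> X5"
    then obtain a l' b where t: "(a, l', b) \<in> set ts2"
      and k: "kind (Some (op x)) = kind l' \<and> x = arg code l' \<and> 2 \<le> kind l'"
      and r: "eps_reach A2 p a" "eps_reach A2 b q"
      unfolding X5_op c by blast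
    have "l' = Some (op x)" by (rule iffD1[OF l k])
    then have "b \<in> delta A2 a (Some (op x))" using t by (simp add: l2(6))
    note this r
    then show "eps_op A2 (op x) p q" unfolding eps_op_iff[OF y] by blast
  next
    assume "eps_op A2 (op x) p q"
    then obtain a b where ab: "b \<in> delta A2 a (Some (op x))" "eps_reach A2 p a" "eps_reach A2 b q"
      unfolding eps_op_iff[OF y] by blast
    then have "(a, Some (op x), b) \<in> set ts2" by (simp add: l2(6))
    then show "(6, kind (Some (op x)), x, p, q) \<in> X5"
      unfolding X5_op c using ab that s2[OF ab(1)] l[of "Some (op x)"] l2(2)
      by (intro exI[of _ a] exI[of _ "Some (op x)"] exI[of _ b]) simp
  qed
qed

section \<open>The emitted lists over structured states, and their agreement with the join
  automaton\<close>

definition states_abs :: "(nat, nat) jstate list" where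
  "states_abs = concat (map (\<lambda>p1. concat (map (\<lambda>p2. [Base p1 p2]) qs2)) qs1) @
    concat (map (\<lambda>p1. concat (map (\<lambda>p2. concat (map (\<lambda>q1. concat (map (\<lambda>q2.
      concat (map (\<lambda>i. [Link p1 p2 q1 q2 i]) [0..<2 * length mv + 1])) qs2)) qs1)) qs2)) qs1)"

lemma length_ys: "length ys = 2 * length mv"
  by (simp add: ys_def)

lemma states_list_abs: "states_list = map (name W) states_abs"
  by (simp add: states_list_def states_abs_def map_concat o_def del: upt_Suc)

lemma set_states_abs: "set states_abs = jstates A1 A2 (length ys)"
proof (rule set_eqI)
  fix u show "u \<in> set states_abs \<longleftrightarrow> u \<in> jstates A1 A2 (length ys)"
    by (cases u) (auto simp: states_abs_def jstates_def length_ys l1 l2 image_iff simp del: upt_Suc)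
qed

lemma distinct_states_abs: "distinct states_abs"
proof -
  have eq: "states_abs = map (\<lambda>(p1, p2). Base p1 p2) (List.product qs1 qs2) @
      map (\<lambda>(p1, p2, q1, q2, i). Link p1 p2 q1 q2 i)
        (List.product qs1 (List.product qs2 (List.product qs1 (List.product qs2 [0..<2 * length mv + 1]))))"
    by (simp add: states_abs_def product_concat_map map_concat o_def del: upt_Suc)
  show ?thesis
    unfolding eq distinct_append distinct_map
    by (intro conjI distinct_product l1(1) l2(1) distinct_upt) (auto simp: inj_on_def)
qed

lemma inj_name: "inj_on (name W) (jstates A1 A2 (length ys))"
proof (rule inj_onI)
  fix u w assume u: "u \<in> jstates A1 A2 (length ys)" and w: "w \<in> jstates A1 A2 (length ys)" and e: "name W u = name W w"
  have s: "p \<in> states A1 \<Longrightarrow> p < W" "p \<in> states A2 \<Longrightarrow> p < W" for p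
    using s1.qs_less s2.qs_less l1(2) l2(2) by auto
  have ib: "i \<le> length ys \<Longrightarrow> i < W" for i using W_consts(18) by (simp add: length_ys)
  show "u = w"
  proof (cases u)
    case u': (Base p1 p2)
    then have b: "p1 < W" "p2 < W" using u s by (auto simp: jstates_def)
    show ?thesis
    proof (cases w)
      case w': (Base p1' p2')
      then have "p1' < W" "p2' < W" using w s by (auto simp: jstates_def)
      then show ?thesis using e b W10(2) by (simp add: u' w' enc_eq_iff)
    next
      case w': (Link p1' p2' q1' q2' i')
      then have "p1' < W" "p2' < W" "q1' < W" "q2' < W" "i' < W" using w s ib by (auto simp: jstates_def)
      then show ?thesis using e b W10(2) by (simp add: u' w' enc_eq_iff)
    qed
  next
    case u': (Link p1 p2 q1 q2 i)
    then have b: "p1 < W" "p2 < W" "q1 < W" "q2 < W" "i < W" using u s ib by (auto simp: jstates_def)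
    show ?thesis
    proof (cases w)
      case w': (Base p1' p2')
      then have "p1' < W" "p2' < W" using w s by (auto simp: jstates_def)
      then show ?thesis using e b W10(2) by (simp add: u' w' enc_eq_iff)
    next
      case w': (Link p1' p2' q1' q2' i')
      then have "p1' < W" "p2' < W" "q1' < W" "q2' < W" "i' < W" using w s ib by (auto simp: jstates_def)
      then show ?thesis using e b W10(2) by (simp add: u' w' enc_eq_iff)
    qed
  qed
qed

definition name_trans ::
    "(nat, nat) jstate \<times> ('a, nat) symbol option \<times> (nat, nat) jstate \<Rightarrow> 'a transition" where
  "name_trans = (\<lambda>(u, l, w). (name W u, l, name W w))"

definition letter_abs ::
    "'a transition \<Rightarrow> 'a transition \<Rightarrow> ((nat, nat) jstate \<times> ('a, nat) symbol option \<times> (nat, nat) jstate) list" where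
  "letter_abs t1 t2 = (if kind (fst (snd t2)) = 1 then
      if arg code (fst (snd t1)) = arg code (fst (snd t2)) then
        [(Base (fst t1) (fst t2), fst (snd t1), Base (snd (snd t1)) (snd (snd t2)))]
      else []
    else [])"

definition letters_abs :: "((nat, nat) jstate \<times> ('a, nat) symbol option \<times> (nat, nat) jstate) list" where
  "letters_abs = concat (map (\<lambda>t1. if kind (fst (snd t1)) = 1 then concat (map (letter_abs t1) ts2) else []) ts1)"

definition link_abs ::
    "nat \<Rightarrow> nat \<Rightarrow> nat \<Rightarrow> nat \<Rightarrow> nat \<Rightarrow> ((nat, nat) jstate \<times> ('a, nat) symbol option \<times> (nat, nat) jstate) list" where
  "link_abs p1 p2 q1 q2 i = (if consistent A1 A2 p1 p2 q1 q2 (ys ! i) then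
      [(Link p1 p2 q1 q2 i, if either A1 A2 p1 p2 q1 q2 (ys ! i) then Some (ys ! i) else None, Link p1 p2 q1 q2 (Suc i))]
    else [])"

definition chain_abs ::
    "nat \<Rightarrow> nat \<Rightarrow> nat \<Rightarrow> nat \<Rightarrow> ((nat, nat) jstate \<times> ('a, nat) symbol option \<times> (nat, nat) jstate) list" where
  "chain_abs p1 p2 q1 q2 = (if connected A1 A2 p1 p2 q1 q2 then
      [(Base p1 p2, None, Link p1 p2 q1 q2 0)] @ concat (map (link_abs p1 p2 q1 q2) [0..<length ys]) @
      [(Link p1 p2 q1 q2 (length ys), None, Base q1 q2)]
    else [])"

definition chains_abs :: "((nat, nat) jstate \<times> ('a, nat) symbol option \<times> (nat, nat) jstate) list" where
  "chains_abs = concat (map (\<lambda>p1. concat (map (\<lambda>p2. concat (map (\<lambda>q1. concat (map (\<lambda>q2.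
    chain_abs p1 p2 q1 q2) qs2)) qs1)) qs2)) qs1)"

lemma letters_list_abs: "letters_list = map name_trans letters_abs"
proof -
  have "letter_trans t1 t2 = map name_trans (letter_abs t1 t2)" for t1 t2
    by (simp add: letter_trans_def letter_abs_def name_trans_def)
  then have "letter_trans t1 = (\<lambda>t2. map name_trans (letter_abs t1 t2))" for t1 by blast
  then show ?thesis
    unfolding letters_list_def letters_abs_def
    by (simp add: map_concat o_def if_distrib[of "map name_trans"] cong: if_cong)
qed

lemma link_trans_abs:
  assumes p: "p1 \<in> states A1" "p2 \<in> states A2" "q1 \<in> states A1" "q2 \<in> states A2"
    and op: "op = Open \<or> op = Close" and y: "ys ! (off + j) = op (mv ! j)"
  shows "link_trans op off p1 p2 q1 q2 j = map name_trans (link_abs p1 p2 q1 q2 (off + j))"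
proof -
  let ?x = "mv ! j"
  have "op ?x \<in> ops V1 \<inter> ops V2 \<longleftrightarrow> ?x \<in> V1 \<and> ?x \<in> V2" using op by (auto simp: ops_def)
  then have "((1, ?x, 0, 0, 0) \<in> X5 \<and> (2, ?x, 0, 0, 0) \<in> X5 \<and> eps_op A1 (op ?x) p1 q1 \<noteq> eps_op A2 (op ?x) p2 q2) \<longleftrightarrow>
      \<not> consistent A1 A2 p1 p2 q1 q2 (op ?x)"
    unfolding X5_flag l1(4) l2(4) consistent_def by blast
  then show ?thesis
    unfolding link_trans_def Let_def X5_eps_op(1)[OF op p(1,3)] X5_eps_op(2)[OF op p(2,4)]
    by (simp add: link_abs_def y either_def name_trans_def)
qed

lemma chain_trans_abs:
  assumes p: "p1 \<in> states A1" "p2 \<in> states A2" "q1 \<in> states A1" "q2 \<in> states A2"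
  shows "chain_trans p1 p2 q1 q2 = map name_trans (chain_abs p1 p2 q1 q2)"
proof -
  let ?n = "length mv"
  have o: "concat (map (link_trans Open 0 p1 p2 q1 q2) [0..<?n]) =
      map name_trans (concat (map (link_abs p1 p2 q1 q2) [0..<?n]))"
    unfolding map_concat map_map o_def
  proof (intro arg_cong[where f = concat] map_cong refl)
    fix j assume "j \<in> set [0..<?n]"
    then have "ys ! (0 + j) = Open (mv ! j)" by (simp add: ys_def nth_append)
    from link_trans_abs[of p1 p2 q1 q2 Open 0 j, OF p _ this]
    show "link_trans Open 0 p1 p2 q1 q2 j = map name_trans (link_abs p1 p2 q1 q2 j)" by simp
  qed
  \<comment> \<open>The second half of \<open>ys\<close> consists of the \<open>Close\<close>
    operations; its indices are those of the first half shifted by the number of variables.\<close>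
  have "[?n..<length ys] = map (\<lambda>j. ?n + j) [0..<?n]"
    by (simp add: length_ys mult_2 map_add_upt[symmetric] add.commute)
  then have "map name_trans (concat (map (link_abs p1 p2 q1 q2) [?n..<length ys])) =
      concat (map (\<lambda>j. map name_trans (link_abs p1 p2 q1 q2 (?n + j))) [0..<?n])"
    by (simp only: map_concat map_map o_def)
  also have "\<dots> = concat (map (link_trans Close ?n p1 p2 q1 q2) [0..<?n])"
  proof (intro arg_cong[where f = concat] map_cong refl)
    fix j assume "j \<in> set [0..<?n]"
    then have "ys ! (?n + j) = Close (mv ! j)" by (simp add: ys_def nth_append)
    from link_trans_abs[of p1 p2 q1 q2 Close ?n j, OF p _ this]
    show "map name_trans (link_abs p1 p2 q1 q2 (?n + j)) = link_trans Close ?n p1 p2 q1 q2 j" by simp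
  qed
  finally have c: "concat (map (link_trans Close ?n p1 p2 q1 q2) [0..<?n]) =
      map name_trans (concat (map (link_abs p1 p2 q1 q2) [?n..<length ys]))" by simp
  have s: "[0..<length ys] = [0..<?n] @ [?n..<length ys]"
    using upt_add_eq_append[of 0 ?n ?n] by (simp add: length_ys mult_2)
  have x: "(if (3, p1, q1, 0, 0) \<in> X5 then if (4, p2, q2, 0, 0) \<in> X5 then r else [] else []) =
      (if connected A1 A2 p1 p2 q1 q2 then r else [])" for r :: "'a transition list"
    using p by (simp add: X5_conn connected_def)
  have "chain_trans p1 p2 q1 q2 = (if connected A1 A2 p1 p2 q1 q2 then
      map name_trans ([(Base p1 p2, None, Link p1 p2 q1 q2 0)] @
        (concat (map (link_abs p1 p2 q1 q2) [0..<?n]) @ concat (map (link_abs p1 p2 q1 q2) [?n..<length ys])) @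
        [(Link p1 p2 q1 q2 (length ys), None, Base q1 q2)]) else [])"
    unfolding chain_trans_def x o c by (simp add: name_trans_def length_ys)
  also have "\<dots> = map name_trans (chain_abs p1 p2 q1 q2)"
    unfolding chain_abs_def s map_append concat_append by simp
  finally show ?thesis .
qed

lemma chains_list_abs: "chains_list = map name_trans chains_abs"
proof -
  have "chains_list = concat (map (\<lambda>p1. concat (map (\<lambda>p2. concat (map (\<lambda>q1. concat (map (\<lambda>q2.
    map name_trans (chain_abs p1 p2 q1 q2)) qs2)) qs1)) qs2)) qs1)"
    unfolding chains_list_def using chain_trans_abs l1(2) l2(2)
    by (intro arg_cong[where f = concat] map_cong refl) auto
  then show ?thesis by (simp add: chains_abs_def map_concat o_def)
qed

lemma set_chain_abs: "(u, l, w) \<in> set (chain_abs p1 p2 q1 q2) \<longleftrightarrow> connected A1 A2 p1 p2 q1 q2 \<and>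
    (u = Base p1 p2 \<and> l = None \<and> w = Link p1 p2 q1 q2 0 \<or>
     (\<exists>i<length ys. consistent A1 A2 p1 p2 q1 q2 (ys ! i) \<and> u = Link p1 p2 q1 q2 i \<and>
        l = (if either A1 A2 p1 p2 q1 q2 (ys ! i) then Some (ys ! i) else None) \<and> w = Link p1 p2 q1 q2 (Suc i)) \<or>
     u = Link p1 p2 q1 q2 (length ys) \<and> l = None \<and> w = Base q1 q2)"
proof -
  have L: "(u, l, w) \<in> set (link_abs p1 p2 q1 q2 i) \<longleftrightarrow> consistent A1 A2 p1 p2 q1 q2 (ys ! i) \<and> u = Link p1 p2 q1 q2 i \<and>
      l = (if either A1 A2 p1 p2 q1 q2 (ys ! i) then Some (ys ! i) else None) \<and> w = Link p1 p2 q1 q2 (Suc i)" for i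
    by (cases "consistent A1 A2 p1 p2 q1 q2 (ys ! i)") (simp_all add: link_abs_def split del: if_split)
  have "(u, l, w) \<in> set (concat (map (link_abs p1 p2 q1 q2) [0..<length ys])) \<longleftrightarrow>
      (\<exists>i<length ys. (u, l, w) \<in> set (link_abs p1 p2 q1 q2 i))"
    by auto
  then show ?thesis
    unfolding chain_abs_def L
    by (cases "connected A1 A2 p1 p2 q1 q2") (simp_all add: disj_commute disj_left_commute split del: if_split)
qed

lemma set_trans_abs: "(u, l, w) \<in> set (letters_abs @ chains_abs) \<longleftrightarrow> jtrans A1 A2 ys u l w"
proof -
  have L: "(u, l, w) \<in> set letters_abs \<longleftrightarrow>
      (\<exists>p1 p2 q1 q2 a. q1 \<in> delta A1 p1 (Some (Letter a)) \<and> q2 \<in> delta A2 p2 (Some (Letter a)) \<and>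
        u = Base p1 p2 \<and> l = Some (Letter a) \<and> w = Base q1 q2)"
  proof -
    have m: "(u, l, w) \<in> set letters_abs \<longleftrightarrow> (\<exists>t1\<in>set ts1. kind (fst (snd t1)) = 1 \<and> (\<exists>t2\<in>set ts2. kind (fst (snd t2)) = 1 \<and>
        arg code (fst (snd t1)) = arg code (fst (snd t2)) \<and> u = Base (fst t1) (fst t2) \<and> l = fst (snd t1) \<and>
        w = Base (snd (snd t1)) (snd (snd t2))))"
      unfolding letters_abs_def letter_abs_def by (auto split: if_splits)
    have "(u, l, w) \<in> set letters_abs \<longleftrightarrow> (\<exists>p1 p2 q1 q2 l2. (p1, l, q1) \<in> set ts1 \<and> (p2, l2, q2) \<in> set ts2 \<and>
        (kind l = 1 \<and> kind l2 = 1 \<and> arg code l = arg code l2) \<and> u = Base p1 p2 \<and> w = Base q1 q2)"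
    proof
      assume "(u, l, w) \<in> set letters_abs"
      then obtain t1 t2 where t: "t1 \<in> set ts1" "t2 \<in> set ts2" "kind (fst (snd t1)) = 1 \<and> kind (fst (snd t2)) = 1 \<and>
          arg code (fst (snd t1)) = arg code (fst (snd t2))" "u = Base (fst t1) (fst t2)" "l = fst (snd t1)"
          "w = Base (snd (snd t1)) (snd (snd t2))"
        unfolding m by blast
      then show "\<exists>p1 p2 q1 q2 l2. (p1, l, q1) \<in> set ts1 \<and> (p2, l2, q2) \<in> set ts2 \<and>
          (kind l = 1 \<and> kind l2 = 1 \<and> arg code l = arg code l2) \<and> u = Base p1 p2 \<and> w = Base q1 q2"
        by (intro exI[of _ "fst t1"] exI[of _ "fst t2"] exI[of _ "snd (snd t1)"] exI[of _ "snd (snd t2)"]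
            exI[of _ "fst (snd t2)"]) simp
    next
      assume "\<exists>p1 p2 q1 q2 l2. (p1, l, q1) \<in> set ts1 \<and> (p2, l2, q2) \<in> set ts2 \<and>
          (kind l = 1 \<and> kind l2 = 1 \<and> arg code l = arg code l2) \<and> u = Base p1 p2 \<and> w = Base q1 q2"
      then obtain p1 p2 q1 q2 l2 where "(p1, l, q1) \<in> set ts1" "(p2, l2, q2) \<in> set ts2"
          "kind l = 1" "kind l2 = 1" "arg code l = arg code l2" "u = Base p1 p2" "w = Base q1 q2" by blast
      then show "(u, l, w) \<in> set letters_abs"
        unfolding m by (intro bexI[of _ "(p1, l, q1)"] conjI bexI[of _ "(p2, l2, q2)"]) simp_all
    qed
    then show ?thesis unfolding letters_iff[OF inj] l1(6) l2(6) by blast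
  qed
  have C: "(u, l, w) \<in> set chains_abs \<longleftrightarrow> (\<exists>p1 p2 q1 q2. (u, l, w) \<in> set (chain_abs p1 p2 q1 q2))"
  proof -
    have "(u, l, w) \<in> set (chain_abs p1 p2 q1 q2) \<Longrightarrow> p1 \<in> set qs1 \<and> p2 \<in> set qs2 \<and> q1 \<in> set qs1 \<and> q2 \<in> set qs2" for p1 p2 q1 q2
      unfolding set_chain_abs l1(2) l2(2) connected_def by blast
    moreover have "(u, l, w) \<in> set chains_abs \<longleftrightarrow> (\<exists>p1\<in>set qs1. \<exists>p2\<in>set qs2. \<exists>q1\<in>set qs1. \<exists>q2\<in>set qs2.
        (u, l, w) \<in> set (chain_abs p1 p2 q1 q2))"
      by (simp add: chains_abs_def)
    ultimately show ?thesis by blast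
  qed
  show ?thesis
  proof
    assume "(u, l, w) \<in> set (letters_abs @ chains_abs)"
    then consider "(u, l, w) \<in> set letters_abs" | p1 p2 q1 q2 where "(u, l, w) \<in> set (chain_abs p1 p2 q1 q2)"
      unfolding set_append Un_iff C by blast
    then show "jtrans A1 A2 ys u l w"
    proof cases
      case 1
      then show ?thesis unfolding L by (elim exE conjE) (simp add: jtrans.letter)
    next
      case 2
      from 2[unfolded set_chain_abs] show ?thesis
      proof (elim conjE disjE exE)
        assume c: "connected A1 A2 p1 p2 q1 q2"
        show "u = Base p1 p2 \<Longrightarrow> l = None \<Longrightarrow> w = Link p1 p2 q1 q2 0 \<Longrightarrow> ?thesis"
          using jtrans.enter[OF c] by simp
        show "u = Link p1 p2 q1 q2 (length ys) \<Longrightarrow> l = None \<Longrightarrow> w = Base q1 q2 \<Longrightarrow> ?thesis"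
          using jtrans.leave[OF c] by simp
        show "i < length ys \<Longrightarrow> consistent A1 A2 p1 p2 q1 q2 (ys ! i) \<Longrightarrow> u = Link p1 p2 q1 q2 i \<Longrightarrow>
            l = (if either A1 A2 p1 p2 q1 q2 (ys ! i) then Some (ys ! i) else None) \<Longrightarrow> w = Link p1 p2 q1 q2 (Suc i) \<Longrightarrow> ?thesis" for i
          using jtrans.link[OF c] by simp
      qed
    qed
  next
    assume "jtrans A1 A2 ys u l w"
    then have "(u, l, w) \<in> set letters_abs \<or> (\<exists>p1 p2 q1 q2. (u, l, w) \<in> set (chain_abs p1 p2 q1 q2))"
    proof cases
      case (letter q1 p1 a q2 p2)
      then show ?thesis unfolding L by blast
    next
      case (enter p1 p2 q1 q2)
      then have "(u, l, w) \<in> set (chain_abs p1 p2 q1 q2)" unfolding set_chain_abs by simp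
      then show ?thesis by blast
    next
      case (link p1 p2 q1 q2 i)
      have "(u, l, w) \<in> set (chain_abs p1 p2 q1 q2)" unfolding set_chain_abs
        by (intro conjI link(4) disjI2 disjI1 exI[of _ i] link)
      then show ?thesis by blast
    next
      case (leave p1 p2 q1 q2)
      then have "(u, l, w) \<in> set (chain_abs p1 p2 q1 q2)" unfolding set_chain_abs by simp
      then show ?thesis by blast
    qed
    then show "(u, l, w) \<in> set (letters_abs @ chains_abs)" unfolding set_append Un_iff C .
  qed
qed

text \<open>The quadruple of a chain can be read off each of its transitions: from the source if
  this is a \<open>Link\<close>, otherwise from the target. The arbitrary \<open>z\<close> fills the
  case of two \<open>Base\<close> states, which does not occur in a chain.\<close>

lemma chain_abs_index:
  "(u, l, w) \<in> set (chain_abs p1 p2 q1 q2) \<Longrightarrow> (case u of Link a b c d i \<Rightarrow> (a, b, c, d)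
    | Base _ _ \<Rightarrow> (case w of Link a b c d i \<Rightarrow> (a, b, c, d) | Base _ _ \<Rightarrow> z)) = (p1, p2, q1, q2)"
  unfolding set_chain_abs by (elim conjE disjE exE) simp_all

lemma chains_abs_product: "chains_abs = concat (map (\<lambda>(p1, p2, q1, q2). chain_abs p1 p2 q1 q2)
    (List.product qs1 (List.product qs2 (List.product qs1 qs2))))"
  by (simp add: chains_abs_def concat_map_product)

text \<open>Letter transitions join two \<open>Base\<close> states, whereas chain transitions always
  touch a \<open>Link\<close>, so the two lists are disjoint. Chains of different quadruples are
  separated by \<open>chain_abs_index\<close>.\<close>

lemma distinct_trans_abs: "distinct (letters_abs @ chains_abs)"
proof -
  have "distinct letters_abs"
    unfolding letters_abs_def
  proof (rule distinct_concat_map[OF l1(5)])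
    fix t1 assume "t1 \<in> set ts1"
    show "distinct (if kind (fst (snd t1)) = 1 then concat (map (letter_abs t1) ts2) else [])"
    proof (cases "kind (fst (snd t1)) = 1")
      case k1: True
      have "distinct (concat (map (letter_abs t1) ts2))"
      proof (rule distinct_concat_map[OF l2(5)])
        fix t2 t2' w assume w: "w \<in> set (letter_abs t1 t2)" "w \<in> set (letter_abs t1 t2')"
        then have "kind (fst (snd t2)) = 1" "kind (fst (snd t2')) = 1"
          "arg code (fst (snd t1)) = arg code (fst (snd t2))" "arg code (fst (snd t1)) = arg code (fst (snd t2'))"
          "fst t2 = fst t2'" "snd (snd t2) = snd (snd t2')"
          by (auto simp: letter_abs_def split: if_splits)
        \<comment> \<open>The labels were compared through their code words; injectivity of
          \<open>code\<close> turns this into equality of letters.\<close>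
        moreover from this k1 have "fst (snd t2) = fst (snd t2')"
          using letters_iff[OF inj, of "fst (snd t1)"] by metis
        ultimately show "t2 = t2'" by (simp add: prod_eq_iff)
      qed (simp add: letter_abs_def)
      then show ?thesis using k1 by simp
    qed simp
  next
    fix t1 t1' w
    assume "w \<in> set (if kind (fst (snd t1)) = 1 then concat (map (letter_abs t1) ts2) else [])"
      "w \<in> set (if kind (fst (snd t1')) = 1 then concat (map (letter_abs t1') ts2) else [])"
    then show "t1 = t1'" by (auto simp: letter_abs_def prod_eq_iff split: if_splits)
  qed
  moreover have "distinct (chain_abs p1 p2 q1 q2)" for p1 p2 q1 q2
  proof -
    have k: "fst w = Link p1 p2 q1 q2 i" if "w \<in> set (link_abs p1 p2 q1 q2 i)" for w i
      using that by (simp add: link_abs_def split: if_split_asm)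
    define L where "L = concat (map (link_abs p1 p2 q1 q2) [0..<length ys])"
    have "distinct L" unfolding L_def
    proof (rule distinct_concat_map[OF distinct_upt])
      fix i i' w assume "w \<in> set (link_abs p1 p2 q1 q2 i)" "w \<in> set (link_abs p1 p2 q1 q2 i')"
      from k[OF this(1)] k[OF this(2)] show "i = i'" by simp
    qed (simp add: link_abs_def)
    moreover have L: "\<exists>i<length ys. fst w = Link p1 p2 q1 q2 i" if "w \<in> set L" for w
    proof -
      from that obtain i where "i < length ys" "w \<in> set (link_abs p1 p2 q1 q2 i)" by (auto simp: L_def)
      then show ?thesis using k by blast
    qed
    have "(Base p1 p2, None, Link p1 p2 q1 q2 0) \<notin> set L" "(Link p1 p2 q1 q2 (length ys), None, Base q1 q2) \<notin> set L"
      by (rule notI, drule L, simp)+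
    ultimately show ?thesis by (simp add: chain_abs_def L_def[symmetric])
  qed
  then have "distinct chains_abs"
    unfolding chains_abs_product
  proof (intro distinct_concat_map distinct_product l1(1) l2(1))
    fix z z' w assume "w \<in> set (case z of (p1, p2, q1, q2) \<Rightarrow> chain_abs p1 p2 q1 q2)"
      "w \<in> set (case z' of (p1, p2, q1, q2) \<Rightarrow> chain_abs p1 p2 q1 q2)"
    moreover obtain p1 p2 q1 q2 where z: "z = (p1, p2, q1, q2)" by (cases z) auto
    moreover obtain p1' p2' q1' q2' where z': "z' = (p1', p2', q1', q2')" by (cases z') auto
    moreover obtain u l v where w: "w = (u, l, v)" by (cases w) auto
    ultimately have m: "(u, l, v) \<in> set (chain_abs p1 p2 q1 q2)" "(u, l, v) \<in> set (chain_abs p1' p2' q1' q2')" by simp_all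
    show "z = z'" unfolding z z'
      by (rule trans[OF chain_abs_index[OF m(1), of z, symmetric] chain_abs_index[OF m(2)]])
  qed auto
  moreover have "t \<notin> set chains_abs" if "t \<in> set letters_abs" for t
  proof -
    have "\<exists>p1 p2 q1 q2. fst t = Base p1 p2 \<and> snd (snd t) = Base q1 q2"
      using that by (auto simp: letters_abs_def letter_abs_def split: if_splits)
    moreover have "\<not> (fst t = Base a b \<and> snd (snd t) = Base c d)" if "t \<in> set (chain_abs p1 p2 q1 q2)" for p1 p2 q1 q2 a b c d
    proof -
      obtain u l w where t: "t = (u, l, w)" by (cases t) auto
      from that[unfolded t set_chain_abs] show ?thesis unfolding t by (elim conjE disjE exE) simp_all
    qed
    ultimately have "t \<notin> set (chain_abs p1 p2 q1 q2)" for p1 p2 q1 q2 by blast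
    then show ?thesis by (simp add: chains_abs_def)
  qed
  ultimately show ?thesis by auto
qed

definition result_automaton :: "('a, nat, nat) vset_automaton" where
  "result_automaton = rename (name W) (join_automaton A1 A2 ys)"

lemma result_automaton: "vset_automaton result_automaton" "functional result_automaton"
  "spanner_of result_automaton = join (spanner_of A1) (spanner_of A2)"
proof -
  have s: "states (join_automaton A1 A2 ys) = jstates A1 A2 (length ys)" by (simp add: join_automaton_def)
  note J = vset_automaton_join_automaton inj_name[folded s]
  show "vset_automaton result_automaton" unfolding result_automaton_def by (rule vset_automaton_rename[OF J(1)])
  show "functional result_automaton"
    unfolding result_automaton_def functional_rename[OF J] by (rule functional_join_automaton)
  show "spanner_of result_automaton = join (spanner_of A1) (spanner_of A2)"
    unfolding result_automaton_def spanner_of_rename[OF J] by (rule spanner_of_join_automaton)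
qed

lemma encodes_result: "encodes code result_automaton final_word"
proof -
  let ?ts = "letters_list @ chains_list"
  have ts: "?ts = map name_trans (letters_abs @ chains_abs)" by (simp add: letters_list_abs chains_list_abs)
  have mem: "fst t \<in> jstates A1 A2 (length ys) \<and> snd (snd t) \<in> jstates A1 A2 (length ys)"
    if "t \<in> set (letters_abs @ chains_abs)" for t
  proof -
    obtain u l w where t: "t = (u, l, w)" by (cases t) auto
    have "w \<in> delta (join_automaton A1 A2 ys) u l"
      using that unfolding t set_trans_abs by (simp add: join_automaton_def)
    then have "u \<in> states (join_automaton A1 A2 ys) \<and> w \<in> states (join_automaton A1 A2 ys)"
      using vset_automaton_join_automaton unfolding vset_automaton_def by blast
    then show ?thesis by (simp add: t join_automaton_def)
  qed
  have "inj_on name_trans (set (letters_abs @ chains_abs))"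
  proof (rule inj_onI)
    fix t t' assume t: "t \<in> set (letters_abs @ chains_abs)" "t' \<in> set (letters_abs @ chains_abs)" "name_trans t = name_trans t'"
    then have "name W (fst t) = name W (fst t')" "fst (snd t) = fst (snd t')" "name W (snd (snd t)) = name W (snd (snd t'))"
      by (simp_all add: name_trans_def split_beta)
    then show "t = t'" using mem[OF t(1)] mem[OF t(2)] inj_onD[OF inj_name]
      by (intro prod_eqI) blast+
  qed
  then have d: "distinct ?ts" unfolding ts distinct_map using distinct_trans_abs by simp
  have "distinct states_list" unfolding states_list_abs distinct_map set_states_abs
    using distinct_states_abs inj_name by simp
  moreover have "set states_list = states result_automaton"
    by (simp add: states_list_abs set_states_abs result_automaton_def rename_def join_automaton_def)
  moreover have "set mv = vars result_automaton"
    by (simp add: set_mv result_automaton_def rename_def join_automaton_def)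
  moreover have "set ?ts = {(p, l, q). q \<in> delta result_automaton p l}"
  proof -
    have d: "q \<in> delta result_automaton p l \<longleftrightarrow> (\<exists>u w. jtrans A1 A2 ys u l w \<and> p = name W u \<and> q = name W w)" for p l q
      by (auto simp: result_automaton_def rename_def join_automaton_def)
    have "(p, l, q) \<in> set ?ts \<longleftrightarrow> (\<exists>u w. jtrans A1 A2 ys u l w \<and> p = name W u \<and> q = name W w)" for p l q
    proof
      assume "(p, l, q) \<in> set ?ts"
      then obtain t where t: "t \<in> set (letters_abs @ chains_abs)" "(p, l, q) = name_trans t" unfolding ts set_map by blast
      obtain u l' w where u: "t = (u, l', w)" by (cases t) auto
      then have "jtrans A1 A2 ys u l' w" using t(1) set_trans_abs by blast
      then show "\<exists>u w. jtrans A1 A2 ys u l w \<and> p = name W u \<and> q = name W w"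
        using t(2) by (auto simp: u name_trans_def)
    next
      assume "\<exists>u w. jtrans A1 A2 ys u l w \<and> p = name W u \<and> q = name W w"
      then obtain u w where u: "jtrans A1 A2 ys u l w" "p = name W u" "q = name W w" by blast
      then have "(u, l, w) \<in> set (letters_abs @ chains_abs)" using set_trans_abs by blast
      then have "name_trans (u, l, w) \<in> set ?ts" unfolding ts set_map by (rule imageI)
      then show "(p, l, q) \<in> set ?ts" using u(2,3) by (simp add: name_trans_def)
    qed
    then have e: "(p, l, q) \<in> set ?ts \<longleftrightarrow> (p, l, q) \<in> {(p, l, q). q \<in> delta result_automaton p l}" for p l q
      unfolding mem_Collect_eq prod.case d .
    show ?thesis
    proof (rule set_eqI)
      fix t show "t \<in> set ?ts \<longleftrightarrow> t \<in> {(p, l, q). q \<in> delta result_automaton p l}"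
        using e by (cases t) blast
    qed
  qed
  moreover have "base i1 i2 = initial result_automaton" "base f1 f2 = final result_automaton"
    by (simp_all add: result_automaton_def rename_def join_automaton_def l1 l2)
  moreover have "trans_word code = (\<lambda>(p, l, q). p # encode_label code l @ [q])"
    by (auto simp: fun_eq_iff)
  ultimately show ?thesis
    unfolding encodes_def final_word_def auto_word_def using d distinct_mv
    by (intro exI[of _ states_list] exI[of _ mv] exI[of _ ?ts]) simp
qed

end

section \<open>Running time and word size\<close>

lemmas reads_defs = accessE_defs cellE_def readE_def baseE_def linkE_def mvarE_def

text \<open>The program itself uses registers up to 19, so a stack from register 40 on does not
  interfere.\<close>

lemma wf_tables: "wf_com 40 tables"
  by (simp add: tables_def flags_def eps_edges_def warshall_def op_table_def merge_vars_def push_def reads_defs Let_def)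

lemma wf_writers: "wf_com 40 write_states" "wf_com 40 write_vars" "wf_com 40 fix_count"
  by (simp_all add: write_states_def write_vars_def fix_count_def emit_def reads_defs)

lemma wf_letters_head: "wf_com 40 write_letters" "wf_com 40 write_head"
  by (simp_all add: write_letters_def write_head_def emit_def reads_defs Let_def)

lemma wf_link: "i = Var 18 \<or> i = Plus (Var 6) (Var 18) \<Longrightarrow> wf_com 40 (write_link kd i)"
  by (auto simp: write_link_def emit_def reads_defs Let_def)

lemma writes_link: "writes (write_link kd i) = {}"
  by (simp add: write_link_def Let_def)

lemma wf_chains: "wf_com 40 write_chains"
proof -
  have "writes write_chain = {18, 19}" by (simp add: write_chain_def writes_link)
  moreover have "wf_com 40 write_chain"
    by (simp add: write_chain_def wf_link writes_link emit_def reads_defs)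
  ultimately show ?thesis by (simp add: write_chains_def reads_defs)
qed

lemma wf_program: "wf_com 40 program"
  using wf_tables wf_writers wf_letters_head wf_chains
  by (simp add: program_def main_def word_base_def lengthE_def write_output_def reads_defs)

context two_encodings
begin

lemma program_computes:
  assumes W: "W = 10 + (\<Sum>i<N. xs ! i + 1)" and N1: "N1 = length (auto_word code qs1 vs1 ts1 i1 f1)"
    and N: "N = N1 + length (auto_word code qs2 vs2 ts2 i2 f2)" and B: "B = 2 ^ w"
  shows "computes_within w (compile 40 0 program) xs
    (600 + 100 * (N + 1) + table_time + 1000 * (out_time + 1)) final_word"
proof -
  let ?f = "\<lambda>_. 0 :: nat" and ?m = "\<lambda>i. if i < N then xs ! i else 0"
  obtain f m where r: "run main (?f, ?m) = (f, m)" by fastforce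
  have "safe B main (?f, ?m) \<and> cost main (?f, ?m) \<le> 500 + 100 * (N + 1) + table_time + 1000 * (out_time + 1) \<and>
      snd (f, m) 0 = OUT \<and> snd (f, m) OUT = OUT + 1 + length final_word \<and>
      (\<forall>i<length final_word. snd (f, m) (OUT + 1 + i) = final_word ! i)"
    using main_triple[OF W N1 N edges_subset room] unfolding triple_def r[symmetric] by simp
  then have main: "safe B main (?f, ?m)" "m 0 = OUT" "m OUT = OUT + 1 + length final_word"
    "\<And>i. i < length final_word \<Longrightarrow> m (OUT + 1 + i) = final_word ! i"
    "cost main (?f, ?m) \<le> 500 + 100 * (N + 1) + table_time + 1000 * (out_time + 1)"
    by simp_all
  have len: "length final_word \<le> out_time"
    using out_word_emits by (simp add: emits_def final_word_eq)
  then have OB: "OUT + 1 + length final_word < B" using room by linarith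
  have NW: "N < B" using less_B[of N] W machine_axioms by (simp add: machine_def)
  show ?thesis
  proof (rule computes_within_compile[where m = m and f = "f(0 := OUT + 1, 1 := length final_word)"])
    show "length xs \<le> 2 ^ w" using NW machine_axioms B by (simp add: machine_def)
    show "\<forall>x\<in>set xs. x < 2 ^ w" using machine_axioms less_B B by (auto simp: machine_def)
    have xs: "length xs = N" using machine_axioms by (simp add: machine_def)
    show "safe (2 ^ w) program (?f, \<lambda>i. if i < length xs then xs ! i else 0)"
      unfolding xs B[symmetric] program_def using main r OB by simp
    show "cost program (?f, \<lambda>i. if i < length xs then xs ! i else 0)
        \<le> 600 + 100 * (N + 1) + table_time + 1000 * (out_time + 1)"
      unfolding xs program_def using main by simp
    show "run program (?f, \<lambda>i. if i < length xs then xs ! i else 0) = (f(0 := OUT + 1, 1 := length final_word), m)"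
      unfolding xs program_def using main r by simp
    show "map m [(f(0 := OUT + 1, 1 := length final_word)) 0..<
        (f(0 := OUT + 1, 1 := length final_word)) 0 + (f(0 := OUT + 1, 1 := length final_word)) 1] = final_word"
      using main(4) by (intro nth_equalityI) (simp_all del: upt_Suc)
  qed (use OB B wf_program in simp_all)
qed

end

context two_segments
begin

text \<open>All products in \<open>out_time\<close> have at most five factors, each at most
  \<open>W\<close>, so it is at most \<open>10000 * W ^ 5\<close>; then \<open>W \<ge> 10\<close>
  trades a factor 100 for two more powers of \<open>W\<close>.\<close>

lemma room_le: "OUT + 6 * out_time + 100 \<le> 1000 * W ^ 7"
proof -
  note l = s1.seg_less s2.seg_less W mv_less
  have a: "length qs1 + 1 \<le> W" "length qs2 + 1 \<le> W" "length ts1 + 1 \<le> W" "length ts2 + 1 \<le> W"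
    "length mv + 1 \<le> W" "2 * length mv + 1 + 1 \<le> W"
    "length (filter (\<lambda>t. kind (fst (snd t)) = 1) ts1) \<le> W"
    using l length_filter_le[of "\<lambda>t. kind (fst (snd t)) = 1" ts1] by linarith+
  have p: "W ^ k \<le> W ^ 5" if "k \<le> 5" for k using that W10 by (intro power_increasing) auto
  have 2: "x * y \<le> W ^ 5" if "x \<le> W" "y \<le> W" for x y
    using mult_le_mono[OF that] p[of 2] by (simp add: power2_eq_square)
  have 1: "x \<le> W ^ 5" if "x \<le> W" for x using that p[of 1] by simp
  have 5: "(length qs1 + 1) * ((length qs2 + 1) * ((length qs1 + 1) * ((length qs2 + 1) * (y * 1)))) \<le> W ^ 5" if "y \<le> W" for y
  proof -
    have "(length qs1 + 1) * ((length qs2 + 1) * ((length qs1 + 1) * ((length qs2 + 1) * (y * 1)))) \<le>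
        W * (W * (W * (W * (W * 1))))" using a that by (intro mult_le_mono order_refl)
    then show ?thesis by (simp add: numeral_eq_Suc)
  qed
  have "1 \<le> W ^ 5" using W10 by simp
  then have o: "out_time \<le> 10000 * W ^ 5"
    unfolding out_time_def using 2[OF a(1,2)] 5[OF a(6)] 5[OF a(5)] 1[OF a(5)] 1[OF a(3)] 2[OF a(7,4)]
    by simp
  have "10 * 10 * W ^ 5 \<le> W * W * W ^ 5" using W10 by (intro mult_le_mono) auto
  then have "100 * W ^ 5 \<le> W ^ 7" by (simp add: numeral_eq_Suc)
  moreover have "W ^ 6 \<le> W ^ 7" using W10 by (intro power_increasing) auto
  ultimately show ?thesis using OUT_B(1) o \<open>1 \<le> W ^ 5\<close> by linarith
qed

text \<open>Every summand is at most the single monomial \<open>Z\<close>. The square of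
  \<open>D\<close> comes from pairing letter transitions with transitions, the fifth power of
  \<open>E\<close> from the loops over two pairs of states and a chain, and the power 4 of
  \<open>n\<close> from these and from the operation table.\<close>

lemma time_le:
  assumes E: "length qs1 + 1 \<le> E * n" "length qs2 + 1 \<le> E * n" "length vs1 + 1 \<le> E * v" "length vs2 + 1 \<le> E * v"
      "2 * length mv + 1 + 1 \<le> E * v"
    and D: "length ts1 + 1 \<le> D * v * n ^ 2" "length ts2 + 1 \<le> D * v * n ^ 2"
      "length (filter (\<lambda>t. kind (fst (snd t)) = 1) ts1) \<le> D * n ^ 2"
    and pos: "1 \<le> D" "1 \<le> E" "1 \<le> n" "1 \<le> v"
    and N: "N = 10 + length qs1 + length vs1 + 4 * length ts1 + length qs2 + length vs2 + 4 * length ts2"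
  shows "600 + 100 * (N + 1) + table_time + 1000 * (out_time + 1) \<le> 10000000 * (D ^ 2 * E ^ 5 * v * n ^ 4)"
proof -
  define Z where "Z = D ^ 2 * E ^ 5 * v * n ^ 4"
  have Z: "D ^ i * E ^ j * v ^ k * n ^ l \<le> Z" if "i \<le> 2" "j \<le> 5" "k \<le> 1" "l \<le> 4" for i j k l
  proof -
    have "D ^ i * E ^ j * v ^ k * n ^ l \<le> D ^ 2 * E ^ 5 * v ^ 1 * n ^ 4"
      using that pos by (intro mult_le_mono power_increasing)
    then show ?thesis by (simp add: Z_def)
  qed
  have mv: "length mv + 1 \<le> E * v" using E(5) by linarith
  have 1: "1 \<le> Z" using Z[of 0 0 0 0] by simp
  have q: "E * n \<le> Z" and v: "E * v \<le> Z" and t: "D * v * n ^ 2 \<le> Z"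
    using Z[of 0 1 0 1] Z[of 0 1 1 0] Z[of 1 0 1 2] by simp_all
  have q2: "x * (y * 1) \<le> Z" if "x \<le> E * n" "y \<le> E * n" for x y
    using mult_le_mono[OF that] Z[of 0 2 0 2] by (simp add: power2_eq_square algebra_simps)
  have q3: "x * (x * (x * 1)) \<le> Z" if "x \<le> E * n" for x
  proof -
    have "x * (x * (x * 1)) \<le> (E * n) * ((E * n) * ((E * n) * 1))"
      using that by (intro mult_le_mono order_refl)
    then show ?thesis using Z[of 0 3 0 3] by (simp add: numeral_eq_Suc algebra_simps)
  qed
  have tqq: "x * (y * (y * 1)) \<le> Z" if "x \<le> D * v * n ^ 2" "y \<le> E * n" for x y
  proof -
    have "x * (y * (y * 1)) \<le> (D * v * n ^ 2) * ((E * n) * ((E * n) * 1))"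
      using that by (intro mult_le_mono order_refl)
    then show ?thesis using Z[of 1 2 1 4] by (simp add: numeral_eq_Suc algebra_simps)
  qed
  have lt: "x * y \<le> Z" if "x \<le> D * n ^ 2" "y \<le> D * v * n ^ 2" for x y
    using mult_le_mono[OF that] Z[of 2 0 1 4] by (simp add: numeral_eq_Suc algebra_simps)
  have q5: "x * (y * (x * (y * (z * 1)))) \<le> Z" if "x \<le> E * n" "y \<le> E * n" "z \<le> E * v" for x y z
  proof -
    have "x * (y * (x * (y * (z * 1)))) \<le> (E * n) * ((E * n) * ((E * n) * ((E * n) * ((E * v) * 1))))"
      using that by (intro mult_le_mono order_refl)
    then show ?thesis using Z[of 0 5 1 4] by (simp add: numeral_eq_Suc algebra_simps)
  qed
  have s: "length qs1 + 1 \<le> Z" "length qs2 + 1 \<le> Z" "length vs1 + 1 \<le> Z" "length vs2 + 1 \<le> Z"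
    "length ts1 + 1 \<le> Z" "length ts2 + 1 \<le> Z" "length mv + 1 \<le> Z"
    using E D mv q v t by linarith+
  have "300 + ((500 * x1 + 800 * x2) + (100 * (x3 * 1) + ((300 * x4 + 1000 * x5) + 5000 * x6))) \<le> 8000 * Z"
    if "x1 \<le> Z" "x2 \<le> Z" "x3 \<le> Z" "x4 \<le> Z" "x5 \<le> Z" "x6 \<le> Z" for x1 x2 x3 x4 x5 x6
    using that 1 by linarith
  then have o: "out_time \<le> 8000 * Z"
    unfolding out_time_def using q2[OF E(1,2)] q5[OF E(1,2,5)] s(7,5) lt[OF D(3,2)] q5[OF E(1,2) mv] .
  have "100 * (y1 * 1) + (100 * (y2 * 1) + ((100 * (y3 * 1) + 300 * (y5 * 1)) + ((500 * x1) +
      ((100 * (y4 * 1) + 300 * (y6 * 1)) + ((500 * x2) + ((600 * x3) + ((600 * x4) +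
      (300 * (y1 * 1) + 400 * (y2 * 1))))))))) \<le> 4000 * Z"
    if "y1 \<le> Z" "y2 \<le> Z" "y3 \<le> Z" "y4 \<le> Z" "y5 \<le> Z" "y6 \<le> Z" "x1 \<le> Z" "x2 \<le> Z" "x3 \<le> Z" "x4 \<le> Z"
    for y1 y2 y3 y4 y5 y6 x1 x2 x3 x4 using that by linarith
  then have t: "table_time \<le> 4000 * Z"
    unfolding table_time_def using s(3,4,1,2,5,6) q3[OF E(1)] q3[OF E(2)] tqq[OF D(1) E(1)] tqq[OF D(2) E(2)] .
  have N: "N + 1 \<le> 30 * Z" using s 1 N by linarith
  have "600 + 100 * (N + 1) + table_time + 1000 * (out_time + 1) \<le>
      600 * Z + 100 * (30 * Z) + 4000 * Z + 1000 * (8000 * Z + Z)"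
    using 1 by (intro add_mono mult_le_mono2 N t o) simp_all
  then show ?thesis unfolding Z_def[symmetric] by simp
qed

end

lemma computes_within_mono:
  assumes "computes_within w P xs T ys" "T \<le> T'"
  shows "computes_within w P xs T' ys"
  using assms unfolding computes_within_def Let_def by (blast intro: le_trans)

text \<open>The number of variables enters through the labels only. For a fixed alphabet, letter
  transitions are therefore quadratic in the number of states, free of \<open>v\<close>.\<close>

lemma length_transitions:
  fixes A :: "('a::finite, nat, nat) vset_automaton"
  assumes A: "vset_automaton A" and ts: "distinct ts" "set ts = {(p, l, q). q \<in> delta A p l}"
    and Q: "card (states A) \<le> m" and V: "card (vars A) \<le> k"
  shows "length ts \<le> m * ((1 + card (UNIV :: 'a set) + 2 * k) * m)"
    and "length (filter (\<lambda>t. kind (fst (snd t)) = 1) ts) \<le> m * (card (UNIV :: 'a set) * m)"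
proof -
  have fin: "finite (vars A)" "finite (states A)" using A by (simp_all add: vset_automaton_def)
  let ?Y = "symbols (vars A) :: ('a, nat) symbol set"
  let ?L = "insert None (Some ` ?Y)"
  have "card ?Y \<le> card (UNIV :: 'a set) + k + k"
    unfolding symbols_def
    by (intro order_trans[OF card_Un_le] add_mono order_trans[OF card_image_le] V) (use fin in simp_all)
  moreover have "card (Some ` ?Y) \<le> card ?Y"
    by (rule card_image_le) (use fin in \<open>simp add: symbols_def\<close>)
  moreover have "card ?L \<le> 1 + card (Some ` ?Y)"
    by (simp add: card_insert_le_m1 card_insert_if fin symbols_def)
  ultimately have L: "card ?L \<le> 1 + card (UNIV :: 'a set) + 2 * k" by linarith
  have "set ts \<subseteq> states A \<times> ?L \<times> states A"
    using A unfolding ts vset_automaton_def by blast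
  then have "card (set ts) \<le> card (states A \<times> ?L \<times> states A)"
    by (intro card_mono) (use fin in \<open>simp_all add: symbols_def\<close>)
  also have "\<dots> \<le> m * ((1 + card (UNIV :: 'a set) + 2 * k) * m)"
    unfolding card_cartesian_product by (intro mult_le_mono Q L)
  finally show "length ts \<le> m * ((1 + card (UNIV :: 'a set) + 2 * k) * m)"
    by (simp add: distinct_card[OF ts(1)])
  let ?S = "range (\<lambda>a. Some (Letter a)) :: ('a, nat) symbol option set"
  have "set (filter (\<lambda>t. kind (fst (snd t)) = 1) ts) \<subseteq> states A \<times> ?S \<times> states A"
    using A by (auto simp: ts vset_automaton_def kind_1_iff[unfolded One_nat_def])
  then have "card (set (filter (\<lambda>t. kind (fst (snd t)) = 1) ts)) \<le> card (states A \<times> ?S \<times> states A)"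
    by (intro card_mono) (use fin in simp_all)
  also have "\<dots> \<le> m * (card (UNIV :: 'a set) * m)"
    unfolding card_cartesian_product by (intro mult_le_mono Q card_image_le) simp
  finally show "length (filter (\<lambda>t. kind (fst (snd t)) = 1) ts) \<le> m * (card (UNIV :: 'a set) * m)"
    using distinct_card[OF distinct_filter[OF ts(1)]] by metis
qed

lemma auto_word_le:
  assumes "x \<in> set (auto_word code qs vs ts i f)"
    and "length qs \<le> b" "length vs \<le> b" "length ts \<le> b" "i \<le> b" "f \<le> b" "3 \<le> b"
    and "\<forall>q\<in>set qs. q \<le> b" "\<forall>y\<in>set vs. y \<le> b" "\<And>a. code a \<le> b"
    and ts: "\<And>p l q. (p, l, q) \<in> set ts \<Longrightarrow> p \<in> set qs \<and> q \<in> set qs \<and> l \<in> insert None (Some ` symbols (set vs))"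
  shows "x \<le> b"
proof -
  have "x \<le> b" if t: "(p, l, q) \<in> set ts" and x: "x \<in> set (trans_word code (p, l, q))" for p l q
  proof -
    have "kind l \<le> b" using assms(7) by (auto simp: kind_def split: option.splits symbol.splits)
    moreover have "arg code l \<le> b"
      using assms(9,10) ts[OF t] by (auto simp: arg_def symbols_def split: option.splits symbol.splits)
    moreover have "p \<le> b" "q \<le> b" using assms(8) ts[OF t] by auto
    ultimately show ?thesis using x unfolding trans_word_eq by auto
  qed
  then show ?thesis using assms(1-9) by (fastforce simp: auto_word_def simp del: trans_word.simps)
qed

text \<open>One program serves all inputs. The time constant \<open>c\<close> results from
  \<open>a\<close> and the alphabet size; the word size must also accommodate the names of states
  and variables and the letter codes, hence \<open>k\<close> is chosen after
  \<open>d\<close>.\<close>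

theorem lemma3p10:
  fixes code :: "'a::finite \<Rightarrow> nat"
  assumes "card (UNIV :: 'a set) \<ge> 2" and "inj code"
  shows "\<exists>P. \<forall>a. \<exists>c. \<forall>d. \<exists>k. \<forall>n\<ge>1. \<forall>v\<ge>1.
    \<forall>(A1 :: ('a, nat, nat) vset_automaton) (A2 :: ('a, nat, nat) vset_automaton) xs1 xs2 N.
      vset_automaton A1 \<and> functional A1 \<and> vset_automaton A2 \<and> functional A2 \<and>
      card (states A1) \<le> a * n \<and> card (states A2) \<le> a * n \<and>
      card (vars A1) \<le> a * v \<and> card (vars A2) \<le> a * v \<and>
      encodes code A1 xs1 \<and> encodes code A2 xs2 \<and> N = length (xs1 @ xs2) \<and>
      (\<forall>z \<in> states A1 \<union> vars A1 \<union> states A2 \<union> vars A2. z \<le> N ^ d)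
      \<longrightarrow> (\<exists>A ys.
            computes_within (k * floorlog 2 N) P (xs1 @ xs2) (c * v * n ^ 4) ys \<and>
            encodes code A ys \<and> vset_automaton A \<and> functional A \<and>
            spanner_of A = join (spanner_of A1) (spanner_of A2))"
proof -
  define mc where "mc = Max (range code)"
  have mc: "code x \<le> mc" for x unfolding mc_def by (intro Max_ge) auto
  have correct: "\<exists>A ys. computes_within ((3 + 7 * (d + mc + 7)) * floorlog 2 N) (compile 40 0 program) (xs1 @ xs2)
        (10000000 * ((a\<^sup>2 * (1 + card (UNIV :: 'a set) + 2 * a) + 1)\<^sup>2 * (4 * a + 2) ^ 5) * v * n ^ 4) ys \<and>
      encodes code A ys \<and> vset_automaton A \<and> functional A \<and>
      spanner_of A = join (spanner_of A1) (spanner_of A2)"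
    if nv: "1 \<le> n" "1 \<le> v"
      and A1: "vset_automaton A1" "functional A1" and A2: "vset_automaton A2" "functional A2"
      and card: "card (states A1) \<le> a * n" "card (states A2) \<le> a * n"
        "card (vars A1) \<le> a * v" "card (vars A2) \<le> a * v"
      and e1: "encodes code A1 xs1" and e2: "encodes code A2 xs2" and N: "N = length (xs1 @ xs2)"
      and d: "\<forall>z \<in> states A1 \<union> vars A1 \<union> states A2 \<union> vars A2. z \<le> N ^ d"
    for a d n v N and A1 A2 :: "('a, nat, nat) vset_automaton" and xs1 xs2
  proof -
    have tw: "trans_word code = (\<lambda>(p, l, q). p # encode_label code l @ [q])" by (auto simp: fun_eq_iff)
    from e1 obtain qs1 vs1 ts1 where L1: "distinct qs1" "set qs1 = states A1" "distinct vs1" "set vs1 = vars A1"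
        "distinct ts1" "set ts1 = {(p, l, q). q \<in> delta A1 p l}"
        "xs1 = auto_word code qs1 vs1 ts1 (initial A1) (final A1)"
      unfolding encodes_def auto_word_def tw by blast
    from e2 obtain qs2 vs2 ts2 where L2: "distinct qs2" "set qs2 = states A2" "distinct vs2" "set vs2 = vars A2"
        "distinct ts2" "set ts2 = {(p, l, q). q \<in> delta A2 p l}"
        "xs2 = auto_word code qs2 vs2 ts2 (initial A2) (final A2)"
      unfolding encodes_def auto_word_def tw by blast
    define xs where "xs = xs1 @ xs2"
    define W where "W = 10 + (\<Sum>i<N. xs ! i + 1)"
    define w where "w = (3 + 7 * (d + mc + 7)) * floorlog 2 N"
    \<comment> \<open>A bound on all input words: \<open>N ^ d\<close> for states and variables,
      \<open>N\<close> for the counts, \<open>mc\<close> for letter codes and 3 for label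
      kinds.\<close>
    define b where "b = N ^ d + N + mc + 3"
    have len: "length xs1 = 5 + length qs1 + length vs1 + 4 * length ts1"
      "length xs2 = 5 + length qs2 + length vs2 + 4 * length ts2"
      by (simp_all add: L1 L2 auto_word_def)
    have N': "N = length xs1 + length xs2" "length xs = N" by (simp_all add: N xs_def)
    have st: "initial A1 \<in> states A1" "final A1 \<in> states A1" "initial A2 \<in> states A2" "final A2 \<in> states A2"
      using A1(1) A2(1) by (simp_all add: vset_automaton_def)
    have Nb: "N \<le> b" "3 \<le> b" by (simp_all add: b_def)
    have db: "\<forall>z \<in> states A1. z \<le> b" "\<forall>z \<in> vars A1. z \<le> b" "\<forall>z \<in> states A2. z \<le> b" "\<forall>z \<in> vars A2. z \<le> b"
      unfolding b_def using d by (simp_all add: trans_le_add1)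
    have N10: "10 \<le> N" using N' len by linarith
    have "x \<le> b" if "x \<in> set xs1" for x
    proof (rule auto_word_le)
      show "x \<in> set (auto_word code qs1 vs1 ts1 (initial A1) (final A1))" using that L1 by simp
      show "code y \<le> b" for y using mc[of y] by (simp add: b_def)
      show "p \<in> set qs1 \<and> q \<in> set qs1 \<and> l \<in> insert None (Some ` symbols (set vs1))" if "(p, l, q) \<in> set ts1" for p l q
        using that A1(1) unfolding L1 vset_automaton_def by blast
    qed (use N' len Nb db st in \<open>simp_all add: L1\<close>)
    moreover have "x \<le> b" if "x \<in> set xs2" for x
    proof (rule auto_word_le)
      show "x \<in> set (auto_word code qs2 vs2 ts2 (initial A2) (final A2))" using that L2 by simp
      show "code y \<le> b" for y using mc[of y] by (simp add: b_def)
      show "p \<in> set qs2 \<and> q \<in> set qs2 \<and> l \<in> insert None (Some ` symbols (set vs2))" if "(p, l, q) \<in> set ts2" for p l q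
        using that A2(1) unfolding L2 vset_automaton_def by blast
    qed (use N' len Nb db st in \<open>simp_all add: L2\<close>)
    ultimately have xs_b: "x \<le> b" if "x \<in> set xs" for x using that by (auto simp: xs_def)
    have "(\<Sum>i<N. xs ! i + 1) \<le> (\<Sum>i<N. b + 1)"
      using xs_b N' by (intro sum_mono add_mono) auto
    then have Wb: "W \<le> 10 + N * (b + 1)" by (simp add: W_def)
    have pw: "N ^ i \<le> N ^ j" if "i \<le> j" for i j using that N10 by (intro power_increasing) auto
    define e where "e = d + mc + 4"
    \<comment> \<open>Additive constants are absorbed into powers of \<open>N\<close>, which is
      possible because the two headers already give \<open>N \<ge> 10\<close>.\<close>
    have "mc + 4 \<le> 2 ^ (mc + 4)" by (rule less_imp_le) (rule less_exp)
    also have "\<dots> \<le> N ^ (mc + 4)" using N10 by (intro power_mono) auto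
    also have "\<dots> \<le> N ^ e" by (rule pw) (simp add: e_def)
    finally have "b + 1 \<le> 3 * N ^ e" using pw[of d e] pw[of 1 e] unfolding b_def e_def by simp
    then have "N * (b + 1) \<le> N * (3 * N ^ e)" by (rule mult_le_mono2)
    moreover have "N \<le> N ^ (e + 1)" using pw[of 1 "e + 1"] by simp
    moreover have "N * (3 * N ^ e) = 3 * N ^ (e + 1)" by simp
    ultimately have "W \<le> 4 * N ^ (e + 1)" using Wb N10 by linarith
    also have "\<dots> \<le> N * N ^ (e + 1)" using N10 by (intro mult_le_mono1) simp
    also have "\<dots> \<le> N ^ (d + mc + 7)" unfolding power_Suc[symmetric] by (rule pw) (simp add: e_def)
    finally have WN: "W \<le> N ^ (d + mc + 7)" .
    \<comment> \<open>The 3 in the word size pays for the factor 1000, and the 7 for the seventh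
      power of \<open>W\<close>.\<close>
    have "1000 * W ^ 7 \<le> N ^ 3 * (N ^ (d + mc + 7)) ^ 7"
      using power_mono[OF N10, of 3] by (intro mult_le_mono power_mono WN) simp_all
    also have "\<dots> = N ^ (3 + 7 * (d + mc + 7))" by (simp only: power_add power_mult mult.commute[of 7])
    also have "\<dots> \<le> (2 ^ floorlog 2 N) ^ (3 + 7 * (d + mc + 7))"
      using floorlog_bounds[of N 2] N10 by (intro power_mono) auto
    also have "\<dots> = 2 ^ w" by (simp add: w_def power_mult[symmetric] mult.commute)
    finally have WB: "1000 * W ^ 7 \<le> 2 ^ w" .
    have WN2: "W = 10 + (\<Sum>i<N. xs ! i) + N" by (simp add: W_def sum.distrib sum_Suc)
    \<comment> \<open>The two variable counts are themselves input words, at these positions, so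
      they occur in the sum defining \<open>W\<close>. They occur a second time in \<open>N\<close>,
      because the variables are listed; this gives the factor 2.\<close>
    have "(\<Sum>i\<in>{1, length xs1 + 1}. xs ! i) \<le> (\<Sum>i<N. xs ! i)"
      using N' len by (intro sum_mono2) auto
    moreover have "xs ! 1 = length vs1" "xs ! (length xs1 + 1) = length vs2"
      by (simp_all add: xs_def nth_append len) (simp_all add: L1 L2 auto_word_def)
    moreover have "1 \<noteq> length xs1 + 1" using len by simp
    ultimately have vless: "2 * (length vs1 + length vs2) + 10 \<le> W"
      using WN2 N' len by simp
    interpret two_segments W "2 ^ w" N "length xs1" xs code qs1 vs1 ts1 "initial A1" "final A1"
      qs2 vs2 ts2 "initial A2" "final A2"
    proof unfold_locales
      show "N + 10 \<le> W" using WN2 by simp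
      show "W ^ 7 \<le> 2 ^ w" using WB by simp
      show "\<forall>x\<in>set xs. x < W"
      proof
        fix x assume "x \<in> set xs"
        then obtain i where "i < N" "x = xs ! i" using N' by (metis in_set_conv_nth)
        then have "x \<le> (\<Sum>i<N. xs ! i)" by (simp add: member_le_sum)
        then show "x < W" using WN2 by simp
      qed
    qed (use N' vless in \<open>simp_all add: xs_def L1(7)[symmetric] L2(7)[symmetric] nth_append\<close>)
    interpret two_encodings W "2 ^ w" N "length xs1" xs code qs1 vs1 ts1 "initial A1" "final A1"
      qs2 vs2 ts2 "initial A2" "final A2" A1 A2
    proof unfold_locales
      show "OUT + 6 * out_time + 100 \<le> 2 ^ w" using room_le WB by linarith
    qed (use assms(2) A1 A2 L1 L2 in simp_all)
    \<comment> \<open>\<open>D\<close> stems from counting triples of state, label and state, with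
      \<open>1 \<le> v\<close> used to pull \<open>v\<close> out of the number of labels. In
      \<open>E\<close>, \<open>4 * a\<close> covers a chain over at most \<open>2 * a * v\<close>
      variables; the summands 1 and 2 absorb the increments of the loop bounds.\<close>
    define D where "D = a\<^sup>2 * (1 + card (UNIV :: 'a set) + 2 * a) + 1"
    define E where "E = 4 * a + 2"
    have q: "length qs1 \<le> a * n" "length qs2 \<le> a * n" "length vs1 \<le> a * v" "length vs2 \<le> a * v"
      using card L1 L2 distinct_card by metis+
    have Ex: "i + j + 1 + 1 \<le> E * x" if "1 \<le> x" "i \<le> 2 * (a * x)" "j \<le> 2 * (a * x)" for i j x
    proof -
      have "E * x = 4 * (a * x) + 2 * x" by (simp add: E_def algebra_simps)
      then show ?thesis using that by linarith
    qed
    have Dx: "x + 1 \<le> D * v * n ^ 2" if "x \<le> a * n * ((1 + card (UNIV :: 'a set) + 2 * (a * v)) * (a * n))" for x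
    proof -
      have "1 + card (UNIV :: 'a set) + 2 * (a * v) \<le> (1 + card (UNIV :: 'a set) + 2 * a) * v"
        using mult_le_mono2[OF nv(2), of "1 + card (UNIV :: 'a set)"] by (simp add: algebra_simps)
      then have "a * n * ((1 + card (UNIV :: 'a set) + 2 * (a * v)) * (a * n)) \<le>
          a * n * (((1 + card (UNIV :: 'a set) + 2 * a) * v) * (a * n))"
        by (intro mult_le_mono order_refl)
      also have "\<dots> = a\<^sup>2 * (1 + card (UNIV :: 'a set) + 2 * a) * v * n ^ 2"
        by (simp only: power2_eq_square mult_ac)
      finally have "x \<le> a\<^sup>2 * (1 + card (UNIV :: 'a set) + 2 * a) * v * n ^ 2" using that by linarith
      moreover have "1 \<le> v * n ^ 2" using nv by simp
      moreover have "D * v * n ^ 2 = a\<^sup>2 * (1 + card (UNIV :: 'a set) + 2 * a) * v * n ^ 2 + v * n ^ 2"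
        unfolding D_def by (simp only: distrib_right mult_1)
      ultimately show ?thesis by linarith
    qed
    have "length (filter (\<lambda>t. kind (fst (snd t)) = 1) ts1) \<le> a * n * (card (UNIV :: 'a set) * (a * n))"
      by (rule length_transitions(2)[OF A1(1) L1(5,6) card(1,3)])
    also have "\<dots> = (a\<^sup>2 * card (UNIV :: 'a set)) * n ^ 2" by (simp add: power2_eq_square mult_ac)
    also have "\<dots> \<le> D * n ^ 2"
      unfolding D_def by (rule mult_le_mono1, rule trans_le_add1, rule mult_le_mono2) simp
    finally have f: "length (filter (\<lambda>t. kind (fst (snd t)) = 1) ts1) \<le> D * n ^ 2" .
    have "600 + 100 * (N + 1) + table_time + 1000 * (out_time + 1) \<le> 10000000 * (D ^ 2 * E ^ 5 * v * n ^ 4)"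
    proof (rule time_le)
      show "length qs1 + 1 \<le> E * n" "length qs2 + 1 \<le> E * n" "length vs1 + 1 \<le> E * v" "length vs2 + 1 \<le> E * v"
        using Ex[of n 0 "length qs1"] Ex[of n 0 "length qs2"] Ex[of v 0 "length vs1"] Ex[of v 0 "length vs2"] q nv
        by simp_all
      show "2 * length mv + 1 + 1 \<le> E * v"
        using Ex[of v "2 * length vs1" "2 * length vs2"] q nv length_mv by simp
      show "length ts1 + 1 \<le> D * v * n ^ 2" "length ts2 + 1 \<le> D * v * n ^ 2"
        by (rule Dx, rule length_transitions(1)[OF A1(1) L1(5,6) card(1,3)])
          (rule Dx, rule length_transitions(1)[OF A2(1) L2(5,6) card(2,4)])
    qed (use f nv N' len in \<open>simp_all add: D_def E_def\<close>)
    moreover have "computes_within w (compile 40 0 program) xs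
        (600 + 100 * (N + 1) + table_time + 1000 * (out_time + 1)) final_word"
    proof (rule program_computes)
      show "W = 10 + (\<Sum>i<N. xs ! i + 1)" by (rule W_def)
      show "length xs1 = length (auto_word code qs1 vs1 ts1 (initial A1) (final A1))"
        using L1(7) by (rule arg_cong)
      show "N = length xs1 + length (auto_word code qs2 vs2 ts2 (initial A2) (final A2))"
        unfolding N'(1) add_left_cancel using L2(7) by (rule arg_cong)
    qed (rule refl)
    ultimately have "computes_within w (compile 40 0 program) xs (10000000 * (D ^ 2 * E ^ 5 * v * n ^ 4)) final_word"
      by (rule computes_within_mono[rotated])
    then have "computes_within w (compile 40 0 program) xs (10000000 * (D ^ 2 * E ^ 5) * v * n ^ 4) final_word"
      by (simp only: mult.assoc)
    then show ?thesis
      unfolding w_def xs_def D_def E_def using encodes_result result_automaton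
      by (intro exI[of _ result_automaton] exI[of _ final_word] conjI)
  qed
  show ?thesis
  proof (intro exI[of _ "compile 40 0 program"] allI)
    fix a
    show "\<exists>c. \<forall>d. \<exists>k. \<forall>n\<ge>1. \<forall>v\<ge>1.
      \<forall>(A1 :: ('a, nat, nat) vset_automaton) (A2 :: ('a, nat, nat) vset_automaton) xs1 xs2 N.
      vset_automaton A1 \<and> functional A1 \<and> vset_automaton A2 \<and> functional A2 \<and>
      card (states A1) \<le> a * n \<and> card (states A2) \<le> a * n \<and>
      card (vars A1) \<le> a * v \<and> card (vars A2) \<le> a * v \<and>
      encodes code A1 xs1 \<and> encodes code A2 xs2 \<and> N = length (xs1 @ xs2) \<and>
      (\<forall>z \<in> states A1 \<union> vars A1 \<union> states A2 \<union> vars A2. z \<le> N ^ d)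
      \<longrightarrow> (\<exists>A ys.
            computes_within (k * floorlog 2 N) (compile 40 0 program) (xs1 @ xs2) (c * v * n ^ 4) ys \<and>
            encodes code A ys \<and> vset_automaton A \<and> functional A \<and>
            spanner_of A = join (spanner_of A1) (spanner_of A2))"
      by (rule exI[of _ "10000000 * ((a\<^sup>2 * (1 + card (UNIV :: 'a set) + 2 * a) + 1)\<^sup>2 * (4 * a + 2) ^ 5)"],
          rule allI, rule_tac x = "3 + 7 * (d + mc + 7)" in exI)
        (intro allI impI; elim conjE; rule correct; assumption)
  qed
qed

end
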